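(* Let $\mathcal A$ be a Lie algebra of dimension $m=2n-1\ge 3$. If there exists a generic couple $(\alpha,\beta)\in\mathcal A^*\times\mathcal A^*$ such that $\beta\wedge(d\beta)^{n-1}\neq 0$, then on $\mathcal B_{\mathcal A}^*$, the dual space of the secondary algebra $\mathcal B_{\mathcal A}$ of $\mathcal A$, there is some non-flat generic linear Poisson pair.
   Context: Lie algebras are finite-dimensional over $\mathbb K=\mathbb R$ or $\mathbb C$. For $\alpha\in\mathcal A^*$, $d\alpha(a,b)=-\alpha([a,b])$. Secondary algebra: $\mathcal B_{\mathcal A}=\mathcal A\times\mathcal A\times\mathbb K$ with bracket $[(v,v',s),(w,w',t)]=([v,w],\,[v,w']-[w,v']+tv'-sw',\,0)$; its dimension is $2m+1$. Subalgebra $\mathcal A_\alpha$: for $\alpha\in\mathcal A^*$ with $(d\alpha)^{n-1}\neq0$ ($\dim\mathcal A=2n-1$): if $\alpha\wedge(d\alpha)^{n-1}\ne0$ then $\mathcal A_\alpha=0$; if $\alpha\wedge(d\alpha)^{n-1}=0$ then there is $v\in\mathcal A$ with $i_v d\alpha=-\alpha$, unique modulo the line $\mathrm{Ker}\,d\alpha$, and $\mathcal A_\alpha$ is the $2$-dimensional Lie subalgebra spanned by $v$ and $\mathrm{Ker}\,d\alpha$. Generic couples: a couple $(\beta,\beta_1)$ of $2$-forms on a vector space of dimension $2n-1\ge3$ is generic if $(s\beta+t\beta_1)^{n-1}\neq0$ for all $(s,t)\in\mathbb C^2\setminus\{0\}$. A couple $(\alpha,\beta)\in\mathcal A^*\times\mathcal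 A^*$ is generic if $(d\alpha,d\beta)$ is generic and $\mathcal A_{(s\alpha+t\beta)}$ is non-abelian or zero for all $(s,t)\in\mathbb C^2\setminus\{0\}$ (if $\mathcal A$ is real, everything is taken in the complexification). Linear Poisson pair on the dual $\mathcal B^*$ of a Lie algebra $\mathcal B$: a couple $(\Lambda,\Lambda_1)$ where $\Lambda$ is the Lie–Poisson structure of $\mathcal B^*$ ($\Lambda(a,b)=[a,b]$ for $a,b\in\mathcal B$ regarded as linear functions) and $\Lambda_1$ is the constant bi-vector given by some $\beta\in\Lambda^2\mathcal B^*$ with $d\beta=0$. When $\dim\mathcal B=2N-1\ge 3$, it is generic at a point $p$ if $(s\Lambda+t\Lambda_1)^{N-1}(p)\ne0$ for all $(s,t)\in\mathbb C^2\setminus\{0\}$; flat at $p$ if in some local coordinates around $p$ (smooth if $\mathbb K=\mathbb R$, holomorphic if $\mathbb K=\mathbb C$) both bi-vectors have constant coefficients. The pair is generic if it is generic at some point, and flat if it is flat at every generic point. *)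

theory Defs
  imports "HOL-Analysis.Analysis" "HOL-Combinatorics.Permutations"
begin

section \<open>Lie algebras and their duals\<close>

locale lie_algebra = vector_space scl
  for scl :: "'k::field \<Rightarrow> 'a::ab_group_add \<Rightarrow> 'a" +
  fixes bracket :: "'a \<Rightarrow> 'a \<Rightarrow> 'a"
  assumes bracket_linear_right: "Vector_Spaces.linear scl scl (bracket x)"
    and bracket_linear_left: "Vector_Spaces.linear scl scl (\<lambda>x. bracket x y)"
    and bracket_self: "bracket x x = 0"
    and jacobi: "bracket x (bracket y z) + bracket y (bracket z x) + bracket z (bracket x y) = 0"

definition dual_space :: "('k::field \<Rightarrow> 'a::ab_group_add \<Rightarrow> 'a) \<Rightarrow> ('a \<Rightarrow> 'k) set" where
  "dual_space scl = {f. Vector_Spaces.linear scl (*) f}"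

definition two_form ::
    "('k::field \<Rightarrow> 'a::ab_group_add \<Rightarrow> 'a) \<Rightarrow> ('a \<Rightarrow> 'a \<Rightarrow> 'k) \<Rightarrow> bool" where
  "two_form scl \<omega> \<longleftrightarrow>
     (\<forall>x. Vector_Spaces.linear scl (*) (\<omega> x)) \<and>
     (\<forall>y. Vector_Spaces.linear scl (*) (\<lambda>x. \<omega> x y)) \<and>
     (\<forall>x. \<omega> x x = 0)"

text \<open>The Chevalley--Eilenberg differential in degrees 1 and 2.\<close>

definition d_one :: "('a \<Rightarrow> 'a \<Rightarrow> 'a) \<Rightarrow> ('a \<Rightarrow> 'k::ring) \<Rightarrow> 'a \<Rightarrow> 'a \<Rightarrow> 'k" where
  "d_one bracket \<alpha> a b = - \<alpha> (bracket a b)"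

definition d_two ::
    "('a \<Rightarrow> 'a \<Rightarrow> 'a) \<Rightarrow> ('a \<Rightarrow> 'a \<Rightarrow> 'k::ring) \<Rightarrow> 'a \<Rightarrow> 'a \<Rightarrow> 'a \<Rightarrow> 'k" where
  "d_two bracket \<omega> a b c =
     - \<omega> (bracket a b) c + \<omega> (bracket a c) b - \<omega> (bracket b c) a"


section \<open>Exterior products\<close>

text \<open>
  A form of degree \<open>p\<close> is a function of a sequence of vectors that only depends on the
  entries with index below \<open>p\<close>.
\<close>

definition wedge ::
    "nat \<Rightarrow> nat \<Rightarrow> ((nat \<Rightarrow> 'a) \<Rightarrow> 'k::field_char_0) \<Rightarrow> ((nat \<Rightarrow> 'a) \<Rightarrow> 'k) \<Rightarrow> (nat \<Rightarrow> 'a) \<Rightarrow> 'k" where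
  "wedge p q f g = (\<lambda>x.
     (\<Sum>\<sigma> | \<sigma> permutes {..<p + q}.
        of_int (sign \<sigma>) * f (\<lambda>i. x (\<sigma> i)) * g (\<lambda>i. x (\<sigma> (p + i)))) / (fact p * fact q))"

definition of_one_form :: "('a \<Rightarrow> 'k) \<Rightarrow> (nat \<Rightarrow> 'a) \<Rightarrow> 'k" where
  "of_one_form \<alpha> = (\<lambda>x. \<alpha> (x 0))"

definition of_two_form :: "('a \<Rightarrow> 'a \<Rightarrow> 'k) \<Rightarrow> (nat \<Rightarrow> 'a) \<Rightarrow> 'k" where
  "of_two_form \<omega> = (\<lambda>x. \<omega> (x 0) (x 1))"

fun wedge_power :: "('a \<Rightarrow> 'a \<Rightarrow> 'k::field_char_0) \<Rightarrow> nat \<Rightarrow> (nat \<Rightarrow> 'a) \<Rightarrow> 'k" where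
  "wedge_power \<omega> 0 = (\<lambda>x. 1)"
| "wedge_power \<omega> (Suc k) = wedge 2 (2 * k) (of_two_form \<omega>) (wedge_power \<omega> k)"

text \<open>This is \<open>\<alpha> \<and> (d\<alpha>)\<^sup>k\<close>.\<close>

definition wedge_d_power ::
    "('a \<Rightarrow> 'a \<Rightarrow> 'a) \<Rightarrow> ('a \<Rightarrow> 'k::field_char_0) \<Rightarrow> nat \<Rightarrow> (nat \<Rightarrow> 'a) \<Rightarrow> 'k" where
  "wedge_d_power bracket \<alpha> k =
     wedge 1 (2 * k) (of_one_form \<alpha>) (wedge_power (d_one bracket \<alpha>) k)"


section \<open>Generic couples\<close>

text \<open>
  The forms are complex valued; a real form is composed with the inclusion of the reals.
  The parameter \<open>n\<close> is the one for which the underlying space has dimension \<open>2 * n - 1\<close>.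
\<close>

definition generic_two_forms ::
    "nat \<Rightarrow> ('a \<Rightarrow> 'a \<Rightarrow> complex) \<Rightarrow> ('a \<Rightarrow> 'a \<Rightarrow> complex) \<Rightarrow> bool" where
  "generic_two_forms n \<omega> \<omega>1 \<longleftrightarrow>
     (\<forall>s t. (s, t) \<noteq> (0, 0) \<longrightarrow>
        wedge_power (\<lambda>a b. s * \<omega> a b + t * \<omega>1 a b) (n - 1) \<noteq> (\<lambda>x. 0))"

text \<open>
  All solutions \<open>v\<close> of \<open>i\<^sub>v d\<alpha> = -\<alpha>\<close> are congruent modulo the kernel of \<open>d\<alpha>\<close>, so taking the
  span of all of them together with the kernel amounts to choosing one.
\<close>

definition assoc_subalgebra ::
    "nat \<Rightarrow> ('k::field_char_0 \<Rightarrow> 'a::ab_group_add \<Rightarrow> 'a) \<Rightarrow> ('a \<Rightarrow> 'a \<Rightarrow> 'a) \<Rightarrow> ('a \<Rightarrow> 'k) \<Rightarrow> 'a set" where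
  "assoc_subalgebra n scl bracket \<alpha> =
     (if wedge_d_power bracket \<alpha> (n - 1) \<noteq> (\<lambda>x. 0) then {0}
      else module.span scl
             ({v. \<forall>y. d_one bracket \<alpha> v y = - \<alpha> y} \<union> {x. \<forall>y. d_one bracket \<alpha> x y = 0}))"

definition abelian_on :: "('a \<Rightarrow> 'a \<Rightarrow> 'a::zero) \<Rightarrow> 'a set \<Rightarrow> bool" where
  "abelian_on bracket S \<longleftrightarrow> (\<forall>x\<in>S. \<forall>y\<in>S. bracket x y = 0)"

definition generic_couple ::
    "nat \<Rightarrow> (complex \<Rightarrow> 'a::ab_group_add \<Rightarrow> 'a) \<Rightarrow> ('a \<Rightarrow> 'a \<Rightarrow> 'a) \<Rightarrow>
     ('a \<Rightarrow> complex) \<Rightarrow> ('a \<Rightarrow> complex) \<Rightarrow> bool" where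
  "generic_couple n scl bracket \<alpha> \<beta> \<longleftrightarrow>
     generic_two_forms n (d_one bracket \<alpha>) (d_one bracket \<beta>) \<and>
     (\<forall>s t. (s, t) \<noteq> (0, 0) \<longrightarrow>
        (let S = assoc_subalgebra n scl bracket (\<lambda>x. s * \<alpha> x + t * \<beta> x)
         in S = {0} \<or> \<not> abelian_on bracket S))"

text \<open>Complexification of a real Lie algebra; the pair \<open>(x, y)\<close> stands for \<open>x + \<i> y\<close>.\<close>

definition cpx_scale ::
    "(real \<Rightarrow> 'a::ab_group_add \<Rightarrow> 'a) \<Rightarrow> complex \<Rightarrow> 'a \<times> 'a \<Rightarrow> 'a \<times> 'a" where
  "cpx_scale scl c = (\<lambda>(x, y).
     (scl (Re c) x - scl (Im c) y, scl (Re c) y + scl (Im c) x))"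

definition cpx_bracket ::
    "('a \<Rightarrow> 'a \<Rightarrow> 'a::ab_group_add) \<Rightarrow> 'a \<times> 'a \<Rightarrow> 'a \<times> 'a \<Rightarrow> 'a \<times> 'a" where
  "cpx_bracket bracket = (\<lambda>(x, y) (x', y').
     (bracket x x' - bracket y y', bracket x y' + bracket y x'))"

definition cpx_form :: "('a \<Rightarrow> real) \<Rightarrow> 'a \<times> 'a \<Rightarrow> complex" where
  "cpx_form \<alpha> = (\<lambda>(x, y). Complex (\<alpha> x) (\<alpha> y))"

definition real_generic_couple ::
    "nat \<Rightarrow> (real \<Rightarrow> 'a::ab_group_add \<Rightarrow> 'a) \<Rightarrow> ('a \<Rightarrow> 'a \<Rightarrow> 'a) \<Rightarrow>
     ('a \<Rightarrow> real) \<Rightarrow> ('a \<Rightarrow> real) \<Rightarrow> bool" where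
  "real_generic_couple n scl bracket \<alpha> \<beta> \<longleftrightarrow>
     generic_couple n (cpx_scale scl) (cpx_bracket bracket) (cpx_form \<alpha>) (cpx_form \<beta>)"


section \<open>The secondary algebra\<close>

definition sec_scale ::
    "('k::field \<Rightarrow> 'a::ab_group_add \<Rightarrow> 'a) \<Rightarrow> 'k \<Rightarrow> 'a \<times> 'a \<times> 'k \<Rightarrow> 'a \<times> 'a \<times> 'k" where
  "sec_scale scl c = (\<lambda>(v, v', s). (scl c v, scl c v', c * s))"

definition sec_bracket ::
    "('k::field \<Rightarrow> 'a::ab_group_add \<Rightarrow> 'a) \<Rightarrow> ('a \<Rightarrow> 'a \<Rightarrow> 'a) \<Rightarrow>
     'a \<times> 'a \<times> 'k \<Rightarrow> 'a \<times> 'a \<times> 'k \<Rightarrow> 'a \<times> 'a \<times> 'k" where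
  "sec_bracket scl bracket = (\<lambda>(v, v', s) (w, w', t).
     (bracket v w, bracket v w' - bracket w v' + scl t v' - scl s w', 0))"


section \<open>Smooth and holomorphic functions\<close>

text \<open>
  Here \<open>S\<close> is a finite-dimensional linear subspace of a function space \<open>'i \<Rightarrow> 'k\<close>, with \<open>'k\<close> the
  reals or the complex numbers, and \<open>U\<close> is relatively open in \<open>S\<close>.  The topology that \<open>S\<close>
  inherits from the product topology is its usual one.  Derivatives are directional
  derivatives over \<open>'k\<close> in the directions of \<open>S\<close>.  Hence \<open>smooth_fun\<close> means infinitely
  differentiable over the reals and holomorphic over the complex numbers.
\<close>

fun C_k ::
    "nat \<Rightarrow> ('i \<Rightarrow> 'k::real_normed_field) set \<Rightarrow> ('i \<Rightarrow> 'k) set \<Rightarrow> (('i \<Rightarrow> 'k) \<Rightarrow> 'k) \<Rightarrow> bool" where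
  "C_k 0 S U f \<longleftrightarrow> continuous_on U f"
| "C_k (Suc k) S U f \<longleftrightarrow> continuous_on U f \<and>
     (\<forall>h\<in>S. \<exists>g. (\<forall>x\<in>U. ((\<lambda>t. f (\<lambda>i. x i + t * h i)) has_field_derivative g x) (at 0)) \<and>
                C_k k S U g)"

definition smooth_fun ::
    "('i \<Rightarrow> 'k::real_normed_field) set \<Rightarrow> ('i \<Rightarrow> 'k) set \<Rightarrow> (('i \<Rightarrow> 'k) \<Rightarrow> 'k) \<Rightarrow> bool" where
  "smooth_fun S U f \<longleftrightarrow> (\<forall>k. C_k k S U f)"

definition coord_space :: "nat \<Rightarrow> (nat \<Rightarrow> 'k::zero) set" where
  "coord_space m = {x. \<forall>i\<ge>m. x i = 0}"

text \<open>Charts of the dual space: diffeomorphisms from \<open>U\<close> onto an open set of tuples.\<close>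

definition local_coordinates ::
    "('k::real_normed_field \<Rightarrow> 'b::ab_group_add \<Rightarrow> 'b) \<Rightarrow> ('b \<Rightarrow> 'k) set \<Rightarrow>
     (('b \<Rightarrow> 'k) \<Rightarrow> nat \<Rightarrow> 'k) \<Rightarrow> bool" where
  "local_coordinates scl U y \<longleftrightarrow>
     (let m = vector_space.dim scl UNIV in
        openin (top_of_set (dual_space scl)) U \<and>
        inj_on y U \<and>
        openin (top_of_set (coord_space m)) (y ` U) \<and>
        (\<forall>i<m. smooth_fun (dual_space scl) U (\<lambda>q. y q i)) \<and>
        (\<forall>a. smooth_fun (coord_space m) (y ` U) (\<lambda>x. the_inv_into U y x a)))"

text \<open>The differential at \<open>q\<close> of a function on the dual space, as an element of the bidual.\<close>

definition differential ::
    "('k::real_normed_field \<Rightarrow> 'b::ab_group_add \<Rightarrow> 'b) \<Rightarrow> (('b \<Rightarrow> 'k) \<Rightarrow> 'k) \<Rightarrow> ('b \<Rightarrow> 'k) \<Rightarrow> 'b" where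
  "differential scl f q =
     (THE a. \<forall>\<phi>\<in>dual_space scl.
        ((\<lambda>t. f (\<lambda>b. q b + t * \<phi> b)) has_field_derivative \<phi> a) (at 0))"


section \<open>Linear Poisson pairs\<close>

text \<open>
  Through the identification of the cotangent spaces of the dual space with the vector space
  \<open>'b\<close> itself, a bi-vector field on the dual space is a function sending each point to an
  alternating bilinear form on \<open>'b\<close>.
\<close>

type_synonym ('b, 'k) bivector_field = "('b \<Rightarrow> 'k) \<Rightarrow> 'b \<Rightarrow> 'b \<Rightarrow> 'k"

definition lie_poisson :: "('b \<Rightarrow> 'b \<Rightarrow> 'b) \<Rightarrow> ('b, 'k) bivector_field" where
  "lie_poisson bracket = (\<lambda>q a b. q (bracket a b))"

definition linear_poisson_pair ::
    "('k::field \<Rightarrow> 'b::ab_group_add \<Rightarrow> 'b) \<Rightarrow> ('b \<Rightarrow> 'b \<Rightarrow> 'b) \<Rightarrow>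
     ('b, 'k) bivector_field \<Rightarrow> ('b, 'k) bivector_field \<Rightarrow> bool" where
  "linear_poisson_pair scl bracket \<Lambda> \<Lambda>1 \<longleftrightarrow>
     \<Lambda> = lie_poisson bracket \<and>
     (\<exists>\<omega>. two_form scl \<omega> \<and> (\<forall>a b c. d_two bracket \<omega> a b c = 0) \<and> \<Lambda>1 = (\<lambda>q. \<omega>))"

text \<open>The parameter \<open>\<iota>\<close> is the inclusion of the scalar field into the complex numbers.\<close>

definition generic_at ::
    "('k \<Rightarrow> complex) \<Rightarrow> ('k::field \<Rightarrow> 'b::ab_group_add \<Rightarrow> 'b) \<Rightarrow>
     ('b, 'k) bivector_field \<Rightarrow> ('b, 'k) bivector_field \<Rightarrow> ('b \<Rightarrow> 'k) \<Rightarrow> bool" where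
  "generic_at \<iota> scl \<Lambda> \<Lambda>1 p \<longleftrightarrow>
     (\<exists>N\<ge>2. vector_space.dim scl UNIV = 2 * N - 1 \<and>
        generic_two_forms N (\<lambda>a b. \<iota> (\<Lambda> p a b)) (\<lambda>a b. \<iota> (\<Lambda>1 p a b)))"

definition flat_at ::
    "('k::real_normed_field \<Rightarrow> 'b::ab_group_add \<Rightarrow> 'b) \<Rightarrow>
     ('b, 'k) bivector_field \<Rightarrow> ('b, 'k) bivector_field \<Rightarrow> ('b \<Rightarrow> 'k) \<Rightarrow> bool" where
  "flat_at scl \<Lambda> \<Lambda>1 p \<longleftrightarrow>
     (\<exists>U y c c1. p \<in> U \<and> local_coordinates scl U y \<and>
        (\<forall>q\<in>U. \<forall>i<vector_space.dim scl UNIV. \<forall>j<vector_space.dim scl UNIV.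
           (let dy_i = differential scl (\<lambda>q. y q i) q;
                dy_j = differential scl (\<lambda>q. y q j) q
            in \<Lambda> q dy_i dy_j = c i j \<and> \<Lambda>1 q dy_i dy_j = c1 i j)))"

definition generic_pair ::
    "('k \<Rightarrow> complex) \<Rightarrow> ('k::field \<Rightarrow> 'b::ab_group_add \<Rightarrow> 'b) \<Rightarrow>
     ('b, 'k) bivector_field \<Rightarrow> ('b, 'k) bivector_field \<Rightarrow> bool" where
  "generic_pair \<iota> scl \<Lambda> \<Lambda>1 \<longleftrightarrow> (\<exists>p\<in>dual_space scl. generic_at \<iota> scl \<Lambda> \<Lambda>1 p)"

definition flat_pair ::
    "('k \<Rightarrow> complex) \<Rightarrow> ('k::real_normed_field \<Rightarrow> 'b::ab_group_add \<Rightarrow> 'b) \<Rightarrow>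
     ('b, 'k) bivector_field \<Rightarrow> ('b, 'k) bivector_field \<Rightarrow> bool" where
  "flat_pair \<iota> scl \<Lambda> \<Lambda>1 \<longleftrightarrow>
     (\<forall>p\<in>dual_space scl. generic_at \<iota> scl \<Lambda> \<Lambda>1 p \<longrightarrow> flat_at scl \<Lambda> \<Lambda>1 p)"

end

theory Submission imports Defs begin

text \<open>
  Write \<open>\<A>\<close> for the given algebra, of dimension \<open>m = 2 r + 1\<close>, and \<open>(\<phi>, \<zeta>, 0)\<close> for the linear
  function \<open>(v, v', s) \<mapsto> \<phi> v + \<zeta> v'\<close> on the secondary algebra. Let \<open>\<Lambda>\<close> be the Lie--Poisson structure
  and let \<open>\<Lambda>\<^sub>1\<close> be its value at the point \<open>(0, \<beta>, 0)\<close>, extended as a constant bi-vector. The pair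
  is generic, but not flat, at the point \<open>p = (\<phi>, \<alpha>, 0)\<close> for a suitable \<open>\<phi>\<close>.

  Genericity. The bi-vector \<open>s \<Lambda> + t \<Lambda>\<^sub>1\<close> at \<open>p\<close> is the Lie--Poisson structure at \<open>(s \<phi>, \<zeta>, 0)\<close>
  with \<open>\<zeta> = s \<alpha> + t \<beta>\<close>. Its exterior power of order \<open>m\<close> is nonzero exactly if its kernel is a
  line, since the secondary algebra has dimension \<open>2 m + 1\<close>. Let \<open>v\<^sub>0\<close> span the kernel of \<open>d\<zeta>\<close>. If
  \<open>\<zeta> v\<^sub>0 \<noteq> 0\<close>, the kernel is always a line. If \<open>\<zeta> v\<^sub>0 = 0\<close>, then the algebra \<open>\<A>\<^sub>\<zeta>\<close> is not abelian and
  is spanned by \<open>v\<^sub>0\<close> and some \<open>v\<^sub>1\<close> with \<open>[v\<^sub>0, v\<^sub>1] = a v\<^sub>0\<close>, \<open>a \<noteq> 0\<close>, and the kernel is a line as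
  soon as \<open>s \<phi>(v\<^sub>0) \<noteq> 0\<close> (lemmas \<open>sec_kernel_line\<close> and \<open>sec_pencil_generic\<close>). The directions
  \<open>(s : t)\<close> of the second kind are zeros of \<open>\<zeta> \<and> (d\<zeta>)\<^sup>r\<close>, whose coefficients are homogeneous
  polynomials in \<open>s\<close> and \<open>t\<close>, and which does not vanish at \<open>(0 : 1)\<close> because \<open>\<beta> \<and> (d\<beta>)\<^sup>r \<noteq> 0\<close>. So there are finitely many of them,
  all with \<open>s \<noteq> 0\<close>, and some \<open>\<phi>\<close> is nonzero at all the corresponding vectors \<open>v\<^sub>0\<close>.

  Non-flatness. Coordinates in which both structures are constant give a volume form preserved by
  all their Hamiltonian vector fields. Let \<open>exp f\<close> be its density with respect to a translation
  invariant volume form. Comparing divergences, \<open>z = df\<close> lies in the kernel of \<open>\<Lambda>\<^sub>1\<close> and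
  \<open>p [z, b]\<close> is minus the trace of \<open>a \<mapsto> [a, b]\<close> for every \<open>b\<close>; lemma
  \<open>flat_imp_modular_hamiltonian\<close> carries this out at the single point \<open>p\<close>, with no determinants.
  Take \<open>b = (0, 0, 1)\<close>, so that \<open>[(v, v', s), b] = (0, v', 0)\<close> and the trace is \<open>m \<noteq> 0\<close>. Since
  \<open>\<beta> \<and> (d\<beta>)\<^sup>r \<noteq> 0\<close>, every vector in the kernel of \<open>\<Lambda>\<^sub>1\<close> has \<open>v' = 0\<close>, and then \<open>[z, b] = 0\<close>, a
  contradiction.

  A real algebra is treated through its complexification: the exterior powers are multilinear,
  so they are nonzero on real vectors as soon as they are nonzero on complex ones.
\<close>

section \<open>Linear forms and coordinate frames\<close>

text \<open>
  Only the algebraic conditions, without the requirement that \<open>scl\<close> is a vector space: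
  this keeps linearity in a single slot of a multilinear map easy to state.
\<close>

definition linear_form :: "('k::field \<Rightarrow> 'a::ab_group_add \<Rightarrow> 'a) \<Rightarrow> ('a \<Rightarrow> 'k) \<Rightarrow> bool" where
  "linear_form scl f \<longleftrightarrow> (\<forall>x y. f (x + y) = f x + f y) \<and> (\<forall>c x. f (scl c x) = c * f x)"

lemma linear_form_zero: "linear_form scl f \<Longrightarrow> f 0 = 0"
  unfolding linear_form_def by (metis add_cancel_right_right)

lemma linear_form_sum:
  assumes "linear_form scl f"
  shows "f (\<Sum>i\<in>I. g i) = (\<Sum>i\<in>I. f (g i))"
  by (induction I rule: infinite_finite_induct)
     (use assms linear_form_zero[OF assms] in \<open>auto simp: linear_form_def\<close>)

lemma linear_form_simps:
  assumes "linear_form scl f"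
  shows "f (x + y) = f x + f y" "f (scl a x) = a * f x" "f (- x) = - f x" "f (x - y) = f x - f y" "f 0 = 0"
proof -
  show a: "f (x + y) = f x + f y" for x y using assms by (simp add: linear_form_def)
  show z: "f 0 = 0" by (rule linear_form_zero[OF assms])
  show m: "f (- x) = - f x" for x using a[of x "- x"] z by (metis add.right_inverse minus_unique)
  show "f (x - y) = f x - f y" using a[of x "- y"] m by simp
  show "f (scl a x) = a * f x" using assms by (simp add: linear_form_def)
qed

lemma linear_iff_linear_form:
  "Vector_Spaces.linear scl (*) f \<longleftrightarrow> vector_space scl \<and> linear_form scl f"
proof
  assume "Vector_Spaces.linear scl (*) f"
  then interpret Vector_Spaces.linear scl "(*)" f .
  show "vector_space scl \<and> linear_form scl f"
    by (auto simp: linear_form_def add scale vs1.vector_space_axioms)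
next
  assume "vector_space scl \<and> linear_form scl f"
  then interpret vector_space scl by simp
  have "vector_space ((*) :: 'a \<Rightarrow> 'a \<Rightarrow> 'a)" by unfold_locales (auto simp: algebra_simps)
  then interpret vector_space_pair scl "(*) :: 'a \<Rightarrow> 'a \<Rightarrow> 'a" by (simp add: vector_space_pair_def vector_space_axioms)
  show "Vector_Spaces.linear scl (*) f"
    using \<open>vector_space scl \<and> linear_form scl f\<close>
    by unfold_locales (auto simp: linear_form_def)
qed

lemma dual_space_iff: "vector_space scl \<Longrightarrow> f \<in> dual_space scl \<longleftrightarrow> linear_form scl f"
  by (simp add: dual_space_def linear_iff_linear_form)

text \<open>
  A basis indexed by the numbers below \<open>M\<close>, together with its dual basis.
\<close>

definition frame ::
    "('k::field \<Rightarrow> 'a::ab_group_add \<Rightarrow> 'a) \<Rightarrow> nat \<Rightarrow> (nat \<Rightarrow> 'a) \<Rightarrow> (nat \<Rightarrow> 'a \<Rightarrow> 'k) \<Rightarrow> bool" where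
  "frame scl M b c \<longleftrightarrow> vector_space scl \<and> (\<forall>i<M. linear_form scl (c i)) \<and>
     (\<forall>v. (\<Sum>i<M. scl (c i v) (b i)) = v) \<and>
     (\<forall>i<M. \<forall>j<M. c i (b j) = (if i = j then 1 else 0))"

lemma frame_of_basis:
  assumes V: "vector_space scl" and B: "\<not> module.dependent scl B" "module.span scl B = UNIV"
    and b: "bij_betw b {..<M} B"
  shows "\<exists>c. frame scl M b c"
proof -
  interpret vector_space scl by (rule V)
  have fin: "finite B" using b bij_betw_finite by blast
  define c where "c i v = representation B v (b i)" for i v
  have sp: "v \<in> span B" for v using B by auto
  have "frame scl M b c"
    unfolding frame_def
  proof (intro conjI allI impI V)
    fix i assume "i < M"
    show "linear_form scl (c i)"
      unfolding linear_form_def c_def using representation_add[OF B(1)] representation_scale[OF B(1)] sp by simp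
  next
    fix v
    have "(\<Sum>i<M. scl (c i v) (b i)) = (\<Sum>u\<in>B. scl (representation B v u) u)"
      unfolding c_def by (rule sum.reindex_bij_betw[OF b])
    then show "(\<Sum>i<M. scl (c i v) (b i)) = v" using sum_representation_eq[OF B(1) sp fin subset_refl] by simp
  next
    fix i j assume ij: "i < M" "j < M"
    then have "b j \<in> B" "b i = b j \<longleftrightarrow> i = j" using b by (auto simp: bij_betw_def inj_on_def)
    then show "c i (b j) = (if i = j then 1 else 0)" unfolding c_def
      using representation_basis[OF B(1)] by auto
  qed
  then show ?thesis by blast
qed

lemma frame_exists:
  assumes V: "vector_space scl" and dim: "vector_space.dim scl UNIV = M" "M > 0"
  obtains b c where "frame scl M b c"
proof -
  interpret vector_space scl by (rule V)
  obtain B where B: "independent B" "UNIV \<subseteq> span B" "card B = M"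
    using basis_exists[of UNIV] dim by metis
  then have fin: "finite B" using dim(2) card_ge_0_finite by blast
  obtain b where b: "bij_betw b {..<M} B"
    using ex_bij_betw_nat_finite[OF fin] B(3) by (auto simp: lessThan_atLeast0)
  have "span B = UNIV" using B(2) by auto
  from frame_of_basis[OF V B(1) this b] show thesis using that by blast
qed

lemma family_relation:
  fixes M N :: nat and scl :: "'k::field \<Rightarrow> 'a::ab_group_add \<Rightarrow> 'a"
  assumes V: "vector_space scl" and sp: "\<And>v. \<exists>c. v = (\<Sum>i<M. scl (c i) (b i))" and N: "M < N"
  shows "\<exists>c. (\<exists>j<N. c j \<noteq> 0) \<and> (\<Sum>i<N. scl (c i) (x i)) = 0"
proof (rule ccontr)
  interpret vector_space scl by (rule V)
  assume "\<not> ?thesis"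
  then have triv: "(\<Sum>i<N. scl (c i) (x i)) = 0 \<Longrightarrow> j < N \<Longrightarrow> c j = 0" for c j by blast
  have inj: "inj_on x {..<N}"
  proof (rule inj_onI, rule ccontr)
    fix i j assume ij: "i \<in> {..<N}" "j \<in> {..<N}" "x i = x j" "i \<noteq> j"
    let ?c = "\<lambda>l. if l = i then 1 else if l = j then -1 else 0"
    have "(\<Sum>l<N. scl (?c l) (x l)) = (\<Sum>l\<in>{i, j}. scl (?c l) (x l))"
      by (rule sum.mono_neutral_right[OF finite_lessThan]) (use ij in auto)
    also have "\<dots> = 0" using ij by simp
    finally show False using triv[of ?c i] ij by simp
  qed
  have "independent (x ` {..<N})"
  proof
    assume "dependent (x ` {..<N})"
    then obtain u v where uv: "v \<in> x ` {..<N}" "u v \<noteq> 0" "(\<Sum>v\<in>x ` {..<N}. scl (u v) v) = 0"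
      unfolding dependent_finite[OF finite_imageI[OF finite_lessThan]] by blast
    then show False using triv[of "\<lambda>i. u (x i)"] by (auto simp: sum.reindex[OF inj])
  qed
  moreover have "x ` {..<N} \<subseteq> span (b ` {..<M})"
  proof
    fix v
    obtain c where "v = (\<Sum>i<M. scl (c i) (b i))" using sp by blast
    also have "\<dots> \<in> span (b ` {..<M})" by (intro span_sum span_scale span_base) auto
    finally show "v \<in> span (b ` {..<M})" .
  qed
  ultimately have "card (x ` {..<N}) \<le> card (b ` {..<M})"
    using independent_span_bound by blast
  also have "\<dots> \<le> M" using card_image_le[of "{..<M}" b] by simp
  finally show False using N by (simp add: card_image[OF inj])
qed

lemma frame_span:
  assumes "frame scl M b c"
  shows "\<exists>c. v = (\<Sum>i<M. scl (c i) (b i))"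
  using assms unfolding frame_def by metis

lemma frame_relation:
  assumes "frame scl M b c" "M < N"
  shows "\<exists>c. (\<exists>j<N. c j \<noteq> 0) \<and> (\<Sum>i<N. scl (c i) (x i)) = 0"
  using assms by (intro family_relation[where b = b and M = M] frame_span[OF assms(1)]) (auto simp: frame_def)

lemma frame_independent:
  assumes f: "frame scl M b c" and "(\<Sum>i<M. scl (a i) (b i)) = 0" "j < M"
  shows "a j = 0"
proof -
  have cj: "linear_form scl (c j)" using f assms by (auto simp: frame_def)
  have "c j (\<Sum>i<M. scl (a i) (b i)) = (\<Sum>i<M. a i * c j (b i))"
    unfolding linear_form_sum[OF cj] using cj by (simp add: linear_form_def)
  also have "\<dots> = (\<Sum>i<M. if i = j then a i else 0)"
    using f assms(3) by (intro sum.cong) (auto simp: frame_def)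
  also have "\<dots> = a j" using assms(3) by simp
  finally show ?thesis using assms(2) linear_form_zero[OF cj] by simp
qed

lemma frame_le_spanning:
  assumes f: "frame scl M b c" and sp: "\<And>v. \<exists>c. v = (\<Sum>i<N. scl (c i) (x i))"
  shows "M \<le> N"
proof (rule ccontr)
  assume "\<not> M \<le> N"
  then obtain a j where "j < M" "a j \<noteq> 0" "(\<Sum>i<M. scl (a i) (b i)) = 0"
    using family_relation[where b = x and x = b and M = N and N = M and scl = scl] sp f unfolding frame_def by auto
  then show False using frame_independent[OF f] by blast
qed

lemma frame_dim:
  assumes f: "frame scl M b c"
  shows "vector_space.dim scl UNIV = M"
proof -
  interpret vector_space scl using f by (simp add: frame_def)
  have inj: "inj_on b {..<M}"
    using f unfolding frame_def inj_on_def by (metis lessThan_iff zero_neq_one)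
  have "independent (b ` {..<M})"
  proof
    assume "dependent (b ` {..<M})"
    then obtain u v where uv: "v \<in> b ` {..<M}" "u v \<noteq> 0" "(\<Sum>v\<in>b ` {..<M}. scl (u v) v) = 0"
      unfolding dependent_finite[OF finite_imageI[OF finite_lessThan]] by blast
    then show False using frame_independent[OF f, of "\<lambda>i. u (b i)"] by (auto simp: sum.reindex[OF inj])
  qed
  moreover have "v \<in> span (b ` {..<M})" for v
  proof -
    have "v = (\<Sum>i<M. scl (c i v) (b i))" using f by (simp add: frame_def)
    also have "\<dots> \<in> span (b ` {..<M})" by (intro span_sum span_scale span_base) auto
    finally show ?thesis .
  qed
  ultimately have "dim UNIV = card (b ` {..<M})"
    by (intro dim_eq_card) (auto simp: span_UNIV)
  then show ?thesis by (simp add: card_image[OF inj])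
qed

lemma frame_coordinate_linear: "frame scl M b c \<Longrightarrow> l < M \<Longrightarrow> linear_form scl (c l)"
  by (simp add: frame_def)

lemma frame_expand:
  assumes f: "frame scl M b c" and h: "linear_form scl h"
  shows "h v = (\<Sum>l<M. h (b l) * c l v)"
proof -
  have "h v = h (\<Sum>l<M. scl (c l v) (b l))" using f by (simp add: frame_def)
  then show ?thesis by (simp add: linear_form_sum[OF h] linear_form_simps[OF h] mult.commute)
qed

lemma frame_separates:
  assumes f: "frame scl M b c" and eq: "\<And>h. linear_form scl h \<Longrightarrow> h v = h w"
  shows "v = w"
proof -
  have "v = (\<Sum>l<M. scl (c l v) (b l))" using f by (simp add: frame_def)
  also have "\<dots> = (\<Sum>l<M. scl (c l w) (b l))"
    by (intro sum.cong refl arg_cong2[where f = scl] eq frame_coordinate_linear[OF f]) simp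
  also have "\<dots> = w" using f by (simp add: frame_def)
  finally show ?thesis .
qed

text \<open>
  As many vectors as the dimension, with no nonzero linear form vanishing on all of them:
  they span, hence they are a basis.
\<close>

lemma frame_of_separating_family:
  assumes f: "frame scl M b c" and sep: "\<And>h. linear_form scl h \<Longrightarrow> (\<And>i. i < M \<Longrightarrow> h (d i) = 0) \<Longrightarrow> h = (\<lambda>x. 0)"
  obtains e where "frame scl M d e"
proof -
  have V: "vector_space scl" using f by (simp add: frame_def)
  interpret vector_space scl by (rule V)
  have "vector_space ((*) :: 'a \<Rightarrow> 'a \<Rightarrow> 'a)" by unfold_locales (auto simp: algebra_simps)
  then interpret vector_space_pair scl "(*) :: 'a \<Rightarrow> 'a \<Rightarrow> 'a" by (simp add: vector_space_pair_def V)
  let ?D = "d ` {..<M}"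
  obtain B where B: "B \<subseteq> ?D" "independent B" "?D \<subseteq> span B" using maximal_independent_subset[of ?D] by blast
  have fin: "finite B" using B(1) finite_subset by blast
  have span: "span B = UNIV"
  proof (rule ccontr)
    assume "span B \<noteq> UNIV"
    then obtain v where v: "v \<notin> span B" by blast
    then have "independent (insert v B)" using B(2) by (simp add: independent_insert)
    \<comment> \<open>otherwise some nonzero linear form would vanish on the whole family\<close>
    from linear_independent_extend[OF this, of "\<lambda>x. if x = v then 1 else 0"]
    obtain g where g: "Vector_Spaces.linear scl (*) g" "\<forall>x\<in>insert v B. g x = (if x = v then 1 else 0)" by blast
    have vB: "v \<notin> B" using v span_base by blast
    have "g x = 0" if "x \<in> B" for x using g(2) vB that by auto
    then have "g x = 0" if "x \<in> span B" for x
      using linear_eq_0_on_span[OF g(1), of B x] that by blast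
    then have "g (d i) = 0" if "i < M" for i using B(3) that by blast
    moreover have "linear_form scl g" using g(1) by (simp add: linear_iff_linear_form)
    ultimately have "g = (\<lambda>x. 0)" using sep by blast
    then show False using g(2) by simp
  qed
  have "card B = M" using frame_dim[OF f] dim_eq_card[of B UNIV] B(2) span by simp
  moreover have "card ?D \<le> M" using card_image_le[of "{..<M}" d] by simp
  moreover have "card B \<le> card ?D" using card_mono[OF _ B(1)] by simp
  ultimately have "card B = card ?D" "card ?D = M" by simp_all
  then have "B = ?D" "card ?D = M" using card_subset_eq[OF _ B(1)] by simp_all
  then have "bij_betw d {..<M} B" by (simp add: bij_betw_def eq_card_imp_inj_on)
  from frame_of_basis[OF V B(2) span this] show thesis using that by blast
qed

text \<open>
  The identification of the bidual with the space itself, for a map \<open>D\<close> whose behaviour is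
  only known on linear forms.
\<close>

lemma functional_on_dual_is_evaluation:
  assumes f: "frame scl M b c"
    and add: "\<And>h k. linear_form scl h \<Longrightarrow> linear_form scl k \<Longrightarrow> D (\<lambda>x. h x + k x) = D h + D k"
    and scale: "\<And>a h. linear_form scl h \<Longrightarrow> D (\<lambda>x. a * h x) = a * D h"
    and h: "linear_form scl h"
  shows "h (\<Sum>l<M. scl (D (c l)) (b l)) = D h"
proof -
  have partial: "D (\<lambda>x. \<Sum>l<N. h (b l) * c l x) = (\<Sum>l<N. h (b l) * D (c l)) \<and>
      linear_form scl (\<lambda>x. \<Sum>l<N. h (b l) * c l x)" if "N \<le> M" for N
    using that
  proof (induction N)
    case 0
    have "linear_form scl (\<lambda>x. 0)" by (simp add: linear_form_def)
    moreover have "D (\<lambda>x. 0 * h x) = 0 * D h" by (rule scale[OF h])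
    ultimately show ?case by simp
  next
    case (Suc N)
    then have c: "linear_form scl (c N)" by (intro frame_coordinate_linear[OF f]) simp
    then have c': "linear_form scl (\<lambda>x. h (b N) * c N x)" by (simp add: linear_form_def algebra_simps)
    have IH: "D (\<lambda>x. \<Sum>l<N. h (b l) * c l x) = (\<Sum>l<N. h (b l) * D (c l))"
      "linear_form scl (\<lambda>x. \<Sum>l<N. h (b l) * c l x)" using Suc by auto
    have "D (\<lambda>x. \<Sum>l<Suc N. h (b l) * c l x) = (\<Sum>l<Suc N. h (b l) * D (c l))"
      using add[OF IH(2) c'] scale[OF c, of "h (b N)"] IH(1) unfolding sum.lessThan_Suc by simp
    moreover have "linear_form scl (\<lambda>x. \<Sum>l<Suc N. h (b l) * c l x)"
      using IH(2) c' unfolding sum.lessThan_Suc linear_form_def by (simp add: algebra_simps)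
    ultimately show ?case by blast
  qed
  have "h = (\<lambda>x. \<Sum>l<M. h (b l) * c l x)" using frame_expand[OF f h] by blast
  then have "D h = (\<Sum>l<M. h (b l) * D (c l))" using partial[of M] by simp
  then show ?thesis by (simp add: linear_form_sum[OF h] linear_form_simps[OF h] mult.commute)
qed

section \<open>Alternating forms and exterior products\<close>

text \<open>
  The first clause makes \<open>F\<close> a function of the first \<open>d\<close> entries; the exterior product
  feeds whole sequences to its factors, so linearity in a slot depends on this clause.
\<close>

definition alternating_form ::
    "('k::field \<Rightarrow> 'a::ab_group_add \<Rightarrow> 'a) \<Rightarrow> nat \<Rightarrow> ((nat \<Rightarrow> 'a) \<Rightarrow> 'k) \<Rightarrow> bool" where
  "alternating_form scl d F \<longleftrightarrow>
     (\<forall>x y. (\<forall>i<d. x i = y i) \<longrightarrow> F x = F y) \<and>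
     (\<forall>i<d. \<forall>x. linear_form scl (\<lambda>v. F (x(i := v)))) \<and>
     (\<forall>x i j. i < d \<longrightarrow> j < d \<longrightarrow> i \<noteq> j \<longrightarrow> x i = x j \<longrightarrow> F x = 0)"

text \<open>
  This says that the contraction of \<open>F\<close> with \<open>w\<close> vanishes.
\<close>

definition annihilated_by :: "'a \<Rightarrow> nat \<Rightarrow> ((nat \<Rightarrow> 'a) \<Rightarrow> 'k::zero) \<Rightarrow> bool" where
  "annihilated_by w d F \<longleftrightarrow> (\<forall>i<d. \<forall>x. x i = w \<longrightarrow> F x = 0)"

lemma annihilated_byD: "annihilated_by w d F \<Longrightarrow> i < d \<Longrightarrow> x i = w \<Longrightarrow> F x = 0"
  unfolding annihilated_by_def by blast

text \<open>
  In the quotient by the vectors that annihilate \<open>F\<close> the arguments are linearly dependent.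
\<close>

lemma alternating_form_dependent:
  assumes F: "alternating_form scl d F" and w: "annihilated_by w d F"
    and rel: "(\<Sum>i<d. scl (c i) (x i)) = w" and j: "j < d" "c j \<noteq> 0"
  shows "F x = 0"
proof -
  define h where "h v = F (x(j := v))" for v
  have h: "linear_form scl h" using F j(1) unfolding alternating_form_def h_def by blast
  have "h (x i) = 0" if "i < d" "i \<noteq> j" for i
  proof -
    have "(x(j := x i)) i = (x(j := x i)) j" using that by simp
    then show ?thesis using F j that unfolding h_def alternating_form_def by blast
  qed
  then have "(\<Sum>i<d. c i * h (x i)) = c j * h (x j)"
    using j by (subst sum.remove[of _ j]) auto
  moreover have "(\<Sum>i<d. c i * h (x i)) = h w"
    unfolding rel[symmetric] linear_form_sum[OF h] using h by (simp add: linear_form_def)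
  moreover have "h w = 0" unfolding h_def using w j(1) by (auto simp: annihilated_by_def)
  ultimately have "h (x j) = 0" using j by simp
  then show ?thesis by (simp add: h_def)
qed

lemma wedge_annihilated:
  fixes f g :: "(nat \<Rightarrow> 'a) \<Rightarrow> 'k::field_char_0"
  assumes "annihilated_by w p f" "annihilated_by w q g"
  shows "annihilated_by w (p + q) (wedge p q f g)"
  unfolding annihilated_by_def
proof (intro allI impI)
  fix j and x :: "nat \<Rightarrow> 'a" assume j: "j < p + q" and xj: "x j = w"
  have *: "f (\<lambda>i. x (\<sigma> i)) * g (\<lambda>i. x (\<sigma> (p + i))) = 0" if s: "\<sigma> permutes {..<p + q}" for \<sigma>
  proof -
    obtain l where l: "\<sigma> l = j" "l < p + q"
      using s j by (metis lessThan_iff permutes_in_image permutes_surj surjE)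
    show ?thesis
    proof (cases "l < p")
      case True
      then have "f (\<lambda>i. x (\<sigma> i)) = 0"
        using annihilated_byD[OF assms(1) True, of "\<lambda>i. x (\<sigma> i)"] l xj by simp
      then show ?thesis by simp
    next
      case False
      then obtain m where m: "l = p + m" "m < q"
        using l(2) by (metis add_diff_inverse_nat nat_add_left_cancel_less)
      have "g (\<lambda>i. x (\<sigma> (p + i))) = 0"
        using annihilated_byD[OF assms(2) m(2), of "\<lambda>i. x (\<sigma> (p + i))"] l m xj by simp
      then show ?thesis by simp
    qed
  qed
  have "(\<Sum>\<sigma> | \<sigma> permutes {..<p + q}.
      of_int (sign \<sigma>) * f (\<lambda>i. x (\<sigma> i)) * g (\<lambda>i. x (\<sigma> (p + i)))) = 0"
    by (rule sum.neutral) (use * in \<open>auto simp: mult.assoc\<close>)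
  then show "wedge p q f g x = 0" unfolding wedge_def by simp
qed

text \<open>
  The exterior product is a signed sum over all permutations, so it is alternating whatever
  its factors are.
\<close>

lemma wedge_permute:
  fixes f g :: "(nat \<Rightarrow> 'a) \<Rightarrow> 'k::field_char_0"
  assumes t: "\<tau> permutes {..<p + q}"
  shows "wedge p q f g (\<lambda>i. x (\<tau> i)) = of_int (sign \<tau>) * wedge p q f g x"
proof -
  let ?S = "{\<sigma>. \<sigma> permutes {..<p + q}}"
  let ?T = "\<lambda>\<sigma>. of_int (sign \<sigma>) * f (\<lambda>i. x (\<sigma> i)) * g (\<lambda>i. x (\<sigma> (p + i)))"
  have pt: "permutation \<sigma>" if "\<sigma> \<in> ?S" for \<sigma>
    using that permutation_permutes by blast
  have "(\<Sum>\<sigma>\<in>?S. of_int (sign \<sigma>) * f (\<lambda>i. x (\<tau> (\<sigma> i))) * g (\<lambda>i. x (\<tau> (\<sigma> (p + i)))))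
      = (\<Sum>\<sigma>\<in>?S. of_int (sign \<tau>) * ?T (\<tau> \<circ> \<sigma>))"
  proof (rule sum.cong[OF refl])
    fix \<sigma> assume s: "\<sigma> \<in> ?S"
    have "sign (\<tau> \<circ> \<sigma>) = sign \<tau> * sign \<sigma>" using sign_compose pt t s by blast
    then have "of_int (sign \<tau>) * of_int (sign (\<tau> \<circ> \<sigma>)) = (of_int (sign \<sigma>) :: 'k)"
      by (simp flip: of_int_mult)
    then show "of_int (sign \<sigma>) * f (\<lambda>i. x (\<tau> (\<sigma> i))) * g (\<lambda>i. x (\<tau> (\<sigma> (p + i))))
        = of_int (sign \<tau>) * ?T (\<tau> \<circ> \<sigma>)"
      by (simp add: mult.assoc[symmetric])
  qed
  also have "\<dots> = of_int (sign \<tau>) * (\<Sum>\<sigma>\<in>?S. ?T (\<tau> \<circ> \<sigma>))" by (simp add: sum_distrib_left)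
  also have "(\<Sum>\<sigma>\<in>?S. ?T (\<tau> \<circ> \<sigma>)) = (\<Sum>\<sigma>\<in>?S. ?T \<sigma>)"
    by (rule setum_permutations_compose_left[OF t, symmetric])
  finally show ?thesis unfolding wedge_def by simp
qed

lemma wedge_alternating:
  fixes f g :: "(nat \<Rightarrow> 'a::ab_group_add) \<Rightarrow> 'k::field_char_0"
  assumes f: "alternating_form scl p f" and g: "alternating_form scl q g"
  shows "alternating_form scl (p + q) (wedge p q f g)"
  unfolding alternating_form_def
proof (intro conjI allI impI)
  fix x y :: "nat \<Rightarrow> 'a" assume xy: "\<forall>i<p + q. x i = y i"
  have *: "f (\<lambda>i. x (\<sigma> i)) = f (\<lambda>i. y (\<sigma> i)) \<and> g (\<lambda>i. x (\<sigma> (p + i))) = g (\<lambda>i. y (\<sigma> (p + i)))"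
    if s: "\<sigma> permutes {..<p + q}" for \<sigma>
  proof -
    have "x (\<sigma> i) = y (\<sigma> i)" if "i < p + q" for i
      using xy s that by (metis lessThan_iff permutes_in_image)
    then have "\<forall>i<p. x (\<sigma> i) = y (\<sigma> i)" "\<forall>i<q. x (\<sigma> (p + i)) = y (\<sigma> (p + i))" by auto
    then show ?thesis using f g unfolding alternating_form_def by meson
  qed
  show "wedge p q f g x = wedge p q f g y"
    unfolding wedge_def by (intro arg_cong[where f = "\<lambda>s. s / _"] sum.cong refl) (use * in simp)
next
  fix j and x :: "nat \<Rightarrow> 'a" assume j: "j < p + q"
  have lin: "linear_form scl (\<lambda>v. f (\<lambda>i. (x(j := v)) (\<sigma> i)) * g (\<lambda>i. (x(j := v)) (\<sigma> (p + i))))"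
    (is "linear_form scl ?h") if s: "\<sigma> permutes {..<p + q}" for \<sigma>
  proof -
    obtain l where l: "\<sigma> l = j" "l < p + q"
      using s j by (metis lessThan_iff permutes_in_image permutes_surj surjE)
    have inj: "\<sigma> i = j \<longleftrightarrow> i = l" for i
      using s l by (metis permutes_inverses(2))
    show ?thesis
    proof (cases "l < p")
      case True
      have "?h v = g (\<lambda>i. x (\<sigma> (p + i))) * f ((\<lambda>i. x (\<sigma> i))(l := v))" for v
      proof -
        have "(\<lambda>i. (x(j := v)) (\<sigma> i)) = (\<lambda>i. x (\<sigma> i))(l := v)" by (auto simp: inj fun_eq_iff)
        moreover have "(\<lambda>i. (x(j := v)) (\<sigma> (p + i))) = (\<lambda>i. x (\<sigma> (p + i)))"
          using True by (auto simp: inj fun_eq_iff)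
        ultimately show ?thesis by simp
      qed
      moreover have "linear_form scl (\<lambda>v. f ((\<lambda>i. x (\<sigma> i))(l := v)))"
        using f True unfolding alternating_form_def by blast
      ultimately show ?thesis by (simp add: linear_form_def algebra_simps)
    next
      case False
      then obtain m where m: "l = p + m" "m < q"
        using l(2) by (metis add_diff_inverse_nat nat_add_left_cancel_less)
      have "?h v = f (\<lambda>i. x (\<sigma> i)) * g ((\<lambda>i. x (\<sigma> (p + i)))(m := v))" for v
      proof -
        have "f (\<lambda>i. (x(j := v)) (\<sigma> i)) = f (\<lambda>i. x (\<sigma> i))"
          using f m unfolding alternating_form_def by (auto simp: inj)
        moreover have "(\<lambda>i. (x(j := v)) (\<sigma> (p + i))) = (\<lambda>i. x (\<sigma> (p + i)))(m := v)"
          using m by (auto simp: inj fun_eq_iff)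
        ultimately show ?thesis by simp
      qed
      moreover have "linear_form scl (\<lambda>v. g ((\<lambda>i. x (\<sigma> (p + i)))(m := v)))"
        using g m unfolding alternating_form_def by blast
      ultimately show ?thesis by (simp add: linear_form_def algebra_simps)
    qed
  qed
  show "linear_form scl (\<lambda>v. wedge p q f g (x(j := v)))"
    unfolding linear_form_def
  proof (intro conjI allI)
    fix v w
    show "wedge p q f g (x(j := v + w)) = wedge p q f g (x(j := v)) + wedge p q f g (x(j := w))"
      unfolding wedge_def add_divide_distrib[symmetric] sum.distrib[symmetric] mult.assoc
        distrib_left[symmetric]
      by (intro arg_cong[where f = "\<lambda>s. s / _"] sum.cong refl arg_cong[where f = "(*) _"])
        (use lin in \<open>auto simp: linear_form_def\<close>)
  next
    fix c v
    show "wedge p q f g (x(j := scl c v)) = c * wedge p q f g (x(j := v))"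
      unfolding wedge_def times_divide_eq_right sum_distrib_left mult.assoc mult.left_commute[of c]
      by (intro arg_cong[where f = "\<lambda>s. s / _"] sum.cong refl arg_cong[where f = "(*) _"])
        (use lin in \<open>auto simp: linear_form_def\<close>)
  qed
next
  fix x :: "nat \<Rightarrow> 'a" and i j assume ij: "i < p + q" "j < p + q" "i \<noteq> j" "x i = x j"
  have "(\<lambda>l. x (Transposition.transpose i j l)) = x" using ij(4) by (auto simp: fun_eq_iff Transposition.transpose_def)
  then have "wedge p q f g x = - wedge p q f g x"
    using wedge_permute[of "Transposition.transpose i j" p q f g x] ij
    by (simp add: sign_swap_id permutes_swap_id)
  then show "wedge p q f g x = 0" by simp
qed

definition bilinear_alt :: "('k::field \<Rightarrow> 'a::ab_group_add \<Rightarrow> 'a) \<Rightarrow> ('a \<Rightarrow> 'a \<Rightarrow> 'k) \<Rightarrow> bool" where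
  "bilinear_alt scl \<omega> \<longleftrightarrow> (\<forall>x. linear_form scl (\<omega> x)) \<and> (\<forall>x y. \<omega> x y = - \<omega> y x)"

lemma bilinear_altD:
  assumes "bilinear_alt scl \<omega>"
  shows "linear_form scl (\<omega> x)" "\<omega> x y = - \<omega> y x" "linear_form scl (\<lambda>x. \<omega> x y)"
proof -
  show r: "linear_form scl (\<omega> x)" for x using assms unfolding bilinear_alt_def by blast
  show sk: "\<omega> x y = - \<omega> y x" for x y using assms unfolding bilinear_alt_def by blast
  show "linear_form scl (\<lambda>x. \<omega> x y)"
    using r[of y] unfolding linear_form_def by (subst (1 2 3 4 5) sk) simp
qed

lemma of_two_form_alternating:
  fixes \<omega> :: "'a::ab_group_add \<Rightarrow> 'a \<Rightarrow> 'k::field_char_0"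
  assumes "bilinear_alt scl \<omega>"
  shows "alternating_form scl 2 (of_two_form \<omega>)"
proof -
  have "\<omega> x x = 0" for x using bilinear_altD(2)[OF assms, of x x] by simp
  then show ?thesis
    unfolding alternating_form_def of_two_form_def
    using bilinear_altD(1,3)[OF assms] by (auto simp: less_2_cases_iff numeral_2_eq_2 less_Suc_eq)
qed

lemma wedge_power_alternating:
  assumes "bilinear_alt scl \<omega>"
  shows "alternating_form scl (2 * k) (wedge_power \<omega> k)"
proof (induction k)
  case 0
  then show ?case by (simp add: alternating_form_def)
next
  case (Suc k)
  then show ?case
    using wedge_alternating[OF of_two_form_alternating[OF assms] Suc] by simp
qed

lemma wedge_power_annihilated:
  assumes "\<And>y. \<omega> w y = 0" "\<And>y. \<omega> y w = 0"
  shows "annihilated_by w (2 * k) (wedge_power \<omega> k)"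
proof (induction k)
  case 0
  then show ?case by (simp add: annihilated_by_def)
next
  case (Suc k)
  have "annihilated_by w 2 (of_two_form \<omega>)"
    using assms by (auto simp: annihilated_by_def of_two_form_def less_2_cases_iff)
  from wedge_annihilated[OF this Suc] show ?case by simp
qed

definition pair_term :: "('a \<Rightarrow> 'a \<Rightarrow> 'k::field_char_0) \<Rightarrow> nat \<Rightarrow> (nat \<Rightarrow> 'a) \<Rightarrow> (nat \<Rightarrow> nat) \<Rightarrow> 'k" where
  "pair_term \<omega> k x \<sigma> = of_int (sign \<sigma>) * (\<Prod>j<k. \<omega> (x (\<sigma> (2 * j))) (x (\<sigma> (2 * j + 1))))"

text \<open>
  Up to a constant, \<open>\<omega>\<^sup>k\<close> is the Pfaffian of the matrix of values of \<open>\<omega>\<close>, written as a sum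
  over all permutations. In this form its value on a symplectic basis can be read off.
\<close>

lemma wedge_power_expansion:
  fixes \<omega> :: "'a \<Rightarrow> 'a \<Rightarrow> 'k::field_char_0"
  shows "wedge_power \<omega> k x = (\<Sum>\<sigma> | \<sigma> permutes {..<2 * k}. pair_term \<omega> k x \<sigma>) / 2 ^ k"
proof (induction k arbitrary: x)
  case 0
  then show ?case by (simp add: pair_term_def)
next
  case (Suc k)
  let ?S = "{\<sigma>. \<sigma> permutes {..<2 + 2 * k}}" and ?T = "{\<tau>. \<tau> permutes {..<2 * k}}"
  \<comment> \<open>a permutation of the last \<open>2 * k\<close> entries, seen as one of all \<open>2 * k + 2\<close> entries\<close>
  define sh where "sh \<tau> = map_permutation {..<2 * k} (\<lambda>i. 2 + i) \<tau>" for \<tau> :: "nat \<Rightarrow> nat"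
  have bij: "bij_betw (\<lambda>i. 2 + i) {..<2 * k} {2..<2 + 2 * k}"
    by (rule bij_betwI[where g = "\<lambda>i. i - 2"]) auto
  have subs: "{2..<2 + 2 * k} \<subseteq> {..<2 + 2 * k}" by auto
  have sh_perm: "sh \<tau> permutes {2..<2 + 2 * k}" if "\<tau> \<in> ?T" for \<tau>
    using map_permutation_permutes[OF bij] that unfolding sh_def by blast
  have sh_S: "sh \<tau> \<in> ?S" if "\<tau> \<in> ?T" for \<tau>
    using permutes_subset[OF sh_perm[OF that] subs] by blast
  have sh_sign: "sign (sh \<tau>) = sign \<tau>" if "\<tau> \<in> ?T" for \<tau>
    unfolding sh_def by (rule sign_map_permutation) (use that in \<open>auto simp: inj_on_def\<close>)
  have sh01: "sh \<tau> 0 = 0" "sh \<tau> (Suc 0) = Suc 0" if "\<tau> \<in> ?T" for \<tau>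
    using sh_perm[OF that] by (simp_all add: permutes_not_in)
  have sh2: "sh \<tau> (2 + i) = 2 + \<tau> i" if "\<tau> \<in> ?T" "i < 2 * k" for \<tau> i
    unfolding sh_def using that
    by (subst map_permutation_apply) (auto simp: inj_on_def)
  have "(\<Sum>\<sigma>\<in>?S. of_int (sign \<sigma>) * of_two_form \<omega> (\<lambda>i. x (\<sigma> i)) * wedge_power \<omega> k (\<lambda>i. x (\<sigma> (2 + i))))
      = (\<Sum>\<sigma>\<in>?S. \<Sum>\<tau>\<in>?T. pair_term \<omega> (Suc k) x (\<sigma> \<circ> sh \<tau>)) / 2 ^ k"
    unfolding Suc sum_divide_distrib times_divide_eq_right sum_distrib_left
  proof (intro sum.cong refl)
    fix \<sigma> \<tau> assume s: "\<sigma> \<in> ?S" and t: "\<tau> \<in> ?T"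
    have "sign (\<sigma> \<circ> sh \<tau>) = sign \<sigma> * sign \<tau>"
    proof -
      have "permutation \<sigma>" "permutation (sh \<tau>)"
        using s sh_S[OF t] permutation_permutes[of _] by blast+
      then show ?thesis by (simp add: sign_compose sh_sign[OF t])
    qed
    moreover have "(\<Prod>j<Suc k. \<omega> (x ((\<sigma> \<circ> sh \<tau>) (2 * j))) (x ((\<sigma> \<circ> sh \<tau>) (2 * j + 1))))
      = \<omega> (x (\<sigma> 0)) (x (\<sigma> 1)) * (\<Prod>j<k. \<omega> (x (\<sigma> (2 + \<tau> (2 * j)))) (x (\<sigma> (2 + \<tau> (2 * j + 1)))))"
    proof -
      have "(\<Prod>j<k. \<omega> (x ((\<sigma> \<circ> sh \<tau>) (2 * Suc j))) (x ((\<sigma> \<circ> sh \<tau>) (2 * Suc j + 1))))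
        = (\<Prod>j<k. \<omega> (x (\<sigma> (2 + \<tau> (2 * j)))) (x (\<sigma> (2 + \<tau> (2 * j + 1)))))"
      proof (intro prod.cong refl)
        fix j assume "j \<in> {..<k}"
        then have "sh \<tau> (2 * Suc j) = 2 + \<tau> (2 * j)" "sh \<tau> (2 * Suc j + 1) = 2 + \<tau> (2 * j + 1)"
          using sh2[OF t, of "2 * j"] sh2[OF t, of "2 * j + 1"] by simp_all
        then show "\<omega> (x ((\<sigma> \<circ> sh \<tau>) (2 * Suc j))) (x ((\<sigma> \<circ> sh \<tau>) (2 * Suc j + 1)))
          = \<omega> (x (\<sigma> (2 + \<tau> (2 * j)))) (x (\<sigma> (2 + \<tau> (2 * j + 1))))" by simp
      qed
      then show ?thesis
        unfolding prod.lessThan_Suc_shift using sh01[OF t] by simp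
    qed
    ultimately show "of_int (sign \<sigma>) * of_two_form \<omega> (\<lambda>i. x (\<sigma> i)) * pair_term \<omega> k (\<lambda>i. x (\<sigma> (2 + i))) \<tau> / 2 ^ k
      = pair_term \<omega> (Suc k) x (\<sigma> \<circ> sh \<tau>) / 2 ^ k"
      unfolding pair_term_def of_two_form_def by (simp add: mult_ac)
  qed
  also have "(\<Sum>\<sigma>\<in>?S. \<Sum>\<tau>\<in>?T. pair_term \<omega> (Suc k) x (\<sigma> \<circ> sh \<tau>))
      = (\<Sum>\<tau>\<in>?T. \<Sum>\<sigma>\<in>?S. pair_term \<omega> (Suc k) x (\<sigma> \<circ> sh \<tau>))" by (rule sum.swap)
  \<comment> \<open>each inner permutation only reindexes the outer sum, so all of them contribute the same\<close>
  also have "\<dots> = (\<Sum>\<tau>\<in>?T. \<Sum>\<sigma>\<in>?S. pair_term \<omega> (Suc k) x \<sigma>)"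
  proof (rule sum.cong[OF refl])
    fix \<tau> assume "\<tau> \<in> ?T"
    then have "sh \<tau> permutes {..<2 + 2 * k}" using sh_S by blast
    then show "(\<Sum>\<sigma>\<in>?S. pair_term \<omega> (Suc k) x (\<sigma> \<circ> sh \<tau>)) = (\<Sum>\<sigma>\<in>?S. pair_term \<omega> (Suc k) x \<sigma>)"
      by (rule sum_permutations_compose_right[symmetric])
  qed
  also have "\<dots> = fact (2 * k) * (\<Sum>\<sigma>\<in>?S. pair_term \<omega> (Suc k) x \<sigma>)"
    using card_permutations[of "{..<2 * k}" "2 * k"] by simp
  finally have num: "(\<Sum>\<sigma>\<in>?S. of_int (sign \<sigma>) * of_two_form \<omega> (\<lambda>i. x (\<sigma> i)) * wedge_power \<omega> k (\<lambda>i. x (\<sigma> (2 + i))))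
      = fact (2 * k) * (\<Sum>\<sigma>\<in>?S. pair_term \<omega> (Suc k) x \<sigma>) / 2 ^ k" .
  have "2 * Suc k = 2 + 2 * k" by simp
  then show ?case
    unfolding wedge_power.simps wedge_def num by (simp only:) (simp add: fact_2 field_simps del: add_2_eq_Suc)
qed

section \<open>Powers of two-forms in odd dimension\<close>

text \<open>
  A partial symplectic basis \<open>e\<^sub>1, f\<^sub>1, e\<^sub>2, f\<^sub>2, \<dots>\<close>, listed pair by pair.
\<close>

definition symplectic_family :: "('a \<Rightarrow> 'a \<Rightarrow> 'k::field_char_0) \<Rightarrow> nat \<Rightarrow> (nat \<Rightarrow> 'a) \<Rightarrow> bool" where
  "symplectic_family \<omega> k x \<longleftrightarrow> (\<forall>i<2 * k. \<forall>j<2 * k. \<omega> (x i) (x j) =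
     (if even i \<and> j = Suc i then 1 else if even j \<and> i = Suc j then - 1 else 0))"

text \<open>
  A term is nonzero only if the permutation maps pairs to pairs. Such a permutation is composed
  of exchanges of whole pairs and of exchanges within a pair, and neither changes the term.
  The induction moves the last pair into its place.
\<close>

lemma symplectic_pair_term:
  fixes \<omega> :: "'a \<Rightarrow> 'a \<Rightarrow> 'k::field_char_0"
  assumes "symplectic_family \<omega> k x" "\<sigma> permutes {..<2 * k}"
  shows "pair_term \<omega> k x \<sigma> \<in> {0, 1}"
  using assms
proof (induction k arbitrary: \<sigma>)
  case 0
  then show ?case by (simp add: pair_term_def)
next
  case (Suc k)
  define J where "J i j = \<omega> (x i) (x j)" for i j
  have J: "J i j = (if even i \<and> j = Suc i then 1 else if even j \<and> i = Suc j then - 1 else 0)"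
    if "i < 2 * Suc k" "j < 2 * Suc k" for i j
    using Suc.prems(1) that unfolding symplectic_family_def J_def by blast
  have less: "\<sigma> i < 2 * Suc k" if "\<sigma> permutes {..<2 * Suc k}" "i < 2 * Suc k" for \<sigma> i
    using that permutes_in_image by (metis lessThan_iff)
  have perm_of: "permutation \<sigma>" if "\<sigma> permutes {..<2 * Suc k}" for \<sigma>
    using that permutation_permutes by (metis finite_lessThan)
  let ?t = Transposition.transpose
  have fix_both: "pair_term \<omega> (Suc k) x \<sigma> \<in> {0, 1}"
    if s: "\<sigma> permutes {..<2 * Suc k}" and f: "\<sigma> (2 * k) = 2 * k" "\<sigma> (2 * k + 1) = 2 * k + 1" for \<sigma>
  proof -
    have "\<sigma> permutes {..<2 * k}"
      by (rule permutes_superset[OF s]) (use f in \<open>auto simp: less_Suc_eq\<close>)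
    moreover have "symplectic_family \<omega> k x"
      using Suc.prems(1) unfolding symplectic_family_def by simp
    ultimately have "pair_term \<omega> k x \<sigma> \<in> {0, 1}" using Suc.IH by blast
    moreover have "\<omega> (x (\<sigma> (2 * k))) (x (\<sigma> (2 * k + 1))) = 1"
      unfolding f using J[of "2 * k" "2 * k + 1"] by (simp add: J_def)
    ultimately show ?thesis by (simp add: pair_term_def)
  qed
  have fix_pair: "pair_term \<omega> (Suc k) x \<sigma> \<in> {0, 1}"
    if s: "\<sigma> permutes {..<2 * Suc k}" and f: "{\<sigma> (2 * k), \<sigma> (2 * k + 1)} = {2 * k, 2 * k + 1}" for \<sigma>
  proof (cases "\<sigma> (2 * k) = 2 * k")
    case True
    then show ?thesis using fix_both[OF s] f by (auto simp: doubleton_eq_iff)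
  next
    case False
    then have f': "\<sigma> (2 * k) = 2 * k + 1" "\<sigma> (2 * k + 1) = 2 * k" using f by (auto simp: doubleton_eq_iff)
    \<comment> \<open>exchanging the two members of a pair changes both the sign and one factor\<close>
    define \<rho> where "\<rho> = \<sigma> \<circ> ?t (2 * k) (2 * k + 1)"
    have t: "?t (2 * k) (2 * k + 1) permutes {..<2 * Suc k}" by (rule permutes_swap_id) auto
    have r: "\<rho> permutes {..<2 * Suc k}" unfolding \<rho>_def by (rule permutes_compose[OF t s])
    have perm: "permutation \<sigma>" "permutation (?t (2 * k) (2 * k + 1))"
      by (rule perm_of; use s t in simp)+
    have "sign \<rho> = - sign \<sigma>" unfolding \<rho>_def
      using sign_compose[of \<sigma> "?t (2 * k) (2 * k + 1)"] perm by (simp add: sign_swap_id)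
    moreover have "(\<Prod>j<k. \<omega> (x (\<rho> (2 * j))) (x (\<rho> (2 * j + 1))))
        = (\<Prod>j<k. \<omega> (x (\<sigma> (2 * j))) (x (\<sigma> (2 * j + 1))))"
      by (rule prod.cong) (auto simp: \<rho>_def Transposition.transpose_def)
    moreover have "\<omega> (x (\<rho> (2 * k))) (x (\<rho> (2 * k + 1))) = - \<omega> (x (\<sigma> (2 * k))) (x (\<sigma> (2 * k + 1)))"
      using J[of "2 * k" "2 * k + 1"] J[of "2 * k + 1" "2 * k"] f' by (simp add: J_def \<rho>_def)
    ultimately have "pair_term \<omega> (Suc k) x \<sigma> = pair_term \<omega> (Suc k) x \<rho>" by (simp add: pair_term_def)
    then show ?thesis using fix_both[OF r] f' by (simp add: \<rho>_def)
  qed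
  show ?case
  proof (cases "pair_term \<omega> (Suc k) x \<sigma> = 0")
    case False
    note s = Suc.prems(2)
    obtain l where l: "\<sigma> l = 2 * k" "l < 2 * Suc k"
    proof -
      have "2 * k \<in> \<sigma> ` {..<2 * Suc k}" unfolding permutes_image[OF s] by simp
      then show thesis using that by auto
    qed
    define b where "b = l div 2"
    have b: "b < Suc k" "l = 2 * b \<or> l = 2 * b + 1" using l unfolding b_def by auto
    have nz: "J (\<sigma> (2 * b)) (\<sigma> (2 * b + 1)) \<noteq> 0"
    proof -
      have "(\<Prod>j<Suc k. J (\<sigma> (2 * j)) (\<sigma> (2 * j + 1))) \<noteq> 0"
        using False unfolding pair_term_def J_def by (rule contrapos_nn) (simp only: mult_zero_right)
      then show ?thesis using prod_zero_iff[of "{..<Suc k}"] b(1) by blast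
    qed
    have pair: "{\<sigma> (2 * b), \<sigma> (2 * b + 1)} = {2 * k, 2 * k + 1}"
    proof -
      define u w where "u = \<sigma> (2 * b)" and "w = \<sigma> (2 * b + 1)"
      have "u < 2 * Suc k" "w < 2 * Suc k" unfolding u_def w_def by (rule less[OF s]; use b in simp)+
      then have "J u w = (if even u \<and> w = Suc u then 1 else if even w \<and> u = Suc w then - 1 else 0)"
        by (rule J)
      then have "even u \<and> w = Suc u \<or> even w \<and> u = Suc w"
        using nz unfolding u_def[symmetric] w_def[symmetric] by (meson)
      moreover have "u = 2 * k \<or> w = 2 * k" using b(2) l(1) unfolding u_def w_def by auto
      ultimately have "u = 2 * k \<and> w = 2 * k + 1 \<or> u = 2 * k + 1 \<and> w = 2 * k" by presburger
      then show ?thesis unfolding u_def[symmetric] w_def[symmetric] by auto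
    qed
    \<comment> \<open>exchanging two whole pairs is an even permutation that only reorders the factors\<close>
    let ?p = "?t (2 * b) (2 * k)" and ?q = "?t (2 * b + 1) (2 * k + 1)"
    define \<rho> where "\<rho> = \<sigma> \<circ> (?p \<circ> ?q)"
    have p: "?p permutes {..<2 * Suc k}" and q: "?q permutes {..<2 * Suc k}"
      by (rule permutes_swap_id; use b in auto)+
    have r: "\<rho> permutes {..<2 * Suc k}" unfolding \<rho>_def by (intro permutes_compose p q s)
    have perm: "permutation \<sigma>" "permutation ?p" "permutation ?q" "permutation (?p \<circ> ?q)"
      by (rule perm_of; use s p q permutes_compose[OF q p] in simp)+
    have sg: "sign \<rho> = sign \<sigma>"
      unfolding \<rho>_def sign_compose[OF perm(1,4)] sign_compose[OF perm(2,3)] sign_swap_id by simp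
    have \<rho>_ev: "\<rho> (2 * j) = \<sigma> (2 * ?t b k j)" and \<rho>_od: "\<rho> (2 * j + 1) = \<sigma> (2 * ?t b k j + 1)" for j
    proof -
      have "?q (2 * j) = 2 * j" by (rule transpose_apply_other; presburger)
      moreover have "?p (2 * j) = 2 * ?t b k j" by (simp add: Transposition.transpose_def)
      moreover have "?q (2 * j + 1) = 2 * ?t b k j + 1" by (simp add: Transposition.transpose_def)
      moreover have "?p (2 * i + 1) = 2 * i + 1" for i by (rule transpose_apply_other; presburger)
      ultimately show "\<rho> (2 * j) = \<sigma> (2 * ?t b k j)" "\<rho> (2 * j + 1) = \<sigma> (2 * ?t b k j + 1)"
        unfolding \<rho>_def o_def by simp_all
    qed
    have "(\<Prod>j<Suc k. J (\<rho> (2 * j)) (\<rho> (2 * j + 1)))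
        = (\<Prod>j<Suc k. J (\<sigma> (2 * ?t b k j)) (\<sigma> (2 * ?t b k j + 1)))"
      by (simp only: \<rho>_ev \<rho>_od)
    also have "\<dots> = (\<Prod>j<Suc k. J (\<sigma> (2 * j)) (\<sigma> (2 * j + 1)))"
    proof (rule prod.reindex_bij_betw[where h = "?t b k"])
      show "bij_betw (?t b k) {..<Suc k} {..<Suc k}"
        using permutes_imp_bij[OF permutes_swap_id[of b "{..<Suc k}" k]] b by simp
    qed
    finally have "pair_term \<omega> (Suc k) x \<sigma> = pair_term \<omega> (Suc k) x \<rho>"
      by (simp add: pair_term_def sg J_def)
    moreover have "{\<rho> (2 * k), \<rho> (2 * k + 1)} = {2 * k, 2 * k + 1}"
      using pair unfolding \<rho>_ev \<rho>_od by simp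
    ultimately show ?thesis using fix_pair[OF r] by simp
  qed simp
qed

text \<open>
  The value is \<open>2\<^sup>-\<^sup>k\<close> times the number of terms equal to one, and the identity gives one.
\<close>

lemma wedge_power_symplectic_nonzero:
  assumes "symplectic_family \<omega> k x"
  shows "wedge_power \<omega> k x \<noteq> 0"
proof -
  let ?S = "{\<sigma>. \<sigma> permutes {..<2 * k}}"
  let ?A = "{\<sigma> \<in> ?S. pair_term \<omega> k x \<sigma> = 1}"
  have fin: "finite ?S" by (simp add: finite_permutations)
  have "(\<Sum>\<sigma>\<in>?S. pair_term \<omega> k x \<sigma>) = (\<Sum>\<sigma>\<in>?A. pair_term \<omega> k x \<sigma>)"
    by (rule sum.mono_neutral_right[OF fin]) (use symplectic_pair_term[OF assms] in auto)
  also have "\<dots> = of_nat (card ?A)" by simp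
  finally have sum: "(\<Sum>\<sigma>\<in>?S. pair_term \<omega> k x \<sigma>) = of_nat (card ?A)" .
  have "pair_term \<omega> k x id = 1"
  proof -
    have "\<omega> (x (2 * j)) (x (2 * j + 1)) = 1" if "j < k" for j
      using assms that unfolding symplectic_family_def by auto
    then show ?thesis by (simp add: pair_term_def)
  qed
  then have "id \<in> ?A" by (simp add: permutes_id)
  then have "card ?A \<noteq> 0" using card_0_eq[of ?A] finite_subset[OF _ fin, of ?A] by blast
  then show ?thesis unfolding wedge_power_expansion sum by simp
qed

lemma symplectic_family_independent:
  fixes \<omega> :: "'a::ab_group_add \<Rightarrow> 'a \<Rightarrow> 'k::field_char_0"
  assumes \<omega>: "bilinear_alt scl \<omega>" and x: "symplectic_family \<omega> k x"
    and rel: "(\<Sum>i<2 * k. scl (a i) (x i)) = 0" and j: "j < 2 * k"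
  shows "a j = 0"
proof -
  \<comment> \<open>\<open>x j'\<close> is the partner of \<open>x j\<close> in its hyperbolic pair\<close>
  define j' where "j' = (if even j then Suc j else j - 1)"
  have j': "j' < 2 * k" using j unfolding j'_def by presburger
  define s :: 'k where "s = (if even j then 1 else - 1)"
  note lin = bilinear_altD(3)[OF \<omega>, of "x j'"]
  have "\<omega> (x i) (x j') = (if i = j then s else 0)" if "i < 2 * k" for i
  proof -
    have "\<omega> (x i) (x j') = (if even i \<and> j' = Suc i then 1 else if even j' \<and> i = Suc j' then - 1 else 0)"
      using x that j' unfolding symplectic_family_def by blast
    moreover have "(even i \<and> j' = Suc i) = (even j \<and> i = j)"
        "(even j' \<and> i = Suc j') = (odd j \<and> i = j)"
      unfolding j'_def by (cases "even j"; simp; presburger)+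
    ultimately show ?thesis by (auto simp: s_def)
  qed
  then have "(\<Sum>i<2 * k. a i * \<omega> (x i) (x j')) = (\<Sum>i<2 * k. if i = j then a j * s else 0)"
    by (intro sum.cong) auto
  also have "\<dots> = a j * s" using j by simp
  also have "(\<Sum>i<2 * k. a i * \<omega> (x i) (x j')) = \<omega> (\<Sum>i<2 * k. scl (a i) (x i)) (x j')"
    by (simp add: linear_form_sum[OF lin] linear_form_simps[OF lin])
  also have "\<dots> = 0" unfolding rel by (rule linear_form_zero[OF lin])
  finally show ?thesis by (simp add: s_def split: if_splits)
qed

text \<open>
  A symplectic family of maximal length. On its orthogonal space the form vanishes, since
  otherwise the family could be extended, so the orthogonal space is the kernel.
\<close>

lemma alternating_split:
  fixes \<omega> :: "'a::ab_group_add \<Rightarrow> 'a \<Rightarrow> 'k::field_char_0"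
  assumes f: "frame scl M b c" and \<omega>: "bilinear_alt scl \<omega>"
  obtains k x where "symplectic_family \<omega> k x" "2 * k \<le> M"
    "\<forall>v. \<exists>a u. v = (\<Sum>i<2 * k. scl (a i) (x i)) + u \<and> (\<forall>y. \<omega> u y = 0)"
proof -
  interpret vector_space scl using f by (simp add: frame_def)
  note lr = bilinear_altD(1)[OF \<omega>] and ll = bilinear_altD(3)[OF \<omega>] and sk = bilinear_altD(2)[OF \<omega>]
  have diag: "\<omega> v v = 0" for v using sk[of v v] by simp
  have bound: "2 * k \<le> M" if "symplectic_family \<omega> k x" for k x
  proof (rule ccontr)
    assume "\<not> 2 * k \<le> M"
    then obtain a j where "j < 2 * k" "a j \<noteq> 0" "(\<Sum>i<2 * k. scl (a i) (x i)) = 0"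
      using frame_relation[OF f, of "2 * k" x] by auto
    then show False using symplectic_family_independent[OF \<omega> that] by blast
  qed
  define P where "P k \<longleftrightarrow> (\<exists>x. symplectic_family \<omega> k x)" for k
  have "P 0" by (simp add: P_def symplectic_family_def)
  moreover have "\<forall>k. P k \<longrightarrow> k \<le> M" using bound unfolding P_def by fastforce
  ultimately have "P (Greatest P)" "\<not> P (Suc (Greatest P))"
    using GreatestI_nat[of P 0 M] Greatest_le_nat[of P _ M] by (blast, metis Suc_n_not_le_n)
  then obtain k x where x: "symplectic_family \<omega> k x" and max: "\<And>y. \<not> symplectic_family \<omega> (Suc k) y"
    unfolding P_def by blast
  \<comment> \<open>the projection onto the span of the family along its orthogonal space\<close>
  define a where "a v i = (if even i then \<omega> v (x (Suc i)) else - \<omega> v (x (i - 1)))" for v i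
  define u where "u v = v - (\<Sum>i<2 * k. scl (a v i) (x i))" for v
  have orth: "\<omega> (u v) (x j) = 0" if j: "j < 2 * k" for v j
  proof -
    define j' where "j' = (if even j then Suc j else j - 1)"
    have j': "j' < 2 * k" using j unfolding j'_def by presburger
    define s :: 'k where "s = (if even j then - 1 else 1)"
    have "\<omega> (x i) (x j) = (if i = j' then s else 0)" if "i < 2 * k" for i
      using x that j' j unfolding symplectic_family_def s_def j'_def
      by (auto elim!: oddE evenE)
    then have "(\<Sum>i<2 * k. a v i * \<omega> (x i) (x j)) = (\<Sum>i<2 * k. if i = j' then a v j' * s else 0)"
      by (intro sum.cong) auto
    also have "\<dots> = a v j' * s" using j' by simp
    also have "\<dots> = \<omega> v (x j)" unfolding a_def j'_def s_def by auto
    finally show ?thesis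
      unfolding u_def by (simp add: linear_form_sum[OF ll] linear_form_simps[OF ll])
  qed
  \<comment> \<open>a nonzero value would give one more hyperbolic pair, against the choice of \<open>k\<close>\<close>
  have iso: "\<omega> (u v) (u w) = 0" for v w
  proof (rule ccontr)
    assume nz: "\<omega> (u v) (u w) \<noteq> 0"
    define y where "y i = (if i < 2 * k then x i else if i = 2 * k then u v
      else scl (1 / \<omega> (u v) (u w)) (u w))" for i
    have orth': "\<omega> (x j) (u v) = 0" if "j < 2 * k" for v j using orth[OF that] sk[of "x j"] by simp
    have "symplectic_family \<omega> (Suc k) y"
      unfolding symplectic_family_def
    proof (intro allI impI)
      fix i j assume ij: "i < 2 * Suc k" "j < 2 * Suc k"
      have vw: "\<omega> (u w) (u v) = - \<omega> (u v) (u w)" by (rule sk)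
      consider "i < 2 * k" "j < 2 * k" | "i < 2 * k" "j \<ge> 2 * k" | "i \<ge> 2 * k" "j < 2 * k"
        | "i \<ge> 2 * k" "j \<ge> 2 * k" by linarith
      then show "\<omega> (y i) (y j) =
        (if even i \<and> j = Suc i then 1 else if even j \<and> i = Suc j then - 1 else 0)"
      proof cases
        case 1
        then show ?thesis using x unfolding symplectic_family_def y_def by auto
      next
        case 2
        then have "\<not> (even i \<and> j = Suc i)" "\<not> (even j \<and> i = Suc j)" by presburger+
        then show ?thesis using 2 orth' unfolding y_def by (simp add: linear_form_simps[OF lr])
      next
        case 3
        then have "\<not> (even i \<and> j = Suc i)" "\<not> (even j \<and> i = Suc j)" by presburger+
        then show ?thesis using 3 orth unfolding y_def by (simp add: linear_form_simps[OF ll])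
      next
        case 4
        then have "i \<in> {2 * k, Suc (2 * k)}" "j \<in> {2 * k, Suc (2 * k)}" using ij by auto
        then show ?thesis using nz vw diag unfolding y_def
          by (auto simp: linear_form_simps[OF lr] linear_form_simps[OF ll])
      qed
    qed
    then show False using max by blast
  qed
  have ker: "\<omega> (u v) y = 0" for v y
  proof -
    have "y = (\<Sum>i<2 * k. scl (a y i) (x i)) + u y" by (simp add: u_def)
    then have "\<omega> (u v) y = \<omega> (u v) ((\<Sum>i<2 * k. scl (a y i) (x i)) + u y)" by simp
    then show ?thesis
      by (simp add: linear_form_sum[OF lr] linear_form_simps[OF lr] iso orth)
  qed
  show thesis
  proof (rule that[OF x bound[OF x]], rule allI)
    fix v show "\<exists>a u. v = (\<Sum>i<2 * k. scl (a i) (x i)) + u \<and> (\<forall>y. \<omega> u y = 0)"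
      by (rule exI[of _ "a v"], rule exI[of _ "u v"]) (simp add: ker, simp add: u_def)
  qed
qed

lemma alternating_odd_kernel:
  fixes \<omega> :: "'a::ab_group_add \<Rightarrow> 'a \<Rightarrow> 'k::field_char_0"
  assumes f: "frame scl M b c" and \<omega>: "bilinear_alt scl \<omega>" and M: "odd M"
  shows "\<exists>v. v \<noteq> 0 \<and> (\<forall>y. \<omega> v y = 0)"
proof (rule ccontr)
  assume no: "\<not> ?thesis"
  have triv: "u = 0" if "\<forall>y. \<omega> u y = 0" for u using that no by blast
  obtain k x where x: "symplectic_family \<omega> k x" "2 * k \<le> M"
    "\<forall>v. \<exists>a u. v = (\<Sum>i<2 * k. scl (a i) (x i)) + u \<and> (\<forall>y. \<omega> u y = 0)"
    by (rule alternating_split[OF f \<omega>])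
  have "\<exists>a. v = (\<Sum>i<2 * k. scl (a i) (x i))" for v using spec[OF x(3), of v] triv by (metis add.right_neutral)
  then have "M \<le> 2 * k" by (rule frame_le_spanning[OF f])
  then show False using x(2) M by presburger
qed

text \<open>
  With a kernel of dimension at most one, a maximal symplectic family has at least \<open>2 * r\<close>
  members, and \<open>\<omega>\<^sup>r\<close> does not vanish on them.
\<close>

lemma wedge_power_nonzero_if_kernel_line:
  fixes \<omega> :: "'a::ab_group_add \<Rightarrow> 'a \<Rightarrow> 'k::field_char_0"
  assumes f: "frame scl (2 * r + 1) b c" and \<omega>: "bilinear_alt scl \<omega>"
    and ker: "\<And>u. \<forall>y. \<omega> u y = 0 \<Longrightarrow> \<exists>a. u = scl a u0"
  obtains x where "wedge_power \<omega> r x \<noteq> 0"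
proof -
  obtain k x where x: "symplectic_family \<omega> k x" "2 * k \<le> 2 * r + 1"
    "\<forall>v. \<exists>a u. v = (\<Sum>i<2 * k. scl (a i) (x i)) + u \<and> (\<forall>y. \<omega> u y = 0)"
    by (rule alternating_split[OF f \<omega>])
  have "\<exists>a. v = (\<Sum>i<2 * k + 1. scl (a i) ((x(2 * k := u0)) i))" for v
  proof -
    obtain a u where au: "v = (\<Sum>i<2 * k. scl (a i) (x i)) + u" "\<forall>y. \<omega> u y = 0" using x(3) by blast
    obtain e where "u = scl e u0" using ker[OF au(2)] by blast
    then have "v = (\<Sum>i<2 * k + 1. scl ((a(2 * k := e)) i) ((x(2 * k := u0)) i))" using au(1) by simp
    then show ?thesis by blast
  qed
  then have "2 * r + 1 \<le> 2 * k + 1" by (rule frame_le_spanning[OF f])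
  then have "symplectic_family \<omega> r x" using x(1) unfolding symplectic_family_def by auto
  then show thesis by (intro that wedge_power_symplectic_nonzero)
qed

text \<open>
  If the kernel had dimension two, then \<open>\<omega>\<^sup>r\<close> would be a form of degree \<open>2 * r\<close> on a quotient
  of dimension \<open>2 * r - 1\<close>.
\<close>

lemma kernel_line_if_wedge_power_nonzero:
  fixes \<omega> :: "'a::ab_group_add \<Rightarrow> 'a \<Rightarrow> 'k::field_char_0"
  assumes f: "frame scl (2 * r + 1) b c" and \<omega>: "bilinear_alt scl \<omega>"
    and nz: "wedge_power \<omega> r \<noteq> (\<lambda>x. 0)"
    and v0: "v0 \<noteq> 0" "\<And>y. \<omega> v0 y = 0" and v: "\<And>y. \<omega> v y = 0"
  shows "\<exists>a. v = scl a v0"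
proof -
  interpret vector_space scl using f by (simp add: frame_def)
  note ll = bilinear_altD(3)[OF \<omega>] and sk = bilinear_altD(2)[OF \<omega>]
  obtain x where x: "wedge_power \<omega> r x \<noteq> 0" using nz by auto
  \<comment> \<open>the \<open>2 * r\<close> arguments and the two kernel vectors: one vector too many in dimension \<open>2 * r + 1\<close>\<close>
  define y where "y = x(2 * r := v0, 2 * r + 1 := v)"
  obtain c j where c: "j < 2 * r + 2" "c j \<noteq> 0" "(\<Sum>i<2 * r + 2. scl (c i) (y i)) = 0"
    using frame_relation[OF f, of "2 * r + 2" y] by auto
  define w where "w = - (scl (c (2 * r)) v0 + scl (c (2 * r + 1)) v)"
  have "(\<Sum>i<2 * r. scl (c i) (y i)) = (\<Sum>i<2 * r. scl (c i) (x i))"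
    by (intro sum.cong) (auto simp: y_def)
  then have rel: "(\<Sum>i<2 * r. scl (c i) (x i)) = w"
    unfolding w_def using c(3) by (intro eq_neg_iff_add_eq_0[THEN iffD2]) (simp add: y_def add.assoc)
  have wk: "\<omega> w z = 0" "\<omega> z w = 0" for z
    using v0(2) v sk[of z w] by (simp_all add: w_def linear_form_simps[OF ll])
  have c0: "c i = 0" if "i < 2 * r" for i
    using alternating_form_dependent[OF wedge_power_alternating[OF \<omega>] wedge_power_annihilated[of \<omega> w, OF wk] rel that] x
    by blast
  then have "w = 0" using rel by simp
  then have w0: "scl (c (2 * r)) v0 + scl (c (2 * r + 1)) v = 0"
    unfolding w_def neg_equal_0_iff_equal .
  have nz1: "c (2 * r + 1) \<noteq> 0"
  proof
    assume "c (2 * r + 1) = 0"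
    then have "c (2 * r) = 0" using w0 v0(1) by simp
    then show False using c(1,2) c0 \<open>c (2 * r + 1) = 0\<close> by (auto simp: less_Suc_eq numeral_2_eq_2)
  qed
  have "scl (c (2 * r + 1)) v = - scl (c (2 * r)) v0" 
    using w0 eq_neg_iff_add_eq_0[of "scl (c (2 * r + 1)) v" "scl (c (2 * r)) v0"] by (metis add.commute)
  then have "v = scl (1 / c (2 * r + 1)) (- scl (c (2 * r)) v0)"
    using nz1 by (metis divide_self_if scale_one scale_scale times_divide_eq_left mult_1)
  also have "\<dots> = scl (- c (2 * r) / c (2 * r + 1)) v0" by simp
  finally show ?thesis by blast
qed

text \<open>
  The form \<open>\<zeta> \<and> (d\<zeta>)\<^sup>r\<close> has top degree and its contraction with \<open>v0\<close> vanishes.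
\<close>

lemma wedge_d_power_eq_zero:
  fixes \<zeta> :: "'a::ab_group_add \<Rightarrow> 'k::field_char_0"
  assumes f: "frame scl (2 * r + 1) b c" and z: "linear_form scl \<zeta>"
    and \<omega>: "bilinear_alt scl (d_one bracket \<zeta>)"
    and v0: "v0 \<noteq> 0" "\<And>y. d_one bracket \<zeta> v0 y = 0" "\<zeta> v0 = 0"
  shows "wedge_d_power bracket \<zeta> r = (\<lambda>x. 0)"
proof
  fix x
  let ?d = "d_one bracket \<zeta>"
  interpret vector_space scl using f by (simp add: frame_def)
  note ll = bilinear_altD(3)[OF \<omega>] and sk = bilinear_altD(2)[OF \<omega>]
  \<comment> \<open>the \<open>2 * r + 1\<close> arguments and \<open>v0\<close>: one vector too many\<close>
  define y where "y = x(2 * r + 1 := v0)"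
  obtain c j where c: "j < 2 * r + 2" "c j \<noteq> 0" "(\<Sum>i<2 * r + 2. scl (c i) (y i)) = 0"
    using frame_relation[OF f, of "2 * r + 2" y] by auto
  define w where "w = - scl (c (2 * r + 1)) v0"
  have "(\<Sum>i<2 * r + 1. scl (c i) (y i)) = (\<Sum>i<2 * r + 1. scl (c i) (x i))"
    by (intro sum.cong) (auto simp: y_def)
  then have rel: "(\<Sum>i<1 + 2 * r. scl (c i) (x i)) = w"
    using c(3) by (simp add: y_def w_def eq_neg_iff_add_eq_0)
  have wk: "?d w z = 0" "?d z w = 0" for z
    using v0(2) sk[of z w] by (simp_all add: w_def linear_form_simps[OF ll])
  have "annihilated_by w 1 (of_one_form \<zeta>)"
    using v0(3) by (auto simp: annihilated_by_def of_one_form_def w_def linear_form_simps[OF z])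
  from wedge_annihilated[OF this wedge_power_annihilated[of ?d w r, OF wk]]
  have ann: "annihilated_by w (1 + 2 * r) (wedge_d_power bracket \<zeta> r)" by (simp add: wedge_d_power_def)
  have "alternating_form scl 1 (of_one_form \<zeta>)"
    using z by (auto simp: alternating_form_def of_one_form_def linear_form_def)
  from wedge_alternating[OF this wedge_power_alternating[OF \<omega>, of r]]
  have alt: "alternating_form scl (1 + 2 * r) (wedge_d_power bracket \<zeta> r)" by (simp add: wedge_d_power_def)
  have "\<exists>i<1 + 2 * r. c i \<noteq> 0"
  proof (rule ccontr)
    assume "\<not> ?thesis"
    then have "c i = 0" if "i < 2 * r + 1" for i using that by auto
    then have "w = 0" "c (2 * r + 1) \<noteq> 0" using rel c(1,2) by (auto simp: less_Suc_eq numeral_2_eq_2)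
    then show False using v0(1) by (simp add: w_def)
  qed
  then show "wedge_d_power bracket \<zeta> r x = 0"
    using alternating_form_dependent[OF alt ann rel] by blast
qed

section \<open>Exact linear Poisson pairs and the secondary algebra\<close>

context lie_algebra
begin

lemma bracket_simps:
  "bracket (x + y) z = bracket x z + bracket y z"
  "bracket x (y + z) = bracket x y + bracket x z"
  "bracket (scl a x) z = scl a (bracket x z)"
  "bracket x (scl a z) = scl a (bracket x z)"
  "bracket (- x) z = - bracket x z"
  "bracket x (- z) = - bracket x z"
  "bracket (x - y) z = bracket x z - bracket y z"
  "bracket x (y - z) = bracket x y - bracket x z"
  "bracket 0 z = 0" "bracket x 0 = 0"
proof -
  interpret r: Vector_Spaces.linear scl scl "bracket x" for x by (rule bracket_linear_right)
  interpret l: Vector_Spaces.linear scl scl "\<lambda>x. bracket x y" for y by (rule bracket_linear_left)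
  show "bracket (x + y) z = bracket x z + bracket y z"
  "bracket x (y + z) = bracket x y + bracket x z"
  "bracket (scl a x) z = scl a (bracket x z)"
  "bracket x (scl a z) = scl a (bracket x z)"
  "bracket (- x) z = - bracket x z"
  "bracket x (- z) = - bracket x z"
  "bracket (x - y) z = bracket x z - bracket y z"
  "bracket x (y - z) = bracket x y - bracket x z"
  "bracket 0 z = 0" "bracket x 0 = 0"
    by (simp_all add: l.add r.add l.scale r.scale l.neg r.neg l.diff r.diff l.zero r.zero)
qed

lemma bracket_skew: "bracket x y = - bracket y x"
proof -
  have "bracket x x + bracket x y + (bracket y x + bracket y y) = 0"
    using bracket_self[of "x + y"] by (simp only: bracket_simps ac_simps)
  then show ?thesis
    by (simp add: bracket_self eq_neg_iff_add_eq_0)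
qed

lemma linear_form_bracket_alt:
  assumes "linear_form scl q"
  shows "bilinear_alt scl (\<lambda>a b. q (bracket a b))"
  unfolding bilinear_alt_def
proof (intro conjI allI)
  show "linear_form scl (\<lambda>b. q (bracket x b))" for x
    unfolding linear_form_def by (simp add: bracket_simps linear_form_simps[OF assms])
  show "q (bracket x y) = - q (bracket y x)" for x y
    by (subst bracket_skew) (simp add: linear_form_simps[OF assms])
qed

lemma d_one_alt:
  assumes "linear_form scl \<alpha>"
  shows "bilinear_alt scl (d_one bracket \<alpha>)"
proof -
  have "linear_form scl (\<lambda>x. - \<alpha> x)" using assms by (simp add: linear_form_def)
  from linear_form_bracket_alt[OF this] show ?thesis unfolding d_one_def[abs_def] .
qed

end

text \<open>
  Up to sign the two-form is the differential of \<open>q\<close>, so this is \<open>d \<circ> d = 0\<close>, that is, the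
  Jacobi identity.
\<close>

lemma (in lie_algebra) exact_two_form_closed:
  assumes "linear_form scl q"
  shows "d_two bracket (\<lambda>a b. q (bracket a b)) a b c = 0"
proof -
  note qs = linear_form_simps[OF assms]
  have "q (bracket a (bracket b c)) + q (bracket b (bracket c a)) + q (bracket c (bracket a b)) = 0"
    using arg_cong[OF jacobi[of a b c], of q] by (simp add: qs)
  moreover have "q (bracket (bracket a b) c) = - q (bracket c (bracket a b))"
    "q (bracket (bracket b c) a) = - q (bracket a (bracket b c))"
    by (subst bracket_skew, simp add: qs)+
  moreover have "q (bracket (bracket a c) b) = q (bracket b (bracket c a))"
    by (subst bracket_skew, subst bracket_skew[of a c]) (simp add: bracket_simps)
  ultimately show ?thesis unfolding d_two_def by (simp add: add_ac)
qed

text \<open>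
  The second bi-vector is the Lie--Poisson structure frozen at the point \<open>q\<close>.
\<close>

lemma (in lie_algebra) exact_linear_poisson_pair:
  assumes "linear_form scl q"
  shows "linear_poisson_pair scl bracket (lie_poisson bracket) (\<lambda>_ a b. q (bracket a b))"
proof -
  let ?\<omega> = "\<lambda>a b. q (bracket a b)"
  note alt = linear_form_bracket_alt[OF assms]
  have "two_form scl ?\<omega>"
    unfolding two_form_def linear_iff_linear_form
    using bilinear_altD(1,3)[OF alt] bracket_self linear_form_zero[OF assms] vector_space_axioms by simp
  then show ?thesis
    unfolding linear_poisson_pair_def using exact_two_form_closed[OF assms] by blast
qed

lemma sec_bracket_apply:
  "sec_bracket scl br (v, v', s) (w, w', t) = (br v w, br v w' - br w v' + scl t v' - scl s w', 0)"
  by (simp add: sec_bracket_def)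

lemma sec_vector_space:
  assumes "vector_space scl" shows "vector_space (sec_scale scl)"
proof -
  interpret vector_space scl by (rule assms)
  show ?thesis
    by unfold_locales (auto simp: sec_scale_def algebra_simps scale_right_distrib scale_left_distrib)
qed

lemma sum_split: "(\<Sum>i<m + (n::nat). f i) = (\<Sum>i<m. f i) + (\<Sum>i<n. f (i + m))"
  by (induction n) (simp_all add: add.assoc add.commute[of m])

lemma sec_frame:
  assumes f: "frame scl M b c"
  shows "frame (sec_scale scl) (2 * M + 1)
    (\<lambda>i. if i < M then (b i, 0, 0) else if i < 2 * M then (0, b (i - M), 0) else (0, 0, 1))
    (\<lambda>i (v, v', s). if i < M then c i v else if i < 2 * M then c (i - M) v' else s)"
    (is "frame _ _ ?b ?c")
proof -
  interpret vector_space scl using f by (simp add: frame_def)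
  have c: "linear_form scl (c i)" if "i < M" for i using f that by (simp add: frame_def)
  have cb: "c i (b j) = (if i = j then 1 else 0)" if "i < M" "j < M" for i j using f that by (simp add: frame_def)
  have dec: "(\<Sum>i<M. scl (c i v) (b i)) = v" for v using f by (simp add: frame_def)
  show ?thesis
    unfolding frame_def
  proof (intro conjI allI impI)
    show "vector_space (sec_scale scl)" by (rule sec_vector_space) (rule vector_space_axioms)
  next
    fix i assume "i < 2 * M + 1"
    then show "linear_form (sec_scale scl) (?c i)"
      using linear_form_simps[OF c] by (auto simp: linear_form_def sec_scale_def)
  next
    fix x :: "'b \<times> 'b \<times> 'a"
    obtain v v' s where x: "x = (v, v', s)" by (cases x)
    have 1: "(\<Sum>i<M. sec_scale scl (?c i x) (?b i)) = (v, 0, 0)"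
    proof -
      have "(\<Sum>i<M. sec_scale scl (?c i x) (?b i)) = (\<Sum>i<M. (scl (c i v) (b i), 0, 0))"
        by (intro sum.cong) (auto simp: x sec_scale_def)
      then show ?thesis by (simp add: sum_prod dec)
    qed
    have 2: "(\<Sum>i<M. sec_scale scl (?c (i + M) x) (?b (i + M))) = (0, v', 0)"
    proof -
      have "(\<Sum>i<M. sec_scale scl (?c (i + M) x) (?b (i + M))) = (\<Sum>i<M. (0, scl (c i v') (b i), 0))"
        by (intro sum.cong) (auto simp: x sec_scale_def)
      then show ?thesis by (simp add: sum_prod dec)
    qed
    have "(\<Sum>i<2 * M. sec_scale scl (?c i x) (?b i))
        = (\<Sum>i<M. sec_scale scl (?c i x) (?b i)) + (\<Sum>i<M. sec_scale scl (?c (i + M) x) (?b (i + M)))"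
      unfolding mult_2 by (rule sum_split)
    then show "(\<Sum>i<2 * M + 1. sec_scale scl (?c i x) (?b i)) = x"
      unfolding 1 2 by (simp add: x sec_scale_def)
  next
    fix i j assume "i < 2 * M + 1" "j < 2 * M + 1"
    then show "?c i (?b j) = (if i = j then 1 else 0)"
      using cb c linear_form_simps(5)[OF c] by (auto simp: not_less)
  qed
qed

text \<open>
  The point \<open>(\<phi>, \<zeta>, 0)\<close> of the dual of the secondary algebra.
\<close>

definition sec_fun :: "('a \<Rightarrow> 'k) \<Rightarrow> ('a \<Rightarrow> 'k) \<Rightarrow> 'a \<times> 'a \<times> 'k \<Rightarrow> 'k::field" where
  "sec_fun \<phi> \<zeta> = (\<lambda>(v, v', s). \<phi> v + \<zeta> v')"

lemma sec_lie_algebra: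
  assumes "lie_algebra scl br"
  shows "lie_algebra (sec_scale scl) (sec_bracket scl br)"
proof -
  interpret lie_algebra scl br by (rule assms)
  interpret S: vector_space "sec_scale scl" by (rule sec_vector_space) (rule vector_space_axioms)
  show ?thesis
  proof unfold_locales
    fix x y z :: "'b \<times> 'b \<times> 'a"
    obtain v v' s where x: "x = (v, v', s)" by (cases x)
    obtain w w' t where y: "y = (w, w', t)" by (cases y)
    obtain u u' r where z: "z = (u, u', r)" by (cases z)
    show "sec_bracket scl br x x = 0" by (simp add: x sec_bracket_apply bracket_self zero_prod_def)
    have j1: "br v (br w u') - br w (br v u') - br (br v w) u' = 0" for v w u'
      using jacobi[of v w u'] bracket_skew[of "br v w" u'] bracket_skew[of u' v]
      by (simp add: bracket_simps)
    have "sec_bracket scl br x (sec_bracket scl br y z) + sec_bracket scl br y (sec_bracket scl br z x) +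
      sec_bracket scl br z (sec_bracket scl br x y)
      = (br v (br w u) + br w (br u v) + br u (br v w),
         (br v (br w u') - br w (br v u') - br (br v w) u')
         + (br w (br u v') - br u (br w v') - br (br w u) v')
         + (br u (br v w') - br v (br u w') - br (br u v) w'), 0)"
      by (simp add: x y z sec_bracket_apply bracket_simps algebra_simps)
    then show "sec_bracket scl br x (sec_bracket scl br y z) + sec_bracket scl br y (sec_bracket scl br z x) +
      sec_bracket scl br z (sec_bracket scl br x y) = 0"
      unfolding j1 jacobi by (simp add: zero_prod_def)
  qed (auto simp: sec_bracket_def sec_scale_def bracket_simps algebra_simps)
qed

lemma sec_fun_linear:
  assumes "linear_form scl \<phi>" "linear_form scl \<zeta>"
  shows "linear_form (sec_scale scl) (sec_fun \<phi> \<zeta>)"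
  using assms by (auto simp: linear_form_def sec_fun_def sec_scale_def algebra_simps)

text \<open>
  If \<open>\<zeta> v0 \<noteq> 0\<close>, then evaluating the kernel equations at \<open>v0\<close> forces \<open>s = 0\<close>, and \<open>v'\<close> is then
  determined by \<open>v\<close>. Otherwise \<open>\<zeta>\<close> is the contraction of \<open>- d\<zeta>\<close> with a vector \<open>v1\<close>, the pairs
  \<open>(v, s)\<close> allowed by \<open>\<zeta>\<close> form a plane, and the skew form \<open>\<phi> \<circ> [\<cdot>, \<cdot>]\<close> on the span of \<open>v0\<close> and
  \<open>v1\<close> is nondegenerate, which leaves only \<open>v = 0\<close> and \<open>s = 0\<close>.
\<close>

lemma sec_kernel_line:
  fixes scl :: "'k::field_char_0 \<Rightarrow> 'a::ab_group_add \<Rightarrow> 'a"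
  assumes lie: "lie_algebra scl br" and \<phi>: "linear_form scl \<phi>" and \<zeta>: "linear_form scl \<zeta>"
    and v0: "v0 \<noteq> 0" "\<And>w. \<zeta> (br v0 w) = 0"
    and ker: "\<And>v. \<forall>w. \<zeta> (br v w) = 0 \<Longrightarrow> \<exists>a. v = scl a v0"
    and cases: "\<zeta> v0 \<noteq> 0 \<or> (\<exists>v1. (\<forall>w. \<zeta> (br v1 w) = \<zeta> w) \<and> \<phi> (br v0 v1) \<noteq> 0)"
  shows "\<exists>u0. \<forall>u. (\<forall>y. sec_fun \<phi> \<zeta> (sec_bracket scl br u y) = 0) \<longrightarrow> (\<exists>a. u = sec_scale scl a u0)"
proof -
  interpret lie_algebra scl br by (rule lie)
  note zs = linear_form_simps[OF \<zeta>] and ps = linear_form_simps[OF \<phi>]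
  define K where "K u \<longleftrightarrow> (\<forall>y. sec_fun \<phi> \<zeta> (sec_bracket scl br u y) = 0)" for u
  interpret S: lie_algebra "sec_scale scl" "sec_bracket scl br" by (rule sec_lie_algebra[OF lie])
  have K_diff: "K (u - sec_scale scl a u')" if "K u" "K u'" for u u' a
    using that unfolding K_def
    by (simp add: S.bracket_simps linear_form_simps[OF sec_fun_linear[OF \<phi> \<zeta>]])
  \<comment> \<open>the equations of the kernel: pair \<open>(v, v', s)\<close> with \<open>(0, w', 0)\<close>, \<open>(0, 0, 1)\<close> and \<open>(w, 0, 0)\<close>\<close>
  have Kw': "\<zeta> (br v w') = s * \<zeta> w'" if "K (v, v', s)" for v v' s w'
    using that[unfolded K_def, rule_format, of "(0, w', 0)"]
    by (simp add: sec_bracket_apply sec_fun_def bracket_simps zs ps)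
  have Kt: "\<zeta> v' = 0" if "K (v, v', s)" for v v' s
    using that[unfolded K_def, rule_format, of "(0, 0, 1)"]
    by (simp add: sec_bracket_apply sec_fun_def bracket_simps zs ps)
  have Kw: "\<phi> (br v w) + \<zeta> (br v' w) = 0" if "K (v, v', s)" for v v' s w
    using that[unfolded K_def, rule_format, of "(w, 0, 0)"] bracket_skew[of v' w]
    by (simp add: sec_bracket_apply sec_fun_def bracket_simps zs ps)
  show ?thesis
  proof (cases "\<zeta> v0 = 0")
    case False
    have form: "s = 0 \<and> (\<exists>a. v = scl a v0)" if k: "K (v, v', s)" for v v' s
    proof -
      have "s * \<zeta> v0 = 0" using Kw'[OF k, of v0] v0(2)[of v] bracket_skew[of v v0] by (simp add: zs)
      then have s: "s = 0" using False by simp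
      then show ?thesis using ker[of v] Kw'[OF k] by simp
    qed
    have zero: "v' = 0" if k: "K (0, v', 0)" for v'
    proof -
      obtain a where a: "v' = scl a v0" using ker[of v'] Kw[OF k] by (auto simp: bracket_simps ps)
      then show ?thesis using Kt[OF k] False by (simp add: zs)
    qed
    \<comment> \<open>the first component lives on the line of \<open>v0\<close> and determines the rest\<close>
    show ?thesis
    proof (cases "\<exists>v v' s. K (v, v', s) \<and> v \<noteq> 0")
      case False
      show ?thesis
      proof (rule exI[of _ 0], intro allI impI)
        fix u assume "\<forall>y. sec_fun \<phi> \<zeta> (sec_bracket scl br u y) = 0"
        then have k: "K u" by (simp add: K_def)
        obtain v v' s where u: "u = (v, v', s)" by (cases u)
        have "v = 0" using False k u by blast
        then have "u = 0" using form[of v v' s] zero[of v'] k u by (auto simp: zero_prod_def)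
        then show "\<exists>a. u = sec_scale scl a 0" by (auto simp: sec_scale_def zero_prod_def)
      qed
    next
      case True
      then obtain v v' s where u0: "K (v, v', s)" "v \<noteq> 0" by blast
      then obtain a where a: "s = 0" "v = scl a v0" "a \<noteq> 0" using form[OF u0(1)] by auto
      show ?thesis
      proof (rule exI[of _ "(v, v', s)"], intro allI impI)
        fix u assume "\<forall>y. sec_fun \<phi> \<zeta> (sec_bracket scl br u y) = 0"
        then have k: "K u" by (simp add: K_def)
        obtain x x' t where u: "u = (x, x', t)" by (cases u)
        obtain e where e: "t = 0" "x = scl e v0" using form k u by blast
        have "K (u - sec_scale scl (e / a) (v, v', s))" using k u0(1) by (rule K_diff)
        then have "K (0, x' - scl (e / a) v', 0)" using a e u by (simp add: sec_scale_def)
        from zero[OF this] have "u = sec_scale scl (e / a) (v, v', s)"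
          using a e u by (simp add: sec_scale_def)
        then show "\<exists>a. u = sec_scale scl a (v, v', s)" by blast
      qed
    qed
  next
    case True
    then obtain v1 where v1: "\<And>w. \<zeta> (br v1 w) = \<zeta> w" "\<phi> (br v0 v1) \<noteq> 0" using cases by blast
    show ?thesis
    proof (rule exI[of _ "(0, v0, 0)"], intro allI impI)
      fix u assume "\<forall>y. sec_fun \<phi> \<zeta> (sec_bracket scl br u y) = 0"
      then have k: "K u" by (simp add: K_def)
      obtain v v' s where u: "u = (v, v', s)" by (cases u)
      note k = k[unfolded u]
      have "\<zeta> (br (v - scl s v1) w) = 0" for w
        using Kw'[OF k] v1(1) by (simp add: bracket_simps zs)
      then obtain e where e: "v - scl s v1 = scl e v0" using ker by blast
      have v: "v = scl s v1 + scl e v0" using e by (simp add: algebra_simps)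
      have "\<phi> (br v v0) = 0" using Kw[OF k, of v0] v0(2)[of v'] bracket_skew[of v' v0] by (simp add: zs)
      then have "s * \<phi> (br v1 v0) = 0" by (simp add: v bracket_simps bracket_self ps)
      then have s: "s = 0" using v1(2) bracket_skew[of v0 v1] by (simp add: ps)
      have "\<zeta> (br v' v1) = 0" using v1(1)[of v'] Kt[OF k] bracket_skew[of v' v1] by (simp add: zs)
      then have "e * \<phi> (br v0 v1) = 0" using Kw[OF k, of v1] s by (simp add: v bracket_simps ps)
      then have v: "v = 0" using v1(2) v s by simp
      then have "\<exists>a. v' = scl a v0" using Kw[OF k] by (intro ker) (simp add: bracket_simps ps)
      then show "\<exists>a. u = sec_scale scl a (0, v0, 0)"
        using u v s by (auto simp: sec_scale_def)
    qed
  qed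
qed

section \<open>Genericity of the pencil\<close>

definition polynomial_map :: "('k::field \<Rightarrow> 'k) \<Rightarrow> bool" where
  "polynomial_map h \<longleftrightarrow> (\<exists>p. \<forall>s. h s = poly p s)"

lemma polynomial_map_const: "polynomial_map (\<lambda>s. a)"
  unfolding polynomial_map_def by (rule exI[of _ "[:a:]"]) simp

lemma polynomial_map_ident: "polynomial_map (\<lambda>s. s)"
  unfolding polynomial_map_def by (rule exI[of _ "[:0, 1:]"]) simp

lemma polynomial_map_add: "polynomial_map f \<Longrightarrow> polynomial_map g \<Longrightarrow> polynomial_map (\<lambda>s. f s + g s)"
  unfolding polynomial_map_def by (metis poly_add)

lemma polynomial_map_mult: "polynomial_map f \<Longrightarrow> polynomial_map g \<Longrightarrow> polynomial_map (\<lambda>s. f s * g s)"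
  unfolding polynomial_map_def by (metis poly_mult)

lemma polynomial_map_sum:
  "(\<And>i. i \<in> I \<Longrightarrow> polynomial_map (f i)) \<Longrightarrow> polynomial_map (\<lambda>s. \<Sum>i\<in>I. f i s)"
  by (induction I rule: infinite_finite_induct)
     (auto intro: polynomial_map_const polynomial_map_add)

lemma polynomial_map_wedge:
  assumes "\<And>x. polynomial_map (\<lambda>s. f s x)" "\<And>x. polynomial_map (\<lambda>s. g s x)"
  shows "polynomial_map (\<lambda>s. wedge p q (f s) (g s) x)"
proof -
  have "polynomial_map (\<lambda>s. (\<Sum>\<sigma> | \<sigma> permutes {..<p + q}.
      of_int (sign \<sigma>) * f s (\<lambda>i. x (\<sigma> i)) * g s (\<lambda>i. x (\<sigma> (p + i)))) * (1 / (fact p * fact q)))"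
    by (intro polynomial_map_mult polynomial_map_sum polynomial_map_const assms)
  then show ?thesis by (simp add: wedge_def)
qed

lemma polynomial_map_wedge_power:
  assumes "\<And>a b. polynomial_map (\<lambda>s. \<omega> s a b)"
  shows "polynomial_map (\<lambda>s. wedge_power (\<omega> s) k x)"
proof (induction k arbitrary: x)
  case 0
  then show ?case by (simp add: polynomial_map_const)
next
  case (Suc k)
  then show ?case unfolding wedge_power.simps
    by (intro polynomial_map_wedge) (simp_all add: of_two_form_def assms)
qed

lemma pencil_linear_form:
  assumes "linear_form scl \<alpha>" "linear_form scl \<beta>"
  shows "linear_form scl (\<lambda>x. s * \<alpha> x + t * \<beta> x)"
  using assms unfolding linear_form_def by (simp add: algebra_simps)

text \<open>
  For \<open>\<zeta> = s \<alpha> + t \<beta>\<close> with \<open>(d\<zeta>)\<^sup>r \<noteq> 0\<close> in dimension \<open>2 r + 1\<close>, such a vector \<open>v\<close> exists exactly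
  if \<open>\<zeta> \<and> (d\<zeta>)\<^sup>r = 0\<close>.
\<close>

definition degenerate_at ::
    "('a \<Rightarrow> 'a \<Rightarrow> 'a::zero) \<Rightarrow> ('a \<Rightarrow> 'k) \<Rightarrow> ('a \<Rightarrow> 'k::ring) \<Rightarrow> 'k \<Rightarrow> 'k \<Rightarrow> 'a \<Rightarrow> bool" where
  "degenerate_at br \<alpha> \<beta> s t v \<longleftrightarrow> v \<noteq> 0 \<and> s * \<alpha> v + t * \<beta> v = 0 \<and>
     (\<forall>y. d_one br (\<lambda>x. s * \<alpha> x + t * \<beta> x) v y = 0)"

text \<open>
  The values \<open>s\<close> for which \<open>s \<alpha> + \<beta>\<close> is degenerate are roots of the polynomial
  \<open>s \<mapsto> (\<zeta> \<and> (d\<zeta>)\<^sup>r)(x)\<close>, \<open>\<zeta> = s \<alpha> + \<beta>\<close>, where \<open>x\<close> is chosen such that it does not vanish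
  at \<open>s = 0\<close>. For each degenerate direction the vector \<open>v\<close> is unique up to a factor.
\<close>

lemma finite_degenerate_directions:
  fixes scl :: "complex \<Rightarrow> 'a::ab_group_add \<Rightarrow> 'a"
  assumes lie: "lie_algebra scl br" and f: "frame scl (2 * r + 1) b c"
    and \<alpha>: "linear_form scl \<alpha>" and \<beta>: "linear_form scl \<beta>"
    and gen: "generic_two_forms (Suc r) (d_one br \<alpha>) (d_one br \<beta>)"
    and nz: "wedge_d_power br \<beta> r \<noteq> (\<lambda>x. 0)"
  obtains F where "finite F" "0 \<notin> F"
    "\<And>s t v. (s, t) \<noteq> (0, 0) \<Longrightarrow> degenerate_at br \<alpha> \<beta> s t v \<Longrightarrow> s \<noteq> 0 \<and> (\<exists>a. \<exists>w\<in>F. v = scl a w)"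
proof -
  interpret lie_algebra scl br by (rule lie)
  let ?z = "\<lambda>s t x. s * \<alpha> x + t * \<beta> x"
  have lin: "linear_form scl (?z s t)" for s t by (rule pencil_linear_form[OF \<alpha> \<beta>])
  have alt: "bilinear_alt scl (d_one br (?z s t))" for s t by (rule d_one_alt[OF lin])
  have pow: "wedge_power (d_one br (?z s t)) r \<noteq> (\<lambda>x. 0)" if "(s, t) \<noteq> (0, 0)" for s t
  proof -
    have "d_one br (?z s t) = (\<lambda>a b. s * d_one br \<alpha> a b + t * d_one br \<beta> a b)"
      by (simp add: d_one_def fun_eq_iff)
    then show ?thesis using gen that unfolding generic_two_forms_def by simp
  qed
  obtain x where x: "wedge_d_power br \<beta> r x \<noteq> 0" using nz by auto
  have z_poly: "polynomial_map (\<lambda>s. ?z s 1 y)" for y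
    by (intro polynomial_map_add polynomial_map_mult polynomial_map_const polynomial_map_ident)
  have "polynomial_map (\<lambda>s. d_one br (?z s 1) y z)" for y z
    using polynomial_map_mult[OF polynomial_map_const[of "- 1"] z_poly[of "br y z"]]
    by (simp add: d_one_def)
  then have "polynomial_map (\<lambda>s. wedge_d_power br (?z s 1) r x)"
    unfolding wedge_d_power_def of_one_form_def
    by (intro polynomial_map_wedge polynomial_map_wedge_power z_poly)
  then obtain p where p: "\<And>s. wedge_d_power br (?z s 1) r x = poly p s"
    unfolding polynomial_map_def by blast
  have "poly p 0 \<noteq> 0" using x p[of 0] by simp
  then have fin: "finite {s. poly p s = 0}" by (metis poly_0 poly_roots_finite)
  have root: "poly p s = 0" if "degenerate_at br \<alpha> \<beta> s 1 v" for s v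
    using wedge_d_power_eq_zero[OF f lin alt, of v s 1] that p[of s] unfolding degenerate_at_def by simp
  have scale: "degenerate_at br \<alpha> \<beta> (s / t) 1 v" if "degenerate_at br \<alpha> \<beta> s t v" "t \<noteq> 0" for s t v
  proof -
    have e: "s / t * p + 1 * q = (s * p + t * q) / t" for p q using that(2) by (simp add: field_simps)
    show ?thesis using that(1) unfolding degenerate_at_def d_one_def e neg_equal_0_iff_equal by simp
  qed
  \<comment> \<open>away from \<open>t = 0\<close> the parameters can be scaled to \<open>t = 1\<close>; the direction \<open>(1, 0)\<close> is kept as a candidate in any case\<close>
  define D where "D = insert (1, 0) ((\<lambda>s. (s, 1 :: complex)) ` {s. poly p s = 0})"
  have "\<exists>v. v \<noteq> 0 \<and> (\<forall>y. d_one br (?z s t) v y = 0)" for s t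
    by (rule alternating_odd_kernel[OF f alt]) simp
  then obtain w where w: "\<And>s t. w s t \<noteq> 0" "\<And>s t y. d_one br (?z s t) (w s t) y = 0" by metis
  have D0: "(s, t) \<noteq> (0, 0)" if "(s, t) \<in> D" for s t using that by (auto simp: D_def)
  show thesis
  proof (rule that[of "case_prod w ` D"])
    show "finite (case_prod w ` D)" using fin by (simp add: D_def)
    show "0 \<notin> case_prod w ` D" using w(1) by (metis (no_types, lifting) case_prod_beta imageE)
    fix s t v assume st: "(s, t) \<noteq> (0, 0)" and deg: "degenerate_at br \<alpha> \<beta> s t v"
    \<comment> \<open>\<open>s = 0\<close> is excluded because the polynomial does not vanish at the direction of \<open>\<beta>\<close>\<close>
    have "s \<noteq> 0"
    proof
      assume s: "s = 0"
      then have "poly p (s / t) = 0" using scale[OF deg] st root by simp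
      then show False using \<open>poly p 0 \<noteq> 0\<close> s by simp
    qed
    have "\<exists>s' t'. (s', t') \<in> D \<and> degenerate_at br \<alpha> \<beta> s' t' v"
    proof (cases "t = 0")
      case True
      then have "degenerate_at br \<alpha> \<beta> 1 0 v" using deg \<open>s \<noteq> 0\<close> by (simp add: degenerate_at_def d_one_def)
      then show ?thesis by (auto simp: D_def)
    next
      case False
      then have "degenerate_at br \<alpha> \<beta> (s / t) 1 v" by (rule scale[OF deg])
      moreover from root[OF this] have "(s / t, 1) \<in> D" by (simp add: D_def)
      ultimately show ?thesis by blast
    qed
    then obtain s' t' where D: "(s', t') \<in> D" and deg': "degenerate_at br \<alpha> \<beta> s' t' v" by blast
    have "\<exists>a. v = scl a (w s' t')"
      by (rule kernel_line_if_wedge_power_nonzero[OF f alt pow[OF D0[OF D]] w(1) w(2)])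
        (use deg' in \<open>simp add: degenerate_at_def\<close>)
    moreover have "w s' t' \<in> case_prod w ` D" using D by (intro image_eqI[of _ _ "(s', t')"]) simp_all
    ultimately show "s \<noteq> 0 \<and> (\<exists>a. \<exists>w\<in>case_prod w ` D. v = scl a w)" using \<open>s \<noteq> 0\<close> by blast
  qed
qed

text \<open>
  The algebra \<open>\<A>\<^sub>\<zeta>\<close> is spanned by \<open>v0\<close> and a solution \<open>v1\<close>. By the Jacobi identity the bracket
  of the two lies in the kernel of \<open>d\<zeta>\<close>, the line of \<open>v0\<close>; it is nonzero because the algebra is not
  abelian.
\<close>

lemma kernel_bracket_nonzero:
  assumes lie: "lie_algebra scl br" and z: "linear_form scl \<zeta>"
    and v0: "v0 \<noteq> 0" "\<And>y. d_one br \<zeta> v0 y = 0"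
    and ker: "\<And>v. (\<And>y. d_one br \<zeta> v y = 0) \<Longrightarrow> \<exists>a. v = scl a v0"
    and w0: "wedge_d_power br \<zeta> (n - 1) = (\<lambda>x. 0)"
    and S: "assoc_subalgebra n scl br \<zeta> = {0} \<or> \<not> abelian_on br (assoc_subalgebra n scl br \<zeta>)"
  obtains v1 a where "\<And>w. \<zeta> (br v1 w) = \<zeta> w" "br v0 v1 = scl a v0" "a \<noteq> 0"
proof -
  interpret lie_algebra scl br by (rule lie)
  note zs = linear_form_simps[OF z]
  let ?sol = "{v. \<forall>y. d_one br \<zeta> v y = - \<zeta> y}" and ?ker = "{x. \<forall>y. d_one br \<zeta> x y = 0}"
  have A: "assoc_subalgebra n scl br \<zeta> = span (?sol \<union> ?ker)" using w0 by (simp add: assoc_subalgebra_def)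
  have "v0 \<in> span (?sol \<union> ?ker)" using v0(2) by (intro span_base) simp
  then have nonab: "\<not> abelian_on br (span (?sol \<union> ?ker))" using S v0(1) unfolding A by blast
  \<comment> \<open>without a solution the subalgebra would be the line of \<open>v0\<close>, which is abelian\<close>
  have sol: "?sol \<noteq> {}"
  proof
    assume "?sol = {}"
    have sub: "span ?ker \<subseteq> range (\<lambda>a. scl a v0)"
    proof (rule span_minimal)
      show "?ker \<subseteq> range (\<lambda>a. scl a v0)" using ker by blast
      show "subspace (range (\<lambda>a. scl a v0))" by (metis span_singleton subspace_span)
    qed
    have "br u u' = 0" if "u \<in> span ?ker" "u' \<in> span ?ker" for u u'
    proof -
      obtain a a' where "u = scl a v0" "u' = scl a' v0" using sub \<open>u \<in> _\<close> \<open>u' \<in> _\<close> by blast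
      then show ?thesis by (simp add: bracket_simps bracket_self)
    qed
    then have "abelian_on br (span ?ker)" unfolding abelian_on_def by blast
    then show False using nonab \<open>?sol = {}\<close> by simp
  qed
  then obtain v1 where v1: "\<And>y. d_one br \<zeta> v1 y = - \<zeta> y" by blast
  then have v1': "\<zeta> (br v1 y) = \<zeta> y" for y by (simp add: d_one_def)
  have v0': "\<zeta> (br v0 y) = 0" for y using v0(2)[of y] by (simp add: d_one_def)
  have "\<zeta> (br (br v0 v1) y) = 0" for y
  proof -
    have "br (br v0 v1) y = br v0 (br v1 y) - br v1 (br v0 y)"
      using jacobi[of v0 v1 y] bracket_skew[of "br v0 v1" y] bracket_skew[of y v0]
      by (simp add: bracket_simps algebra_simps)
    then show ?thesis by (simp add: zs v0' v1')
  qed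
  then obtain a where a: "br v0 v1 = scl a v0" using ker[of "br v0 v1"] by (auto simp: d_one_def)
  have "a \<noteq> 0"
  proof
    assume "a = 0"
    then have c01: "br v0 v1 = 0" "br v1 v0 = 0" using a bracket_skew[of v1 v0] by simp_all
    have "?sol \<union> ?ker \<subseteq> span {v0, v1}"
    proof
      fix u assume u: "u \<in> ?sol \<union> ?ker"
      have k: "x \<in> span {v0, v1}" if "\<forall>y. d_one br \<zeta> x y = 0" for x
        using ker that by (metis insertI1 span_base span_scale)
      show "u \<in> span {v0, v1}"
      proof (cases "u \<in> ?ker")
        case False
        then have "\<forall>y. d_one br \<zeta> u y = - \<zeta> y" using u by blast
        then have "\<forall>y. d_one br \<zeta> (u - v1) y = 0" using v1' by (simp add: d_one_def bracket_simps zs)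
        then have "u - v1 \<in> span {v0, v1}" by (rule k)
        moreover have "v1 \<in> span {v0, v1}" by (rule span_base) simp
        ultimately have "(u - v1) + v1 \<in> span {v0, v1}" by (rule span_add)
        then show ?thesis by simp
      qed (use k in simp)
    qed
    then have sub: "span (?sol \<union> ?ker) \<subseteq> span {v0, v1}" by (rule span_minimal) simp
    have "br u u' = 0" if "u \<in> span {v0, v1}" "u' \<in> span {v0, v1}" for u u'
    proof -
      have "\<exists>p q. x = scl p v0 + scl q v1" if x: "x \<in> span {v0, v1}" for x
      proof -
        obtain p where "x - scl p v0 \<in> span {v1}" using x span_breakdown_eq by blast
        then obtain q where "x - scl p v0 = scl q v1" by (auto simp: span_singleton)
        then have "x = scl p v0 + scl q v1" by (simp add: algebra_simps)
        then show ?thesis by blast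
      qed
      from this[OF that(1)] this[OF that(2)]
      obtain p q p' q' where "u = scl p v0 + scl q v1" "u' = scl p' v0 + scl q' v1" by blast
      then show ?thesis by (simp add: bracket_simps bracket_self c01)
    qed
    then show False using nonab sub unfolding abelian_on_def by blast
  qed
  then show thesis using that v1' a by blast
qed

text \<open>
  The member \<open>(s, t)\<close> of the pencil is the Lie--Poisson structure at
  \<open>(s \<phi>, s \<alpha> + t \<beta>, 0)\<close>. Its kernel has dimension at most one: for degenerate directions this is
  where the non-abelian algebras \<open>\<A>\<^sub>\<zeta>\<close> and the choice of \<open>\<phi>\<close> come in.
\<close>

lemma sec_pencil_generic:
  fixes scl :: "complex \<Rightarrow> 'a::ab_group_add \<Rightarrow> 'a"
  assumes lie: "lie_algebra scl br" and f: "frame scl (2 * r + 1) b c"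
    and \<alpha>: "linear_form scl \<alpha>" and \<beta>: "linear_form scl \<beta>" and \<phi>: "linear_form scl \<phi>"
    and gen: "generic_couple (Suc r) scl br \<alpha> \<beta>"
    and avoid: "\<And>s t v. (s, t) \<noteq> (0, 0) \<Longrightarrow> degenerate_at br \<alpha> \<beta> s t v \<Longrightarrow> s * \<phi> v \<noteq> 0"
    and st: "(s, t) \<noteq> (0, 0)"
  shows "\<exists>x. wedge_power (\<lambda>a b. s * sec_fun \<phi> \<alpha> (sec_bracket scl br a b)
    + t * sec_fun (\<lambda>v. 0) \<beta> (sec_bracket scl br a b)) (2 * r + 1) x \<noteq> 0"
proof -
  interpret lie_algebra scl br by (rule lie)
  define \<zeta> where "\<zeta> x = s * \<alpha> x + t * \<beta> x" for x
  have z: "linear_form scl \<zeta>" unfolding \<zeta>_def by (rule pencil_linear_form[OF \<alpha> \<beta>])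
  have p: "linear_form scl (\<lambda>v. s * \<phi> v)" using \<phi> by (simp add: linear_form_def algebra_simps)
  have alt: "bilinear_alt scl (d_one br \<zeta>)" by (rule d_one_alt[OF z])
  have "d_one br \<zeta> = (\<lambda>a b. s * d_one br \<alpha> a b + t * d_one br \<beta> a b)"
    by (simp add: d_one_def \<zeta>_def fun_eq_iff)
  then have pow: "wedge_power (d_one br \<zeta>) r \<noteq> (\<lambda>x. 0)"
    using gen st unfolding generic_couple_def generic_two_forms_def by simp
  obtain v0 where v0: "v0 \<noteq> 0" "\<And>y. d_one br \<zeta> v0 y = 0"
    using alternating_odd_kernel[OF f alt] by auto
  have ker: "\<exists>a. v = scl a v0" if "\<And>y. d_one br \<zeta> v y = 0" for v
    by (rule kernel_line_if_wedge_power_nonzero[OF f alt pow v0 that])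
  have cases: "\<zeta> v0 \<noteq> 0 \<or> (\<exists>v1. (\<forall>w. \<zeta> (br v1 w) = \<zeta> w) \<and> s * \<phi> (br v0 v1) \<noteq> 0)"
  proof (cases "\<zeta> v0 = 0")
    case True
    have w0: "wedge_d_power br \<zeta> (Suc r - 1) = (\<lambda>x. 0)"
      using wedge_d_power_eq_zero[OF f z alt v0 True] by simp
    have "assoc_subalgebra (Suc r) scl br \<zeta> = {0} \<or> \<not> abelian_on br (assoc_subalgebra (Suc r) scl br \<zeta>)"
      using gen st unfolding generic_couple_def Let_def \<zeta>_def by blast
    from kernel_bracket_nonzero[OF lie z v0 ker w0 this]
    obtain v1 a where v1: "\<And>w. \<zeta> (br v1 w) = \<zeta> w" "br v0 v1 = scl a v0" "a \<noteq> 0" by metis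
    have "degenerate_at br \<alpha> \<beta> s t v0" using v0 True unfolding degenerate_at_def \<zeta>_def by blast
    then have "s * \<phi> v0 \<noteq> 0" by (rule avoid[OF st])
    then have "s * \<phi> (br v0 v1) \<noteq> 0" using v1 by (simp add: linear_form_simps[OF \<phi>])
    then show ?thesis using v1 by blast
  qed simp
  have v0': "\<zeta> (br v0 w) = 0" for w using v0(2)[of w] by (simp add: d_one_def)
  have ker': "\<exists>a. v = scl a v0" if "\<forall>w. \<zeta> (br v w) = 0" for v using ker that by (simp add: d_one_def)
  obtain u0 where u0: "\<And>u. \<forall>y. sec_fun (\<lambda>v. s * \<phi> v) \<zeta> (sec_bracket scl br u y) = 0 \<Longrightarrow> \<exists>a. u = sec_scale scl a u0"
    using sec_kernel_line[OF lie p z v0(1) v0' ker' cases] by blast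
  interpret S: lie_algebra "sec_scale scl" "sec_bracket scl br" by (rule sec_lie_algebra[OF lie])
  let ?\<omega> = "\<lambda>a b. sec_fun (\<lambda>v. s * \<phi> v) \<zeta> (sec_bracket scl br a b)"
  have lin: "linear_form (sec_scale scl) (sec_fun (\<lambda>v. s * \<phi> v) \<zeta>)" by (rule sec_fun_linear[OF p z])
  have "bilinear_alt (sec_scale scl) ?\<omega>" by (rule S.linear_form_bracket_alt[OF lin])
  from wedge_power_nonzero_if_kernel_line[OF sec_frame[OF f] this u0]
  obtain x where "wedge_power ?\<omega> (2 * r + 1) x \<noteq> 0" by blast
  moreover have "?\<omega> = (\<lambda>a b. s * sec_fun \<phi> \<alpha> (sec_bracket scl br a b)
    + t * sec_fun (\<lambda>v. 0) \<beta> (sec_bracket scl br a b))"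
    by (auto simp: fun_eq_iff sec_fun_def \<zeta>_def algebra_simps split: prod.split)
  ultimately show ?thesis by auto
qed

text \<open>
  A vector space over an infinite field is not a finite union of proper subspaces. The map
  \<open>ev v\<close> is complex valued, so that real linear forms can be evaluated at complex vectors.
\<close>

lemma avoid_finitely_many_zeros:
  fixes ev :: "'v \<Rightarrow> ('a::ab_group_add \<Rightarrow> 'k::field) \<Rightarrow> complex" and scl :: "'k \<Rightarrow> 'a \<Rightarrow> 'a"
  assumes "finite F" "infinite (UNIV :: 'k set)" "inj \<iota>"
    and ev: "\<And>v \<phi> \<psi> a. ev v (\<lambda>x. \<phi> x + a * \<psi> x) = ev v \<phi> + \<iota> a * ev v \<psi>"
    and ex: "\<And>v. v \<in> F \<Longrightarrow> \<exists>\<phi>. linear_form scl \<phi> \<and> ev v \<phi> \<noteq> 0"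
  shows "\<exists>\<phi>. linear_form scl \<phi> \<and> (\<forall>v\<in>F. ev v \<phi> \<noteq> 0)"
  using assms(1) ex
proof (induction F rule: finite_induct)
  case empty
  have "linear_form scl (\<lambda>x. 0)" by (simp add: linear_form_def)
  then show ?case by blast
next
  case (insert v F)
  then obtain \<phi> where \<phi>: "linear_form scl \<phi>" "\<forall>v\<in>F. ev v \<phi> \<noteq> 0" by auto
  obtain \<psi> where \<psi>: "linear_form scl \<psi>" "ev v \<psi> \<noteq> 0" using insert.prems[of v] by auto
  define Bad where "Bad w = {a. ev w \<phi> + \<iota> a * ev w \<psi> = 0}" for w
  have "finite (Bad w)" if w: "w \<in> insert v F" for w
  proof (cases "ev w \<psi> = 0")
    case True
    then have "ev w \<phi> \<noteq> 0" using w \<phi>(2) \<psi>(2) by auto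
    then show ?thesis using True by (simp add: Bad_def)
  next
    case False
    have "Bad w \<subseteq> \<iota> -` {- ev w \<phi> / ev w \<psi>}"
      using False by (auto simp: Bad_def field_simps eq_neg_iff_add_eq_0)
    moreover have "finite (\<iota> -` {- ev w \<phi> / ev w \<psi>})" by (rule finite_vimageI[OF _ assms(3)]) simp
    ultimately show ?thesis by (rule finite_subset)
  qed
  then have "finite (\<Union>w\<in>insert v F. Bad w)" using insert.hyps by blast
  then obtain a where "a \<notin> (\<Union>w\<in>insert v F. Bad w)" using assms(2) ex_new_if_finite by blast
  then have "\<forall>w\<in>insert v F. ev w (\<lambda>x. \<phi> x + a * \<psi> x) \<noteq> 0" by (simp add: ev Bad_def)
  moreover have "linear_form scl (\<lambda>x. \<phi> x + a * \<psi> x)"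
    using \<phi>(1) \<psi>(1) by (simp add: linear_form_def algebra_simps)
  ultimately show ?case by blast
qed

section \<open>Directional derivatives\<close>

abbreviation ray :: "('i \<Rightarrow> 'k::ring) \<Rightarrow> 'k \<Rightarrow> ('i \<Rightarrow> 'k) \<Rightarrow> 'i \<Rightarrow> 'k" where
  "ray x t h \<equiv> (\<lambda>i. x i + t * h i)"

definition dir_deriv :: "(('i \<Rightarrow> 'k::real_normed_field) \<Rightarrow> 'k) \<Rightarrow> ('i \<Rightarrow> 'k) \<Rightarrow> ('i \<Rightarrow> 'k) \<Rightarrow> 'k \<Rightarrow> bool" where
  "dir_deriv f h x d \<longleftrightarrow> ((\<lambda>t. f (ray x t h)) has_field_derivative d) (at 0)"

lemma dir_deriv_unique: "dir_deriv f h x d \<Longrightarrow> dir_deriv f h x d' \<Longrightarrow> d = d'"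
  unfolding dir_deriv_def by (rule DERIV_unique)

lemma dir_deriv_along_ray:
  assumes "dir_deriv f h (ray x s h) d"
  shows "((\<lambda>t. f (ray x t h)) has_field_derivative d) (at s)"
proof -
  have "((\<lambda>t. f (ray x (t + s) h)) has_field_derivative d) (at 0)"
    using assms unfolding dir_deriv_def by (simp add: algebra_simps)
  then show ?thesis using DERIV_shift[of "\<lambda>t. f (ray x t h)" d 0 s] by simp
qed

lemma dir_deriv_scale:
  fixes f :: "('i \<Rightarrow> 'k::real_normed_field) \<Rightarrow> 'k"
  assumes "dir_deriv f h q d"
  shows "dir_deriv f (\<lambda>i. a * h i) q (a * d)"
proof -
  have "((\<lambda>t. f (ray q t h)) has_field_derivative d) (at (0 * a))" using assms by (simp add: dir_deriv_def)
  moreover have "((\<lambda>t. t * a) has_field_derivative 1 * a) (at 0)" by (intro DERIV_cmult_right DERIV_ident)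
  ultimately have "((\<lambda>t. f (ray q (t * a) h)) has_field_derivative d * (1 * a)) (at 0)"
    by (rule DERIV_chain2)
  then show ?thesis unfolding dir_deriv_def by (simp add: mult_ac)
qed

text \<open>
  Differential calculus in a linear subspace \<open>S\<close> of a function space, which carries no norm.
  Everything is reduced to functions of one or two scalar variables along the rays
  \<open>q + s h + t k\<close>.
\<close>

locale open_in_directions =
  fixes S U :: "('i \<Rightarrow> 'k::real_normed_field) set"
  assumes ray_closed: "x \<in> S \<Longrightarrow> h \<in> S \<Longrightarrow> ray x t h \<in> S"
    and open_U: "openin (top_of_set S) U"
begin

lemma U_subset: "U \<subseteq> S"
  using open_U openin_imp_subset by blast

lemma rays_stay_near:
  assumes "q \<in> U" "h \<in> S" "k \<in> S"
  obtains \<delta> where "\<delta> > 0" "\<And>s t. norm s < \<delta> \<Longrightarrow> norm t < \<delta> \<Longrightarrow> ray (ray q s h) t k \<in> U"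
proof -
  let ?g = "\<lambda>z :: 'k \<times> 'k. ray (ray q (fst z) h) (snd z) k"
  have cont: "continuous_on UNIV ?g"
    by (intro continuous_on_coordinatewise_then_product continuous_intros)
  have "?g \<in> UNIV \<rightarrow> S" using assms U_subset ray_closed by blast
  from continuous_openin_preimage[OF cont this open_U]
  have "open (?g -` U)" by simp
  moreover have "(0, 0) \<in> ?g -` U" using assms by simp
  ultimately obtain e where e: "e > 0" "ball (0, 0) e \<subseteq> ?g -` U"
    by (rule openE)
  show thesis
  proof (rule that[of "e / 2"])
    fix s t :: 'k assume st: "norm s < e / 2" "norm t < e / 2"
    have "norm (s, t) \<le> norm s + norm t" by (rule norm_Pair_le)
    then have "(s, t) \<in> ball (0, 0) e" using st unfolding mem_ball by (subst dist_commute) (simp add: dist_norm)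
    then show "ray (ray q s h) t k \<in> U" using e(2) by auto
  qed (use e in simp)
qed

lemma continuous_along_rays:
  assumes q: "q \<in> U" "h \<in> S" "k \<in> S" and g: "continuous_on U g" and "\<epsilon> > 0"
  obtains \<delta> where "\<delta> > 0" "\<And>s t. norm s < \<delta> \<Longrightarrow> norm t < \<delta> \<Longrightarrow>
    ray (ray q s h) t k \<in> U \<and> norm (g (ray (ray q s h) t k) - g q) < \<epsilon>"
proof -
  let ?U = "U \<inter> g -` ball (g q) \<epsilon>"
  have "openin (top_of_set U) ?U" by (rule continuous_openin_preimage_gen[OF g open_ball])
  then have "openin (top_of_set S) ?U" by (rule openin_trans[OF _ open_U])
  then interpret near: open_in_directions S ?U by unfold_locales (use ray_closed in blast)
  have "q \<in> ?U" using q \<open>\<epsilon> > 0\<close> by simp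
  then obtain \<delta> where "\<delta> > 0" "\<And>s t. norm s < \<delta> \<Longrightarrow> norm t < \<delta> \<Longrightarrow> ray (ray q s h) t k \<in> ?U"
    using near.rays_stay_near[OF _ q(2,3)] by blast
  then show thesis using that[of \<delta>] by (auto simp: dist_norm norm_minus_commute)
qed

text \<open>
  Continuity of the derivative makes the difference quotient along \<open>k\<close> uniform in the base point.
\<close>
lemma strict_difference:
  assumes q: "q \<in> U" "h \<in> S" "k \<in> S" and f: "\<And>x. x \<in> U \<Longrightarrow> dir_deriv f k x (g x)"
    and g: "continuous_on U g" and "\<epsilon> > 0"
  obtains \<delta> where "\<delta> > 0" "\<And>s t. norm s < \<delta> \<Longrightarrow> norm t < \<delta> \<Longrightarrow>
    norm (f (ray (ray q s h) t k) - f (ray q s h) - t * g q) \<le> \<epsilon> * norm t"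
proof -
  obtain \<delta> where \<delta>: "\<delta> > 0" "\<And>s t. norm s < \<delta> \<Longrightarrow> norm t < \<delta> \<Longrightarrow>
    ray (ray q s h) t k \<in> U \<and> norm (g (ray (ray q s h) t k) - g q) < \<epsilon>"
    using continuous_along_rays[OF q g \<open>\<epsilon> > 0\<close>] by blast
  show thesis
  proof (rule that[OF \<delta>(1)])
    fix s t :: 'k assume s: "norm s < \<delta>" and t: "norm t < \<delta>"
    let ?f = "\<lambda>t. f (ray (ray q s h) t k) - t * g q"
    \<comment> \<open>the mean value inequality: the derivative of \<open>?f\<close> is at most \<open>\<epsilon>\<close> near \<open>q\<close>\<close>
    have "norm (?f t - ?f 0) \<le> \<epsilon> * norm (t - 0)"
    proof (rule field_differentiable_bound)
      fix z :: 'k assume "z \<in> ball 0 \<delta>"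
      then have z: "norm z < \<delta>" by simp
      have "((\<lambda>t. f (ray (ray q s h) t k)) has_field_derivative g (ray (ray q s h) z k)) (at z)"
        by (rule dir_deriv_along_ray) (use f \<delta>(2)[OF s z] in blast)
      then have "(?f has_field_derivative g (ray (ray q s h) z k) - 1 * g q) (at z)"
        by (intro DERIV_diff DERIV_cmult_right DERIV_ident)
      then show "(?f has_field_derivative g (ray (ray q s h) z k) - g q) (at z within ball 0 \<delta>)"
        by (simp add: has_field_derivative_at_within)
      show "norm (g (ray (ray q s h) z k) - g q) \<le> \<epsilon>" using \<delta>(2)[OF s z] by simp
    qed (use t \<delta>(1) in auto)
    then show "norm (f (ray (ray q s h) t k) - f (ray q s h) - t * g q) \<le> \<epsilon> * norm t"
      by (simp add: algebra_simps)
  qed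
qed

lemma dir_deriv_add:
  assumes q: "q \<in> U" "h \<in> S" "k \<in> S" and h: "dir_deriv f h q a"
    and f: "\<And>x. x \<in> U \<Longrightarrow> dir_deriv f k x (g x)" and g: "continuous_on U g"
  shows "dir_deriv f (\<lambda>i. h i + k i) q (a + g q)"
proof -
  \<comment> \<open>the increment along \<open>h + k\<close> is the one along \<open>h\<close> followed by \<open>?R\<close>, an increment along \<open>k\<close> from a moving base point\<close>
  let ?R = "\<lambda>t. f (ray (ray q t h) t k) - f (ray q t h)"
  have "(?R has_field_derivative g q) (at 0)"
    unfolding DERIV_def
  proof (rule LIM_I)
    fix r :: real assume "r > 0"
    then have "r / 2 > 0" by simp
    from strict_difference[OF q f g this]
    obtain \<delta> where \<delta>: "\<delta> > 0" "\<And>s t. norm s < \<delta> \<Longrightarrow> norm t < \<delta> \<Longrightarrow>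
      norm (f (ray (ray q s h) t k) - f (ray q s h) - t * g q) \<le> r / 2 * norm t" by blast
    show "\<exists>s>0. \<forall>x. x \<noteq> 0 \<and> norm (x - 0) < s \<longrightarrow> norm ((?R (0 + x) - ?R 0) / x - g q) < r"
    proof (intro exI[of _ \<delta>] conjI allI impI)
      fix t :: 'k assume t: "t \<noteq> 0 \<and> norm (t - 0) < \<delta>"
      have "norm ((?R (0 + t) - ?R 0) / t - g q) = norm (?R t - t * g q) / norm t"
        using t by (simp add: norm_divide[symmetric] diff_divide_distrib)
      also have "\<dots> \<le> r / 2" using \<delta>(2)[of t t] t by (simp add: divide_le_eq)
      also have "\<dots> < r" using \<open>r > 0\<close> by simp
      finally show "norm ((?R (0 + t) - ?R 0) / t - g q) < r" .
    qed (rule \<delta>(1))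
  qed
  from DERIV_add[OF h[unfolded dir_deriv_def] this]
  show ?thesis unfolding dir_deriv_def by (simp add: algebra_simps)
qed

lemma second_difference:
  assumes q: "q \<in> U" "h \<in> S" "k \<in> S" and f: "\<And>x. x \<in> U \<Longrightarrow> dir_deriv f h x (g x)"
    and g: "\<And>x. x \<in> U \<Longrightarrow> dir_deriv g k x (g' x)" and g': "continuous_on U g'" and "\<epsilon> > 0"
  obtains \<delta> where "\<delta> > 0" "\<And>t. norm t < \<delta> \<Longrightarrow>
    norm (f (ray (ray q t h) t k) - f (ray q t h) - f (ray q t k) + f q - t * t * g' q) \<le> \<epsilon> * (norm t * norm t)"
proof -
  obtain \<delta>1 where \<delta>1: "\<delta>1 > 0" "\<And>s t. norm s < \<delta>1 \<Longrightarrow> norm t < \<delta>1 \<Longrightarrow>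
      norm (g (ray (ray q s h) t k) - g (ray q s h) - t * g' q) \<le> \<epsilon> * norm t"
    using strict_difference[OF q g g' \<open>\<epsilon> > 0\<close>] by blast
  obtain \<delta>2 where \<delta>2: "\<delta>2 > 0" "\<And>s t. norm s < \<delta>2 \<Longrightarrow> norm t < \<delta>2 \<Longrightarrow> ray (ray q s h) t k \<in> U"
    using rays_stay_near[OF q] by blast
  define \<delta> where "\<delta> = min \<delta>1 \<delta>2"
  show thesis
  proof (rule that[of \<delta>])
    show "\<delta> > 0" using \<delta>1 \<delta>2 by (simp add: \<delta>_def)
    fix t :: 'k assume t: "norm t < \<delta>"
    have swap: "ray (ray q s h) t k = ray (ray q t k) s h" for s by (simp add: algebra_simps)
    let ?f = "\<lambda>s. f (ray (ray q s h) t k) - f (ray q s h) - s * (t * g' q)"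
    have "norm (?f t - ?f 0) \<le> (\<epsilon> * norm t) * norm (t - 0)"
    proof (rule field_differentiable_bound)
      fix z :: 'k assume "z \<in> ball 0 \<delta>"
      then have z: "norm z < \<delta>1" "norm z < \<delta>2" by (auto simp: \<delta>_def)
      have t': "norm t < \<delta>1" "norm t < \<delta>2" using t by (auto simp: \<delta>_def)
      have "ray (ray q t k) z h \<in> U" using \<delta>2(2)[OF z(2) t'(2)] swap[of z] by simp
      then have "((\<lambda>s. f (ray (ray q t k) s h)) has_field_derivative g (ray (ray q t k) z h)) (at z)"
        by (intro dir_deriv_along_ray f)
      then have 1: "((\<lambda>s. f (ray (ray q s h) t k)) has_field_derivative g (ray (ray q z h) t k)) (at z)"
        unfolding swap .
      have "ray q z h \<in> U" using \<delta>2(2)[OF z(2), of 0] \<delta>2(1) by simp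
      then have 2: "((\<lambda>s. f (ray q s h)) has_field_derivative g (ray q z h)) (at z)"
        by (intro dir_deriv_along_ray f)
      have "(?f has_field_derivative g (ray (ray q z h) t k) - g (ray q z h) - 1 * (t * g' q)) (at z)"
        by (intro DERIV_diff DERIV_cmult_right DERIV_ident 1 2)
      then show "(?f has_field_derivative g (ray (ray q z h) t k) - g (ray q z h) - t * g' q) (at z within ball 0 \<delta>)"
        by (simp add: has_field_derivative_at_within)
      show "norm (g (ray (ray q z h) t k) - g (ray q z h) - t * g' q) \<le> \<epsilon> * norm t"
        by (rule \<delta>1(2)[OF z(1) t'(1)])
    qed (use t \<open>\<delta> > 0\<close> in auto)
    then show "norm (f (ray (ray q t h) t k) - f (ray q t h) - f (ray q t k) + f q - t * t * g' q)
        \<le> \<epsilon> * (norm t * norm t)"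
      by (simp add: algebra_simps)
  qed
qed

text \<open>
  Both mixed derivatives are limits of the same second difference divided by \<open>t\<^sup>2\<close>.
\<close>
lemma dir_deriv_commute:
  assumes q: "q \<in> U" "h \<in> S" "k \<in> S"
    and fh: "\<And>x. x \<in> U \<Longrightarrow> dir_deriv f h x (gh x)" and fk: "\<And>x. x \<in> U \<Longrightarrow> dir_deriv f k x (gk x)"
    and hk: "\<And>x. x \<in> U \<Longrightarrow> dir_deriv gh k x (ghk x)" and kh: "\<And>x. x \<in> U \<Longrightarrow> dir_deriv gk h x (gkh x)"
    and c: "continuous_on U ghk" "continuous_on U gkh"
  shows "ghk q = gkh q"
proof (rule ccontr)
  assume "ghk q \<noteq> gkh q"
  define \<epsilon> where "\<epsilon> = norm (ghk q - gkh q) / 3"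
  have \<epsilon>: "\<epsilon> > 0" using \<open>ghk q \<noteq> gkh q\<close> by (simp add: \<epsilon>_def)
  \<comment> \<open>the mixed second difference does not see the order of \<open>h\<close> and \<open>k\<close>\<close>
  let ?D = "\<lambda>t. f (ray (ray q t h) t k) - f (ray q t h) - f (ray q t k) + f q"
  obtain \<delta>1 where \<delta>1: "\<delta>1 > 0" "\<And>t. norm t < \<delta>1 \<Longrightarrow> norm (?D t - t * t * ghk q) \<le> \<epsilon> * (norm t * norm t)"
    using second_difference[OF q fh hk c(1) \<epsilon>] by blast
  obtain \<delta>2 where \<delta>2: "\<delta>2 > 0" "\<And>t. norm t < \<delta>2 \<Longrightarrow>
    norm (f (ray (ray q t k) t h) - f (ray q t k) - f (ray q t h) + f q - t * t * gkh q) \<le> \<epsilon> * (norm t * norm t)"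
    using second_difference[OF q(1,3,2) fk kh c(2) \<epsilon>] by blast
  define t :: 'k where "t = of_real (min \<delta>1 \<delta>2 / 2)"
  have t: "norm t < \<delta>1" "norm t < \<delta>2" "norm t > 0" using \<delta>1(1) \<delta>2(1) by (auto simp: t_def)
  have swap: "ray (ray q t h) t k = ray (ray q t k) t h" by (simp add: algebra_simps)
  have 1: "norm (?D t - t * t * ghk q) \<le> \<epsilon> * (norm t * norm t)" by (rule \<delta>1(2)[OF t(1)])
  have 2: "norm (?D t - t * t * gkh q) \<le> \<epsilon> * (norm t * norm t)"
    using \<delta>2(2)[OF t(2)] unfolding swap by (simp add: algebra_simps)
  have "norm (t * t * (ghk q - gkh q)) = norm ((?D t - t * t * gkh q) - (?D t - t * t * ghk q))"
    by (rule arg_cong[where f = norm]) (simp add: algebra_simps)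
  also have "\<dots> \<le> \<epsilon> * (norm t * norm t) + \<epsilon> * (norm t * norm t)"
    by (rule order_trans[OF norm_triangle_ineq4 add_mono[OF 2 1]])
  finally have "norm t * norm t * norm (ghk q - gkh q) \<le> \<epsilon> * (norm t * norm t) + \<epsilon> * (norm t * norm t)"
    by (simp only: norm_mult)
  then have "norm (ghk q - gkh q) * (norm t * norm t) \<le> 2 * \<epsilon> * (norm t * norm t)"
    by (simp only: mult.commute[of "norm (ghk q - gkh q)"] mult.assoc mult_2 distrib_right)
  then have "norm (ghk q - gkh q) \<le> 2 * \<epsilon>" using t(3) by (simp add: mult_le_cancel_right)
  then show False using \<epsilon> by (simp add: \<epsilon>_def)
qed

end

definition derivatives_upto_two ::
    "('i \<Rightarrow> 'k::real_normed_field) set \<Rightarrow> ('i \<Rightarrow> 'k) set \<Rightarrow> (('i \<Rightarrow> 'k) \<Rightarrow> 'k) \<Rightarrow>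
     (('i \<Rightarrow> 'k) \<Rightarrow> ('i \<Rightarrow> 'k) \<Rightarrow> 'k) \<Rightarrow> (('i \<Rightarrow> 'k) \<Rightarrow> ('i \<Rightarrow> 'k) \<Rightarrow> ('i \<Rightarrow> 'k) \<Rightarrow> 'k) \<Rightarrow> bool" where
  "derivatives_upto_two S U f G H \<longleftrightarrow>
     (\<forall>h\<in>S. (\<forall>x\<in>U. dir_deriv f h x (G h x)) \<and> continuous_on U (G h)) \<and>
     (\<forall>h\<in>S. \<forall>k\<in>S. (\<forall>x\<in>U. dir_deriv (G h) k x (H h k x)) \<and> continuous_on U (H h k))"

lemma smooth_fun_derivatives:
  assumes "smooth_fun S U f"
  shows "\<exists>G H. derivatives_upto_two S U f G H"
proof -
  have "C_k (Suc (Suc 0)) S U f" using assms unfolding smooth_fun_def by blast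
  then have "\<forall>h\<in>S. \<exists>g. (\<forall>x\<in>U. dir_deriv f h x (g x)) \<and> C_k (Suc 0) S U g"
    unfolding dir_deriv_def C_k.simps(2)[of "Suc 0"] by blast
  then obtain G where G: "\<forall>h\<in>S. (\<forall>x\<in>U. dir_deriv f h x (G h x)) \<and> C_k (Suc 0) S U (G h)"
    by (auto simp: bchoice_iff simp del: C_k.simps)
  then have "\<forall>h\<in>S. \<forall>k\<in>S. \<exists>g. (\<forall>x\<in>U. dir_deriv (G h) k x (g x)) \<and> continuous_on U g"
    unfolding dir_deriv_def by simp
  then obtain H where "\<forall>h\<in>S. \<forall>k\<in>S. (\<forall>x\<in>U. dir_deriv (G h) k x (H h k x)) \<and> continuous_on U (H h k)"
    by (auto simp: bchoice_iff)
  then have "derivatives_upto_two S U f G H" using G unfolding derivatives_upto_two_def by simp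
  then show ?thesis by blast
qed

section \<open>Charts of the dual space\<close>

lemma coord_space_box:
  fixes V :: "(nat \<Rightarrow> 'k::real_normed_field) set"
  assumes V: "openin (top_of_set (coord_space m)) V" and x0: "x0 \<in> V"
  obtains \<delta> where "\<delta> > 0" "\<And>x. x \<in> coord_space m \<Longrightarrow> (\<And>i. i < m \<Longrightarrow> norm (x i - x0 i) < \<delta>) \<Longrightarrow> x \<in> V"
proof -
  obtain T where T: "open T" "V = coord_space m \<inter> T" using V unfolding openin_open by blast
  then have "openin (product_topology (\<lambda>i. euclidean) UNIV) T" "x0 \<in> T" using x0 by (auto simp: open_fun_def)
  from product_topology_open_contains_basis[OF this]
  obtain X where X: "x0 \<in> Pi\<^sub>E UNIV X" "\<And>i. openin euclidean (X i)" "Pi\<^sub>E UNIV X \<subseteq> T" by blast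
  have "\<exists>d>0. ball (x0 i) d \<subseteq> X i" for i
    using X(1) X(2)[of i] open_contains_ball[of "X i"] by (auto simp: PiE_iff)
  then obtain d where d: "\<And>i. d i > 0" "\<And>i. ball (x0 i) (d i) \<subseteq> X i" by metis
  define \<delta> where "\<delta> = Min (insert 1 (d ` {..<m}))"
  show thesis
  proof (rule that[of \<delta>])
    show "\<delta> > 0" unfolding \<delta>_def using d(1) by simp
    fix x assume x: "x \<in> coord_space m" "\<And>i. i < m \<Longrightarrow> norm (x i - x0 i) < \<delta>"
    have "x i \<in> X i" for i
    proof (cases "i < m")
      case True
      then have "\<delta> \<le> d i" unfolding \<delta>_def by simp
      then have "x i \<in> ball (x0 i) (d i)" using x(2)[OF True] by (simp add: dist_norm norm_minus_commute)
      then show ?thesis using d(2) by blast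
    next
      case False
      then have "x i = x0 i" using x(1) x0 T(2) by (simp add: coord_space_def)
      then show ?thesis using X(1) by (simp add: PiE_iff)
    qed
    then have "x \<in> T" using X(3) by (auto simp: PiE_iff)
    then show "x \<in> V" using x(1) T(2) by blast
  qed
qed

lemma coord_space_ray: "x \<in> coord_space m \<Longrightarrow> h \<in> coord_space m \<Longrightarrow> ray x t h \<in> coord_space m"
  for x :: "nat \<Rightarrow> 'k::real_normed_field"
  by (simp add: coord_space_def)

text \<open>
  Used for the inverse of a chart: it replaces the chain rule in the proof that the differential
  of a chart is injective.
\<close>

lemma smooth_fun_locally_Lipschitz:
  fixes g :: "(nat \<Rightarrow> 'k::real_normed_field) \<Rightarrow> 'k"
  assumes V: "openin (top_of_set (coord_space m)) V" and x0: "x0 \<in> V"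
    and g: "smooth_fun (coord_space m) V g"
  obtains L \<delta> where "L \<ge> 0" "\<delta> > 0" "\<And>x. x \<in> coord_space m \<Longrightarrow> (\<And>i. i < m \<Longrightarrow> norm (x i - x0 i) < \<delta>) \<Longrightarrow>
    norm (g x - g x0) \<le> L * (\<Sum>i<m. norm (x i - x0 i))"
proof -
  interpret open_in_directions "coord_space m" V by unfold_locales (use V coord_space_ray in blast)+
  define e :: "nat \<Rightarrow> nat \<Rightarrow> 'k" where "e j i = (if i = j then 1 else 0)" for j i
  have e: "e j \<in> coord_space m" if "j < m" for j using that by (simp add: e_def coord_space_def)
  obtain G H where G: "\<And>h x. h \<in> coord_space m \<Longrightarrow> x \<in> V \<Longrightarrow> dir_deriv g h x (G h x)"
    "\<And>h. h \<in> coord_space m \<Longrightarrow> continuous_on V (G h)"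
    using smooth_fun_derivatives[OF g] unfolding derivatives_upto_two_def by auto
  define near where "near \<delta> x \<longleftrightarrow> x \<in> coord_space m \<and> (\<forall>i<m. norm (x i - x0 i) < \<delta>)" for \<delta> x
  have "\<exists>\<delta>>0. \<forall>x. near \<delta> x \<longrightarrow> x \<in> V \<and> norm (G (e j) x - G (e j) x0) < 1" if "j < m" for j
  proof -
    let ?V = "V \<inter> G (e j) -` ball (G (e j) x0) 1"
    have "openin (top_of_set V) ?V" by (rule continuous_openin_preimage_gen[OF G(2)[OF e[OF that]] open_ball])
    then have "openin (top_of_set (coord_space m)) ?V" by (rule openin_trans[OF _ V])
    moreover have "x0 \<in> ?V" using x0 by simp
    ultimately obtain \<delta> where "\<delta> > 0" "\<And>x. x \<in> coord_space m \<Longrightarrow> (\<And>i. i < m \<Longrightarrow> norm (x i - x0 i) < \<delta>) \<Longrightarrow> x \<in> ?V"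
      by (rule coord_space_box) blast
    then show ?thesis unfolding near_def by (intro exI[of _ \<delta>]) (auto simp: dist_norm norm_minus_commute)
  qed
  then obtain d where d: "\<And>j. j < m \<Longrightarrow> d j > 0"
    "\<And>j x. j < m \<Longrightarrow> near (d j) x \<Longrightarrow> x \<in> V \<and> norm (G (e j) x - G (e j) x0) < 1" by metis
  define \<delta> where "\<delta> = Min (insert 1 (d ` {..<m}))"
  have \<delta>: "\<delta> > 0" unfolding \<delta>_def using d(1) by simp
  have near: "x \<in> V \<and> norm (G (e j) x - G (e j) x0) < 1" if "j < m" "near \<delta> x" for j x
  proof -
    have "\<delta> \<le> d j" unfolding \<delta>_def using that(1) by simp
    then have "near (d j) x" using that(2) unfolding near_def by force
    then show ?thesis by (rule d(2)[OF that(1)])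
  qed
  define B where "B j = norm (G (e j) x0) + 1" for j
  have B0: "B j \<ge> 0" for j by (simp add: B_def)
  show thesis
  proof (rule that[of "\<Sum>j<m. B j" \<delta>])
    show "(\<Sum>j<m. B j) \<ge> 0" by (intro sum_nonneg B0)
    show "\<delta> > 0" by (rule \<delta>)
    fix x assume x: "x \<in> coord_space m" "\<And>i. i < m \<Longrightarrow> norm (x i - x0 i) < \<delta>"
    have x0': "x0 \<in> coord_space m" using x0 U_subset by blast
    \<comment> \<open>replace the entries of \<open>x0\<close> by those of \<open>x\<close> one at a time; the intermediate points stay in the box\<close>
    define z where "z j i = (if i < j then x i else x0 i)" for j i
    have step: "norm (g (z (Suc j)) - g (z j)) \<le> B j * norm (x j - x0 j)" if j: "j < m" for j
    proof -
      let ?f = "\<lambda>t. g (ray (z j) t (e j))"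
      have n: "near \<delta> (ray (z j) t (e j))" if "norm t < \<delta>" for t
        using x that x0' \<delta> j by (auto simp: near_def z_def e_def coord_space_def)
      have "norm (?f (x j - x0 j) - ?f 0) \<le> B j * norm (x j - x0 j - 0)"
      proof (rule field_differentiable_bound)
        fix t :: 'k assume "t \<in> ball 0 \<delta>"
        then have n: "ray (z j) t (e j) \<in> V \<and> norm (G (e j) (ray (z j) t (e j)) - G (e j) x0) < 1"
          by (intro near[OF j] n) simp
        then have "(?f has_field_derivative G (e j) (ray (z j) t (e j))) (at t)"
          by (intro dir_deriv_along_ray G(1) e j) simp
        then show "(?f has_field_derivative G (e j) (ray (z j) t (e j))) (at t within ball 0 \<delta>)"
          by (rule has_field_derivative_at_within)
        show "norm (G (e j) (ray (z j) t (e j))) \<le> B j"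
          using n norm_triangle_ineq2[of "G (e j) (ray (z j) t (e j))" "G (e j) x0"] by (simp add: B_def)
      qed (use x(2)[OF j] \<delta> in auto)
      moreover have "ray (z j) (x j - x0 j) (e j) = z (Suc j)"
        by (auto simp: z_def e_def fun_eq_iff less_Suc_eq)
      ultimately show ?thesis by simp
    qed
    have "norm (g (z j) - g x0) \<le> (\<Sum>i<j. B i * norm (x i - x0 i))" if "j \<le> m" for j
      using that
    proof (induction j)
      case 0
      have "z 0 = x0" by (simp add: z_def fun_eq_iff)
      then show ?case by simp
    next
      case (Suc j)
      have "norm (g (z (Suc j)) - g x0) \<le> norm (g (z (Suc j)) - g (z j)) + norm (g (z j) - g x0)"
        by (rule norm_diff_triangle_ineq[of "g (z (Suc j))" "g (z j)" "g (z j)" "g x0", simplified]) 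
      then show ?case using Suc step[of j] by simp
    qed
    from this[of m] have "norm (g (z m) - g x0) \<le> (\<Sum>i<m. B i * norm (x i - x0 i))" by simp
    also have "z m = x" using x(1) x0' by (auto simp: z_def coord_space_def fun_eq_iff)
    also have "(\<Sum>i<m. B i * norm (x i - x0 i)) \<le> (\<Sum>i<m. (\<Sum>j<m. B j) * norm (x i - x0 i))"
      by (intro sum_mono mult_right_mono member_le_sum B0) auto
    also have "\<dots> = (\<Sum>j<m. B j) * (\<Sum>i<m. norm (x i - x0 i))" by (simp add: sum_distrib_left)
    finally show "norm (g x - g x0) \<le> (\<Sum>j<m. B j) * (\<Sum>i<m. norm (x i - x0 i))" .
  qed
qed

lemma dual_space_ray:
  assumes "vector_space scl" "x \<in> dual_space scl" "h \<in> dual_space scl"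
  shows "ray x t h \<in> dual_space scl"
  using assms(2,3) unfolding dual_space_iff[OF assms(1)] linear_form_def by (simp add: algebra_simps)

text \<open>
  The directional derivatives are additive in the direction because they are continuous, hence
  they are given by a vector, the differential at \<open>q\<close>.
\<close>

lemma differential_represents:
  fixes scl :: "'k::real_normed_field \<Rightarrow> 'b::ab_group_add \<Rightarrow> 'b"
  assumes f: "frame scl M b c" and U: "openin (top_of_set (dual_space scl)) U"
    and G: "\<And>h x. h \<in> dual_space scl \<Longrightarrow> x \<in> U \<Longrightarrow> dir_deriv g h x (G h x)"
    and cont: "\<And>h. h \<in> dual_space scl \<Longrightarrow> continuous_on U (G h)"
    and h: "linear_form scl h" and q: "q \<in> U"
  shows "h (\<Sum>l<M. scl (G (c l) q) (b l)) = G h q"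
proof -
  have V: "vector_space scl" using f by (simp add: frame_def)
  note iff = dual_space_iff[OF V]
  interpret open_in_directions "dual_space scl" U
    by unfold_locales (use U dual_space_ray[OF V] in blast)+
  show ?thesis
  proof (rule functional_on_dual_is_evaluation[OF f _ _ h, of "\<lambda>h. G h q"])
    fix h k assume hk: "linear_form scl h" "linear_form scl k"
    then have "linear_form scl (\<lambda>x. h x + k x)" by (simp add: linear_form_def algebra_simps)
    then have "dir_deriv g (\<lambda>x. h x + k x) q (G (\<lambda>x. h x + k x) q)" using G q iff by blast
    moreover have "dir_deriv g (\<lambda>x. h x + k x) q (G h q + G k q)"
      using hk iff G cont q by (intro dir_deriv_add) blast+
    ultimately show "G (\<lambda>x. h x + k x) q = G h q + G k q" by (rule dir_deriv_unique)
  next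
    fix a h assume h: "linear_form scl h"
    then have "linear_form scl (\<lambda>x. a * h x)" by (simp add: linear_form_def algebra_simps)
    then have "dir_deriv g (\<lambda>x. a * h x) q (G (\<lambda>x. a * h x) q)" using G q iff by blast
    moreover have "dir_deriv g (\<lambda>x. a * h x) q (a * G h q)"
      by (rule dir_deriv_scale) (use h G q iff in blast)
    ultimately show "G (\<lambda>x. a * h x) q = a * G h q" by (rule dir_deriv_unique)
  qed
qed

lemma differential_eq:
  fixes scl :: "'k::real_normed_field \<Rightarrow> 'b::ab_group_add \<Rightarrow> 'b"
  assumes f: "frame scl M b c"
    and G: "\<And>h. linear_form scl h \<Longrightarrow> dir_deriv g h q (h a)"
  shows "differential scl g q = a"
  unfolding differential_def
proof (rule the_equality)
  have V: "vector_space scl" using f by (simp add: frame_def)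
  note iff = dual_space_iff[OF V]
  show "\<forall>\<phi>\<in>dual_space scl. ((\<lambda>t. g (\<lambda>b. q b + t * \<phi> b)) has_field_derivative \<phi> a) (at 0)"
    using G iff unfolding dir_deriv_def by blast
  fix a' assume "\<forall>\<phi>\<in>dual_space scl. ((\<lambda>t. g (\<lambda>b. q b + t * \<phi> b)) has_field_derivative \<phi> a') (at 0)"
  then have "dir_deriv g h q (h a')" if "linear_form scl h" for h
    using that iff unfolding dir_deriv_def by blast
  then show "a' = a" by (intro frame_separates[OF f]) (metis G dir_deriv_unique)
qed

text \<open>
  The differential of a chart is injective, since the inverse of the chart is locally Lipschitz.
\<close>

lemma chart_differentials_separate:
  fixes scl :: "'k::real_normed_field \<Rightarrow> 'b::ab_group_add \<Rightarrow> 'b"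
  assumes f: "frame scl M b c" and y: "local_coordinates scl U y" and p: "p \<in> U"
    and h: "linear_form scl h" and zero: "\<And>i. i < M \<Longrightarrow> dir_deriv (\<lambda>q. y q i) h p 0"
  shows "h = (\<lambda>x. 0)"
proof
  fix a
  have V: "vector_space scl" using f by (simp add: frame_def)
  note iff = dual_space_iff[OF V]
  note y' = y[unfolded local_coordinates_def Let_def frame_dim[OF f]]
  interpret open_in_directions "dual_space scl" U
    by unfold_locales (use y' dual_space_ray[OF V] in blast)+
  let ?g = "\<lambda>x. the_inv_into U y x a"
  have inv: "?g (y q) = q a" if "q \<in> U" for q using y' that by (simp add: the_inv_into_f_f)
  have coord: "y q \<in> coord_space M" if "q \<in> U" for q using y' that openin_imp_subset by blast
  have "smooth_fun (coord_space M) (y ` U) ?g" "openin (top_of_set (coord_space M)) (y ` U)" using y' by blast+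
  then obtain L \<delta> where L: "L \<ge> 0" "\<delta> > 0" "\<And>x. x \<in> coord_space M \<Longrightarrow>
    (\<And>i. i < M \<Longrightarrow> norm (x i - y p i) < \<delta>) \<Longrightarrow> norm (?g x - ?g (y p)) \<le> L * (\<Sum>i<M. norm (x i - y p i))"
    using smooth_fun_locally_Lipschitz[of M "y ` U" "y p" ?g] p by blast
  have hd: "h \<in> dual_space scl" using h iff by blast
  obtain \<delta>0 where \<delta>0: "\<delta>0 > 0" "\<And>s t. norm s < \<delta>0 \<Longrightarrow> norm t < \<delta>0 \<Longrightarrow> ray (ray p s h) t h \<in> U"
    using rays_stay_near[OF p hd hd] by blast
  \<comment> \<open>the chart moves by at most \<open>\<epsilon> * norm t\<close> along \<open>h\<close>, so the point itself moves by a small multiple of \<open>norm t\<close>\<close>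
  have bound: "norm (h a) \<le> L * (real M * \<epsilon>)" if \<epsilon>: "\<epsilon> > 0" for \<epsilon>
  proof -
    have "\<exists>d>0. \<forall>t. t \<noteq> 0 \<and> norm t < d \<longrightarrow> norm (y (ray p t h) i - y p i) < \<epsilon> * norm t" if i: "i < M" for i
    proof -
      have "((\<lambda>t. (y (ray p (0 + t) h) i - y (ray p 0 h) i) / t) \<longlongrightarrow> 0) (at 0)"
        using zero[OF i] unfolding dir_deriv_def DERIV_def .
      from LIM_D[OF this \<epsilon>] obtain d where "d > 0" "\<And>t. t \<noteq> 0 \<and> norm t < d \<Longrightarrow>
        norm ((y (ray p t h) i - y p i) / t) < \<epsilon>" by auto
      then show ?thesis by (intro exI[of _ d]) (auto simp: norm_divide divide_less_eq)
    qed
    then obtain d where d: "\<And>i. i < M \<Longrightarrow> d i > 0"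
      "\<And>i t. i < M \<Longrightarrow> t \<noteq> 0 \<and> norm t < d i \<Longrightarrow> norm (y (ray p t h) i - y p i) < \<epsilon> * norm t" by metis
    define r where "r = Min ({\<delta>0, \<delta> / \<epsilon>} \<union> d ` {..<M})"
    have le: "r \<le> x" if "x \<in> {\<delta>0, \<delta> / \<epsilon>} \<union> d ` {..<M}" for x
      unfolding r_def by (rule Min_le[OF _ that]) simp
    have r: "r > 0" "r \<le> \<delta>0" "r \<le> \<delta> / \<epsilon>" "\<And>i. i < M \<Longrightarrow> r \<le> d i"
      unfolding r_def[symmetric] using d(1) \<delta>0(1) L(2) \<epsilon>
      by (simp add: r_def, intro le, simp, intro le, simp, intro le, simp)
    define t :: 'k where "t = of_real (r / 2)"
    have t: "t \<noteq> 0" "norm t < r" "norm t > 0" using r(1) by (auto simp: t_def)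
    have "ray p t h \<in> U" using \<delta>0(2)[of t 0] t r(2) \<delta>0(1) by simp
    have small: "norm (y (ray p t h) i - y p i) < \<epsilon> * norm t" if "i < M" for i
      using d(2)[OF that, of t] t r(4)[OF that] by simp
    moreover have "\<epsilon> * norm t < \<delta>" 
    proof -
      have "\<epsilon> * norm t < \<epsilon> * r" using t(2) \<epsilon> by simp
      also have "\<dots> \<le> \<delta>" using r(3) \<epsilon> by (simp add: field_simps)
      finally show ?thesis .
    qed
    ultimately have "norm (?g (y (ray p t h)) - ?g (y p)) \<le> L * (\<Sum>i<M. norm (y (ray p t h) i - y p i))"
      by (intro L(3) coord \<open>ray p t h \<in> U\<close>) force
    also have "\<dots> \<le> L * (\<Sum>i<M. \<epsilon> * norm t)"
      using small by (intro mult_left_mono sum_mono L(1)) (simp add: less_imp_le)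
    also have "?g (y (ray p t h)) - ?g (y p) = t * h a" using inv[OF \<open>ray p t h \<in> U\<close>] inv[OF p] by simp
    finally have "norm t * norm (h a) \<le> norm t * (L * (real M * \<epsilon>))" by (simp add: norm_mult mult_ac)
    then show ?thesis using t(3) by simp
  qed
  show "h a = 0"
  proof (rule ccontr)
    assume "h a \<noteq> 0"
    define \<epsilon> where "\<epsilon> = norm (h a) / (2 * (L * real M + 1))"
    have pos: "L * real M + 1 > 0" using L(1) by (simp add: add_nonneg_pos)
    then have "\<epsilon> > 0" using \<open>h a \<noteq> 0\<close> by (simp add: \<epsilon>_def)
    from bound[OF this] have "norm (h a) \<le> (L * real M) * \<epsilon>" by (simp add: mult.assoc)
    also have "\<dots> \<le> (L * real M + 1) * \<epsilon>" using \<open>\<epsilon> > 0\<close> by simp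
    also have "\<dots> = norm (h a) / 2" using pos by (simp add: \<epsilon>_def field_simps)
    finally show False using \<open>h a \<noteq> 0\<close> by simp
  qed
qed

section \<open>The modular vector field of a flat pair\<close>

text \<open>
  In a chart \<open>y\<close> with differentials \<open>d i\<close> and dual basis \<open>e i\<close>, the vector \<open>hess i h\<close> is the
  derivative of \<open>d i\<close> in the direction \<open>h\<close>. The hypothesis \<open>const\<close> says that the coefficients of a
  bi-vector field with value \<open>B\<close> and derivative \<open>C h\<close> are constant to first order. Setting
  \<open>h = e i\<close> and summing over \<open>i\<close> kills the last term by the symmetry of second derivatives.
  The vector \<open>\<Sum>i. hess i (e i)\<close> is the differential of \<open>log (det Dy)\<close>, and the conclusion
  compares the divergences of a Hamiltonian vector field in the two coordinate systems.
\<close>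

lemma contracted_constancy:
  fixes scl :: "'k::field_char_0 \<Rightarrow> 'a::ab_group_add \<Rightarrow> 'a"
  assumes f: "frame scl M d e" and B: "bilinear_alt scl B"
    and sym: "\<And>j h k. j < M \<Longrightarrow> linear_form scl h \<Longrightarrow> linear_form scl k \<Longrightarrow> h (hess j k) = k (hess j h)"
    and const: "\<And>i j h. i < M \<Longrightarrow> j < M \<Longrightarrow> linear_form scl h \<Longrightarrow>
      C h (d i) (d j) + B (hess i h) (d j) + B (d i) (hess j h) = 0"
    and j: "j < M"
  shows "B (\<Sum>i<M. hess i (e i)) (d j) = - (\<Sum>i<M. C (e i) (d i) (d j))"
proof -
  note r = bilinear_altD(1)[OF B] and l = bilinear_altD(3)[OF B] and sk = bilinear_altD(2)[OF B]
  have e: "linear_form scl (e i)" if "i < M" for i using frame_coordinate_linear[OF f that] .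
  let ?s = "\<lambda>i k. B (d i) (d k) * e k (hess j (e i))"
  have "(\<Sum>i<M. B (d i) (hess j (e i))) = (\<Sum>i<M. \<Sum>k<M. ?s i k)"
    by (intro sum.cong refl frame_expand[OF f r])
  also have "\<dots> = (\<Sum>i<M. \<Sum>k<M. - ?s k i)"
  proof (intro sum.cong refl)
    fix i k assume "i \<in> {..<M}" "k \<in> {..<M}"
    then have "e k (hess j (e i)) = e i (hess j (e k))" using sym[OF j e e] by simp
    then show "?s i k = - ?s k i" using sk[of "d i" "d k"] by simp
  qed
  also have "\<dots> = - (\<Sum>i<M. \<Sum>k<M. ?s k i)" by (simp add: sum_negf)
  also have "(\<Sum>i<M. \<Sum>k<M. ?s k i) = (\<Sum>k<M. \<Sum>i<M. ?s k i)" by (rule sum.swap)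
  also have "\<dots> = (\<Sum>i<M. B (d i) (hess j (e i)))"
    by (intro sum.cong refl frame_expand[OF f r, symmetric])
  \<comment> \<open>a symmetric array contracted with an antisymmetric one\<close>
  finally have 0: "(\<Sum>i<M. B (d i) (hess j (e i))) = 0" by simp
  have "(\<Sum>i<M. C (e i) (d i) (d j) + B (hess i (e i)) (d j) + B (d i) (hess j (e i))) = 0"
    using const[OF _ j e] by simp
  then show ?thesis using 0 by (simp add: sum.distrib linear_form_sum[OF l] eq_neg_iff_add_eq_0 add.commute)
qed

lemma bilinear_frame_derivative:
  fixes B C :: "'b::ab_group_add \<Rightarrow> 'b \<Rightarrow> 'k::real_normed_field" and b :: "nat \<Rightarrow> 'b"
  assumes B: "bilinear_alt scl B" and C: "bilinear_alt scl C"
    and u: "\<And>l. l < M \<Longrightarrow> (u l has_field_derivative u' l) (at 0)"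
    and v: "\<And>l. l < M \<Longrightarrow> (v l has_field_derivative v' l) (at 0)"
  defines "comb w \<equiv> (\<Sum>l<M. scl (w l) (b l))"
  shows "((\<lambda>t. B (comb (\<lambda>l. u l t)) (comb (\<lambda>l. v l t)) + t * C (comb (\<lambda>l. u l t)) (comb (\<lambda>l. v l t)))
    has_field_derivative
      (C (comb (\<lambda>l. u l 0)) (comb (\<lambda>l. v l 0)) + B (comb u') (comb (\<lambda>l. v l 0)) + B (comb (\<lambda>l. u l 0)) (comb v'))) (at 0)"
proof -
  have expand: "F (comb x) (comb y) = (\<Sum>l<M. \<Sum>k<M. x l * y k * F (b l) (b k))"
    if "bilinear_alt scl F" for F :: "'b \<Rightarrow> 'b \<Rightarrow> 'k" and x y
  proof -
    note r = bilinear_altD(1)[OF that] and l = bilinear_altD(3)[OF that]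
    have "F (comb x) (comb y) = (\<Sum>l<M. x l * F (b l) (comb y))"
      unfolding comb_def[of x] by (simp add: linear_form_sum[OF l] linear_form_simps[OF l])
    also have "\<dots> = (\<Sum>l<M. x l * (\<Sum>k<M. y k * F (b l) (b k)))"
      unfolding comb_def by (simp add: linear_form_sum[OF r] linear_form_simps[OF r])
    finally show ?thesis by (simp add: sum_distrib_left mult.assoc)
  qed
  have "((\<lambda>t. \<Sum>l<M. \<Sum>k<M. u l t * v k t * B (b l) (b k) + t * (u l t * v k t * C (b l) (b k)))
    has_field_derivative (\<Sum>l<M. \<Sum>k<M. (u' l * v k 0 + v' k * u l 0) * B (b l) (b k) +
      (1 * (u l 0 * v k 0 * C (b l) (b k)) + (u' l * v k 0 + v' k * u l 0) * C (b l) (b k) * 0))) (at 0)"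
    by (intro DERIV_sum DERIV_add DERIV_cmult_right DERIV_mult DERIV_ident u v) auto
  then show ?thesis
    unfolding expand[OF B] expand[OF C]
    by (simp add: sum.distrib sum_distrib_left distrib_right algebra_simps)
qed

lemma has_derivative_const_near:
  fixes f :: "'k::real_normed_field \<Rightarrow> 'k"
  assumes "(f has_field_derivative d) (at 0)" "\<delta> > 0" "\<And>t. norm t < \<delta> \<Longrightarrow> f t = e"
  shows "d = 0"
proof -
  have "((\<lambda>t. e) has_field_derivative d) (at 0)"
    by (rule has_field_derivative_transform_within[OF assms(1,2)]) (use assms(3) in auto)
  then show ?thesis by (metis DERIV_const DERIV_unique)
qed

text \<open>
  The product rule for the constant function \<open>q \<mapsto> B q (dy\<^sub>i) (dy\<^sub>j)\<close> along a ray.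
\<close>

lemma flat_chart_constancy:
  fixes scl :: "'k::real_normed_field \<Rightarrow> 'b::ab_group_add \<Rightarrow> 'b"
  assumes f: "frame scl M b c" and p: "p \<in> U" and U: "openin (top_of_set (dual_space scl)) U"
    and h: "linear_form scl h"
    and B: "\<And>q. q \<in> U \<Longrightarrow> bilinear_alt scl (B q)" and C: "bilinear_alt scl C"
    and affine: "\<And>t v w. B (ray p t h) v w = B p v w + t * C v w"
    and Gi: "\<And>l x. l < M \<Longrightarrow> x \<in> U \<Longrightarrow> dir_deriv (Gi l) h x (Hi l x)"
    and Gj: "\<And>l x. l < M \<Longrightarrow> x \<in> U \<Longrightarrow> dir_deriv (Gj l) h x (Hj l x)"
    and const: "\<And>q. q \<in> U \<Longrightarrow> B q (\<Sum>l<M. scl (Gi l q) (b l)) (\<Sum>l<M. scl (Gj l q) (b l)) = e"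
  shows "C (\<Sum>l<M. scl (Gi l p) (b l)) (\<Sum>l<M. scl (Gj l p) (b l))
    + B p (\<Sum>l<M. scl (Hi l p) (b l)) (\<Sum>l<M. scl (Gj l p) (b l))
    + B p (\<Sum>l<M. scl (Gi l p) (b l)) (\<Sum>l<M. scl (Hj l p) (b l)) = 0"
proof -
  have V: "vector_space scl" using f by (simp add: frame_def)
  interpret open_in_directions "dual_space scl" U
    by unfold_locales (use U dual_space_ray[OF V] in blast)+
  have hd: "h \<in> dual_space scl" using h dual_space_iff[OF V] by blast
  obtain \<delta> where \<delta>: "\<delta> > 0" "\<And>s t. norm s < \<delta> \<Longrightarrow> norm t < \<delta> \<Longrightarrow> ray (ray p s h) t h \<in> U"
    using rays_stay_near[OF p hd hd] by blast
  have near: "ray p t h \<in> U" if "norm t < \<delta>" for t using \<delta>(2)[OF that, of 0] \<delta>(1) by simp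
  have i: "((\<lambda>t. Gi l (ray p t h)) has_field_derivative Hi l p) (at 0)" if "l < M" for l
    using Gi[OF that p] by (simp add: dir_deriv_def)
  have j: "((\<lambda>t. Gj l (ray p t h)) has_field_derivative Hj l p) (at 0)" if "l < M" for l
    using Gj[OF that p] by (simp add: dir_deriv_def)
  let ?u = "\<lambda>t. \<Sum>l<M. scl (Gi l (ray p t h)) (b l)" and ?v = "\<lambda>t. \<Sum>l<M. scl (Gj l (ray p t h)) (b l)"
  have "B p (?u t) (?v t) + t * C (?u t) (?v t) = e" if "norm t < \<delta>" for t
    using const[OF near[OF that]] unfolding affine .
  moreover have "((\<lambda>t. B p (?u t) (?v t) + t * C (?u t) (?v t)) has_field_derivative
      (C (?u 0) (?v 0) + B p (\<Sum>l<M. scl (Hi l p) (b l)) (?v 0) + B p (?u 0) (\<Sum>l<M. scl (Hj l p) (b l)))) (at 0)"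
    by (rule bilinear_frame_derivative[OF B[OF p] C i j])
  ultimately have "C (?u 0) (?v 0) + B p (\<Sum>l<M. scl (Hi l p) (b l)) (?v 0)
      + B p (?u 0) (\<Sum>l<M. scl (Hj l p) (b l)) = 0"
    by (rule has_derivative_const_near[OF _ \<delta>(1), rotated])
  then show ?thesis by simp
qed

text \<open>
  In constant coordinates \<open>y\<close> all Hamiltonian vector fields of both structures preserve the
  volume form \<open>dy\<^sub>1 \<and> \<dots> \<and> dy\<^sub>M\<close>. Compared with a translation invariant volume form it has a density
  \<open>exp f\<close>. For the constant structure this gives \<open>\<omega> (df, \<cdot>) = 0\<close>. The Hamiltonian vector field of
  the linear function \<open>b0\<close> for the Lie--Poisson structure is linear, and its divergence is the
  trace of \<open>a \<mapsto> [a, b0]\<close>, so \<open>p [df, b0]\<close> is minus this trace. The vector \<open>z\<close> is \<open>df\<close> at \<open>p\<close>;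
  the trace is expressed through any decomposition into operators of rank one.
\<close>

lemma flat_imp_modular_hamiltonian:
  fixes scl :: "'k::real_normed_field \<Rightarrow> 'b::ab_group_add \<Rightarrow> 'b"
  assumes lie: "lie_algebra scl br" and f: "frame scl M b c" and \<omega>: "bilinear_alt scl \<omega>"
    and flat: "flat_at scl (lie_poisson br) (\<lambda>q. \<omega>) p"
    and tr: "\<And>a. br a b0 = (\<Sum>l<m. scl (\<theta> l a) (u l))" "\<And>l. l < m \<Longrightarrow> linear_form scl (\<theta> l)"
  shows "\<exists>z. (\<forall>v. \<omega> z v = 0) \<and> p (br z b0) = - (\<Sum>l<m. \<theta> l (u l))"
proof -
  interpret lie_algebra scl br by (rule lie)
  have V: "vector_space scl" using f by (simp add: frame_def)
  note iff = dual_space_iff[OF V]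
  obtain U y cc c1 where p: "p \<in> U" and y: "local_coordinates scl U y"
    and const: "\<forall>q\<in>U. \<forall>i<M. \<forall>j<M.
      lie_poisson br q (differential scl (\<lambda>q. y q i) q) (differential scl (\<lambda>q. y q j) q) = cc i j \<and>
      \<omega> (differential scl (\<lambda>q. y q i) q) (differential scl (\<lambda>q. y q j) q) = c1 i j"
    using flat unfolding flat_at_def Let_def frame_dim[OF f] by (elim exE conjE) (rule that)
  note y' = y[unfolded local_coordinates_def Let_def frame_dim[OF f]]
  have U: "openin (top_of_set (dual_space scl)) U" using y' by blast
  interpret open_in_directions "dual_space scl" U
    by unfold_locales (use U dual_space_ray[OF V] in blast)+
  have "\<exists>G H. derivatives_upto_two (dual_space scl) U (\<lambda>q. y q i) G H" if "i < M" for i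
    by (rule smooth_fun_derivatives) (use y' that in blast)
  then obtain G H where GH: "\<And>i. i < M \<Longrightarrow> derivatives_upto_two (dual_space scl) U (\<lambda>q. y q i) (G i) (H i)"
    by metis
  have G: "dir_deriv (\<lambda>q. y q i) h x (G i h x)" if "i < M" "h \<in> dual_space scl" "x \<in> U" for i h x
    using GH[OF that(1)] that unfolding derivatives_upto_two_def by blast
  have Gc: "continuous_on U (G i h)" if "i < M" "h \<in> dual_space scl" for i h
    using GH[OF that(1)] that unfolding derivatives_upto_two_def by blast
  have H: "dir_deriv (G i h) k x (H i h k x)"
    if "i < M" "h \<in> dual_space scl" "k \<in> dual_space scl" "x \<in> U" for i h k x
    using GH[OF that(1)] that unfolding derivatives_upto_two_def by blast
  have Hc: "continuous_on U (H i h k)" if "i < M" "h \<in> dual_space scl" "k \<in> dual_space scl" for i h k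
    using GH[OF that(1)] that unfolding derivatives_upto_two_def by blast
  \<comment> \<open>the differential of \<open>y i\<close> at \<open>q\<close>, and its derivative at \<open>p\<close> in the direction \<open>k\<close>, as vectors\<close>
  define grad where "grad i q = (\<Sum>l<M. scl (G i (c l) q) (b l))" for i q
  define hess where "hess i k = (\<Sum>l<M. scl (H i (c l) k p) (b l))" for i k
  have cd: "c l \<in> dual_space scl" if "l < M" for l
    using frame_coordinate_linear[OF f that] iff by blast
  have grad: "h (grad i q) = G i h q" if "i < M" "q \<in> U" "linear_form scl h" for i q h
    unfolding grad_def by (rule differential_represents[OF f U G Gc that(3,2)]) (use that in auto)
  have diff: "differential scl (\<lambda>q. y q i) q = grad i q" if "i < M" "q \<in> U" for i q
    by (rule differential_eq[OF f]) (use that grad G iff in auto)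
  have H_sym: "H i h k p = H i k h p" if "i < M" "linear_form scl h" "linear_form scl k" for i h k
  proof -
    have hk: "h \<in> dual_space scl" "k \<in> dual_space scl" using that iff by blast+
    show ?thesis
      by (rule dir_deriv_commute[where f = "\<lambda>q. y q i" and gh = "G i h" and gk = "G i k"
            and ghk = "H i h k" and gkh = "H i k h", OF p hk])
        (use G[OF that(1)] H[OF that(1)] Hc[OF that(1)] hk in blast)+
  qed
  have hess: "h (hess i k) = H i h k p" if "i < M" "linear_form scl h" "linear_form scl k" for i h k
  proof -
    have kd: "k \<in> dual_space scl" using that iff by blast
    have "h (\<Sum>l<M. scl (H i k (c l) p) (b l)) = H i k h p"
      by (rule differential_represents[OF f U H[OF that(1) kd] Hc[OF that(1) kd] that(2) p])
    moreover have "(\<Sum>l<M. scl (H i k (c l) p) (b l)) = hess i k"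
      unfolding hess_def using H_sym[OF that(1) _ that(3)] frame_coordinate_linear[OF f] by simp
    ultimately show ?thesis using H_sym that by simp
  qed
  obtain e where e: "frame scl M (\<lambda>i. grad i p) e"
  proof (rule frame_of_separating_family[OF f])
    fix h assume h: "linear_form scl h" "\<And>i. i < M \<Longrightarrow> h (grad i p) = 0"
    show "h = (\<lambda>x. 0)"
      by (rule chart_differentials_separate[OF f y p h(1)])
        (use G[OF _ _ p] h grad[OF _ p h(1)] iff in force)
  qed
  have sym: "h (hess j k) = k (hess j h)" if "j < M" "linear_form scl h" "linear_form scl k" for j h k
    using hess H_sym that by simp
  have lie_alt: "bilinear_alt scl (lie_poisson br q)" if "linear_form scl q" for q
    using linear_form_bracket_alt[OF that] unfolding lie_poisson_def .
  have Uq: "linear_form scl q" if "q \<in> U" for q using that U_subset iff by blast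
  have zero_alt: "bilinear_alt scl (\<lambda>v w. 0)" by (simp add: bilinear_alt_def linear_form_def)
  \<comment> \<open>the structure functions in the chart have zero derivative at \<open>p\<close>\<close>
  have c_lie: "lie_poisson br h (grad i p) (grad j p) + lie_poisson br p (hess i h) (grad j p)
      + lie_poisson br p (grad i p) (hess j h) = 0" if ij: "i < M" "j < M" "linear_form scl h" for i j h
    unfolding grad_def hess_def
  proof (rule flat_chart_constancy[OF f p U ij(3), where e = "cc i j"])
    show "lie_poisson br q (\<Sum>l<M. scl (G i (c l) q) (b l)) (\<Sum>l<M. scl (G j (c l) q) (b l)) = cc i j"
      if "q \<in> U" for q using const that ij diff by (auto simp: grad_def)
  qed (use lie_alt Uq ij H cd iff in \<open>auto simp: lie_poisson_def\<close>)
  have c_\<omega>: "0 + \<omega> (hess i h) (grad j p) + \<omega> (grad i p) (hess j h) = 0"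
    if ij: "i < M" "j < M" "linear_form scl h" for i j h
    unfolding grad_def hess_def
  proof (rule flat_chart_constancy[OF f p U ij(3), where B = "\<lambda>q. \<omega>" and C = "\<lambda>v w. 0" and e = "c1 i j"])
    show "\<omega> (\<Sum>l<M. scl (G i (c l) q) (b l)) (\<Sum>l<M. scl (G j (c l) q) (b l)) = c1 i j"
      if "q \<in> U" for q using const that ij diff by (auto simp: grad_def)
  qed (use \<omega> zero_alt Uq ij H cd iff in auto)
  define z where "z = (\<Sum>i<M. hess i (e i))"
  note el = frame_coordinate_linear[OF e]
  have z_\<omega>: "\<omega> z (grad j p) = 0" if "j < M" for j
  proof -
    have "\<omega> (\<Sum>i<M. hess i (e i)) (grad j p) = - (\<Sum>i<M. 0)"
      by (rule contracted_constancy[where d = "\<lambda>i. grad i p" and C = "\<lambda>h v w. 0", OF e \<omega> _ _ that])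
        (rule sym c_\<omega>; assumption)+
    then show ?thesis by (simp add: z_def)
  qed
  have "\<omega> z v = 0" for v
    using frame_expand[OF e bilinear_altD(1)[OF \<omega>], of z v] z_\<omega> by simp
  moreover have "p (br z b0) = - (\<Sum>l<m. \<theta> l (u l))"
  proof -
    have z_p: "p (br z (grad j p)) = - (\<Sum>i<M. e i (br (grad i p) (grad j p)))" if "j < M" for j
    proof -
      have "lie_poisson br p (\<Sum>i<M. hess i (e i)) (grad j p)
          = - (\<Sum>i<M. lie_poisson br (e i) (grad i p) (grad j p))"
        by (rule contracted_constancy[where d = "\<lambda>i. grad i p" and C = "lie_poisson br",
              OF e lie_alt[OF Uq[OF p]] _ _ that])
          (rule sym c_lie; assumption)+
      then show ?thesis by (simp add: z_def lie_poisson_def)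
    qed
    have pz: "linear_form scl (\<lambda>v. p (br z v))" 
      using bilinear_altD(1)[OF lie_alt[OF Uq[OF p]], of z] by (simp add: lie_poisson_def)
    have ei: "linear_form scl (\<lambda>v. e i (br w v))" if "i < M" for i w
      using bilinear_altD(1)[OF lie_alt[OF el[OF that]], of w] by (simp add: lie_poisson_def)
    have "p (br z b0) = (\<Sum>j<M. p (br z (grad j p)) * e j b0)" by (rule frame_expand[OF e pz])
    also have "\<dots> = - (\<Sum>j<M. \<Sum>i<M. e i (br (grad i p) (grad j p)) * e j b0)"
      by (simp add: z_p sum_negf sum_distrib_right)
    also have "(\<Sum>j<M. \<Sum>i<M. e i (br (grad i p) (grad j p)) * e j b0)
        = (\<Sum>i<M. \<Sum>j<M. e i (br (grad i p) (grad j p)) * e j b0)" by (rule sum.swap)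
    also have "\<dots> = (\<Sum>i<M. e i (br (grad i p) b0))"
      by (intro sum.cong refl frame_expand[OF e ei, symmetric]) simp
    also have "\<dots> = (\<Sum>i<M. \<Sum>l<m. \<theta> l (grad i p) * e i (u l))"
      by (intro sum.cong refl) (simp add: tr(1) linear_form_sum[OF el] linear_form_simps[OF el])
    also have "\<dots> = (\<Sum>l<m. \<Sum>i<M. \<theta> l (grad i p) * e i (u l))" by (rule sum.swap)
    also have "\<dots> = (\<Sum>l<m. \<theta> l (u l))"
      by (intro sum.cong refl frame_expand[OF e tr(2), symmetric]) simp
    finally show ?thesis .
  qed
  ultimately show ?thesis by blast
qed

section \<open>Non-flat generic pairs on the dual of the secondary algebra\<close>

text \<open>
  For \<open>b0 = (0, 0, 1)\<close> the map \<open>a \<mapsto> [a, b0]\<close> is the projection onto the middle component, and its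
  trace is the dimension of \<open>\<A>\<close>. But a vector in the kernel of the constant structure has middle
  component \<open>0\<close>, so its bracket with \<open>b0\<close> vanishes.
\<close>

lemma sec_pair_not_flat:
  fixes scl :: "'k::real_normed_field \<Rightarrow> 'a::ab_group_add \<Rightarrow> 'a"
  assumes lie: "lie_algebra scl br" and f: "frame scl (2 * r + 1) b c"
    and \<beta>: "linear_form scl \<beta>" and nz: "wedge_d_power br \<beta> r \<noteq> (\<lambda>x. 0)"
    and \<phi>: "linear_form scl \<phi>" and \<alpha>: "linear_form scl \<alpha>"
  shows "\<not> flat_at (sec_scale scl) (lie_poisson (sec_bracket scl br))
    (\<lambda>_ a b. sec_fun (\<lambda>v. 0) \<beta> (sec_bracket scl br a b)) (sec_fun \<phi> \<alpha>)"
proof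
  interpret lie_algebra scl br by (rule lie)
  interpret S: lie_algebra "sec_scale scl" "sec_bracket scl br" by (rule sec_lie_algebra[OF lie])
  let ?M = "2 * r + 1"
  have "linear_form scl (\<lambda>v. 0)" by (simp add: linear_form_def)
  then have \<gamma>: "linear_form (sec_scale scl) (sec_fun (\<lambda>v. 0) \<beta>)" by (rule sec_fun_linear[OF _ \<beta>])
  let ?D = "(0, 0, 1) :: 'a \<times> 'a \<times> 'k"
  have brD: "sec_bracket scl br a ?D = (0, fst (snd a), 0)" for a :: "'a \<times> 'a \<times> 'k"
    by (cases a) (simp add: sec_bracket_apply bracket_simps)
  assume flat: "flat_at (sec_scale scl) (lie_poisson (sec_bracket scl br))
    (\<lambda>_ a b. sec_fun (\<lambda>v. 0) \<beta> (sec_bracket scl br a b)) (sec_fun \<phi> \<alpha>)"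
  have "\<exists>z. (\<forall>v. sec_fun (\<lambda>v. 0) \<beta> (sec_bracket scl br z v) = 0) \<and>
    sec_fun \<phi> \<alpha> (sec_bracket scl br z ?D) = - (\<Sum>l<?M. c l (fst (snd (0 :: 'a, b l, 0 :: 'k))))"
  proof (rule flat_imp_modular_hamiltonian[OF sec_lie_algebra[OF lie] sec_frame[OF f]
        S.linear_form_bracket_alt[OF \<gamma>] flat])
    fix a :: "'a \<times> 'a \<times> 'k"
    have "(\<Sum>l<?M. sec_scale scl (c l (fst (snd a))) (0, b l, 0)) = (\<Sum>l<?M. (0, scl (c l (fst (snd a))) (b l), 0))"
      by (simp add: sec_scale_def)
    also have "\<dots> = (0, \<Sum>l<?M. scl (c l (fst (snd a))) (b l), 0)" by (simp add: sum_prod)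
    also have "\<dots> = sec_bracket scl br a ?D" using f unfolding brD by (simp add: frame_def)
    finally show "sec_bracket scl br a ?D = (\<Sum>l<?M. sec_scale scl (c l (fst (snd a))) (0, b l, 0))" ..
  next
    fix l assume "l < ?M"
    then have "linear_form scl (c l)" by (rule frame_coordinate_linear[OF f])
    then show "linear_form (sec_scale scl) (\<lambda>a. c l (fst (snd a)))"
      by (auto simp: linear_form_def sec_scale_def)
  qed
  then obtain v v' s where z: "\<And>y. sec_fun (\<lambda>v. 0) \<beta> (sec_bracket scl br (v, v', s) y) = 0"
    "sec_fun \<phi> \<alpha> (sec_bracket scl br (v, v', s) ?D) = - (\<Sum>l<?M. c l (b l))"
    by auto
  have "\<beta> v' = 0"
    using z(1)[of "(0, 0, 1)"] by (simp add: sec_bracket_apply sec_fun_def bracket_simps linear_form_simps[OF \<beta>])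
  moreover have "d_one br \<beta> v' w = 0" for w
    using z(1)[of "(w, 0, 0)"] bracket_skew[of v' w]
    by (simp add: sec_bracket_apply sec_fun_def bracket_simps linear_form_simps[OF \<beta>] d_one_def)
  \<comment> \<open>here \<open>\<beta> \<and> (d\<beta>)\<^sup>r \<noteq> 0\<close> enters: \<open>\<beta>\<close> does not vanish on the kernel of its differential\<close>
  ultimately have "v' = 0"
    using wedge_d_power_eq_zero[OF f \<beta> d_one_alt[OF \<beta>], of v'] nz by blast
  then have "sec_fun \<phi> \<alpha> (sec_bracket scl br (v, v', s) ?D) = 0"
    by (simp add: brD sec_fun_def linear_form_simps[OF \<phi>] linear_form_simps[OF \<alpha>])
  then have "(\<Sum>l<?M. c l (b l)) = 0" unfolding z(2) by (rule neg_equal_0_iff_equal[THEN iffD1])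
  moreover have "(\<Sum>l<?M. c l (b l)) = (\<Sum>l<?M. 1)" using f by (intro sum.cong) (auto simp: frame_def)
  ultimately have "(of_nat ?M :: 'k) = 0" by (simp only: sum_constant card_lessThan mult_1_right)
  then show False unfolding of_nat_eq_0_iff by simp
qed

lemma sec_nonflat_generic_pair:
  fixes scl :: "'k::real_normed_field \<Rightarrow> 'a::ab_group_add \<Rightarrow> 'a"
  assumes lie: "lie_algebra scl br" and f: "frame scl (2 * r + 1) b c"
    and \<alpha>: "linear_form scl \<alpha>" and \<beta>: "linear_form scl \<beta>" and \<phi>: "linear_form scl \<phi>"
    and nz: "wedge_d_power br \<beta> r \<noteq> (\<lambda>x. 0)"
    and gen: "\<And>s t. (s, t) \<noteq> (0, 0) \<Longrightarrow> wedge_power (\<lambda>a b. s * \<iota> (sec_fun \<phi> \<alpha> (sec_bracket scl br a b))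
      + t * \<iota> (sec_fun (\<lambda>v. 0) \<beta> (sec_bracket scl br a b))) (2 * r + 1) \<noteq> (\<lambda>x. 0)"
  shows "\<exists>\<Lambda> \<Lambda>1. linear_poisson_pair (sec_scale scl) (sec_bracket scl br) \<Lambda> \<Lambda>1 \<and>
    generic_pair \<iota> (sec_scale scl) \<Lambda> \<Lambda>1 \<and> \<not> flat_pair \<iota> (sec_scale scl) \<Lambda> \<Lambda>1"
proof -
  interpret S: lie_algebra "sec_scale scl" "sec_bracket scl br" by (rule sec_lie_algebra[OF lie])
  let ?\<Lambda> = "lie_poisson (sec_bracket scl br)"
  let ?\<Lambda>1 = "\<lambda>_ :: 'a \<times> 'a \<times> 'k \<Rightarrow> 'k. \<lambda>a b. sec_fun (\<lambda>v. 0) \<beta> (sec_bracket scl br a b)"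
  let ?p = "sec_fun \<phi> \<alpha>"
  have "linear_form scl (\<lambda>v. 0)" by (simp add: linear_form_def)
  then have "linear_form (sec_scale scl) (sec_fun (\<lambda>v. 0) \<beta>)" by (rule sec_fun_linear[OF _ \<beta>])
  then have pair: "linear_poisson_pair (sec_scale scl) (sec_bracket scl br) ?\<Lambda> ?\<Lambda>1"
    by (rule S.exact_linear_poisson_pair)
  have p: "?p \<in> dual_space (sec_scale scl)"
    using sec_fun_linear[OF \<phi> \<alpha>] dual_space_iff[OF S.vector_space_axioms] by blast
  have "generic_at \<iota> (sec_scale scl) ?\<Lambda> ?\<Lambda>1 ?p"
    unfolding generic_at_def
  proof (intro exI[of _ "2 * r + 2"] conjI)
    show "vector_space.dim (sec_scale scl) UNIV = 2 * (2 * r + 2) - 1"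
      using frame_dim[OF sec_frame[OF f]] by simp
    show "generic_two_forms (2 * r + 2) (\<lambda>a b. \<iota> (?\<Lambda> ?p a b)) (\<lambda>a b. \<iota> (?\<Lambda>1 ?p a b))"
      using gen unfolding generic_two_forms_def lie_poisson_def by simp
  qed simp
  then have "generic_pair \<iota> (sec_scale scl) ?\<Lambda> ?\<Lambda>1" "\<not> flat_pair \<iota> (sec_scale scl) ?\<Lambda> ?\<Lambda>1"
    using p sec_pair_not_flat[OF lie f \<beta> nz \<phi> \<alpha>] unfolding generic_pair_def flat_pair_def by blast+
  then show ?thesis using pair by blast
qed

lemma sec_nonflat_generic_pair_complex:
  fixes scl :: "complex \<Rightarrow> 'b::ab_group_add \<Rightarrow> 'b"
  assumes lie: "lie_algebra scl br" and f: "frame scl (2 * r + 1) b c"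
    and \<alpha>: "linear_form scl \<alpha>" and \<beta>: "linear_form scl \<beta>"
    and gen: "generic_couple (Suc r) scl br \<alpha> \<beta>" and nz: "wedge_d_power br \<beta> r \<noteq> (\<lambda>x. 0)"
  shows "\<exists>\<Lambda> \<Lambda>1. linear_poisson_pair (sec_scale scl) (sec_bracket scl br) \<Lambda> \<Lambda>1 \<and>
    generic_pair (\<lambda>z. z) (sec_scale scl) \<Lambda> \<Lambda>1 \<and> \<not> flat_pair (\<lambda>z. z) (sec_scale scl) \<Lambda> \<Lambda>1"
proof -
  obtain F where F: "finite F" "0 \<notin> F"
    "\<And>s t v. (s, t) \<noteq> (0, 0) \<Longrightarrow> degenerate_at br \<alpha> \<beta> s t v \<Longrightarrow> s \<noteq> 0 \<and> (\<exists>a. \<exists>w\<in>F. v = scl a w)"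
    using finite_degenerate_directions[OF lie f \<alpha> \<beta> _ nz] gen unfolding generic_couple_def by blast
  have "\<exists>\<phi>. linear_form scl \<phi> \<and> (\<forall>v\<in>F. \<phi> v \<noteq> 0)"
  proof (rule avoid_finitely_many_zeros[where ev = "\<lambda>v \<phi>. \<phi> v" and \<iota> = "\<lambda>z. z", OF F(1)])
    fix v assume "v \<in> F"
    then have "v \<noteq> 0" using F(2) by blast
    then show "\<exists>\<phi>. linear_form scl \<phi> \<and> \<phi> v \<noteq> 0"
      using frame_separates[OF f, of v 0] linear_form_zero by fastforce
  qed (simp_all add: infinite_UNIV_char_0)
  then obtain \<phi> where \<phi>: "linear_form scl \<phi>" "\<And>v. v \<in> F \<Longrightarrow> \<phi> v \<noteq> 0" by blast
  have avoid: "s * \<phi> v \<noteq> 0" if st: "(s, t) \<noteq> (0, 0)" and d: "degenerate_at br \<alpha> \<beta> s t v" for s t v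
  proof -
    obtain a w where w: "s \<noteq> 0" "w \<in> F" "v = scl a w" using F(3)[OF st d] by blast
    interpret lie_algebra scl br by (rule lie)
    have "a \<noteq> 0" using d w by (auto simp: degenerate_at_def)
    then show ?thesis using w \<phi> by (simp add: linear_form_simps[OF \<phi>(1)])
  qed
  show ?thesis
  proof (rule sec_nonflat_generic_pair[OF lie f \<alpha> \<beta> \<phi>(1) nz])
    fix s t :: complex assume "(s, t) \<noteq> (0, 0)"
    from sec_pencil_generic[OF lie f \<alpha> \<beta> \<phi>(1) gen avoid this]
    show "wedge_power (\<lambda>a b. s * sec_fun \<phi> \<alpha> (sec_bracket scl br a b)
      + t * sec_fun (\<lambda>v. 0) \<beta> (sec_bracket scl br a b)) (2 * r + 1) \<noteq> (\<lambda>x. 0)" by auto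
  qed
qed

section \<open>Passage to the complexification\<close>

lemma cpx_vector_space:
  assumes "vector_space scl" shows "vector_space (cpx_scale scl)"
proof -
  interpret vector_space scl by (rule assms)
  show ?thesis
    by unfold_locales
      (auto simp: cpx_scale_def scale_right_distrib scale_left_distrib scale_right_diff_distrib scale_left_diff_distrib algebra_simps)
qed

lemma cpx_lie_algebra:
  assumes "lie_algebra scl br" shows "lie_algebra (cpx_scale scl) (cpx_bracket br)"
proof -
  interpret lie_algebra scl br by (rule assms)
  interpret C: vector_space "cpx_scale scl" by (rule cpx_vector_space) (rule vector_space_axioms)
  show ?thesis
  proof unfold_locales
    fix x y z :: "'a \<times> 'a"
    obtain a a' where x: "x = (a, a')" by (cases x)
    obtain b b' where y: "y = (b, b')" by (cases y)
    obtain c c' where z: "z = (c, c')" by (cases z)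
    show "cpx_bracket br x x = 0"
      using bracket_skew[of a a'] by (simp add: x cpx_bracket_def bracket_self zero_prod_def)
    let ?j = "\<lambda>u v w. br u (br v w) + br v (br w u) + br w (br u v)"
    have "cpx_bracket br x (cpx_bracket br y z) + cpx_bracket br y (cpx_bracket br z x)
        + cpx_bracket br z (cpx_bracket br x y)
      = (?j a b c - ?j a b' c' - ?j a' b c' - ?j a' b' c,
         ?j a b c' + ?j a b' c + ?j a' b c - ?j a' b' c')"
      by (simp add: x y z cpx_bracket_def bracket_simps algebra_simps)
    then show "cpx_bracket br x (cpx_bracket br y z) + cpx_bracket br y (cpx_bracket br z x)
        + cpx_bracket br z (cpx_bracket br x y) = 0"
      by (simp add: jacobi zero_prod_def)
  qed (auto simp: cpx_bracket_def cpx_scale_def bracket_simps scale_right_distrib scale_right_diff_distrib algebra_simps)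
qed

lemma cpx_form_linear:
  assumes "linear_form scl \<alpha>" shows "linear_form (cpx_scale scl) (cpx_form \<alpha>)"
  unfolding linear_form_def cpx_form_def cpx_scale_def
  by (auto simp: linear_form_simps[OF assms] complex_eq_iff)

lemma cpx_frame:
  assumes f: "frame scl M b c"
  shows "frame (cpx_scale scl) M (\<lambda>i. (b i, 0)) (\<lambda>i. cpx_form (c i))"
proof -
  interpret vector_space scl using f by (simp add: frame_def)
  note c = frame_coordinate_linear[OF f]
  show ?thesis
    unfolding frame_def
  proof (intro conjI allI impI)
    show "vector_space (cpx_scale scl)" by (rule cpx_vector_space) (rule vector_space_axioms)
    fix i assume "i < M"
    then show "linear_form (cpx_scale scl) (cpx_form (c i))" by (intro cpx_form_linear c)
  next
    fix v :: "'a \<times> 'a"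
    obtain x y where v: "v = (x, y)" by (cases v)
    have "(\<Sum>i<M. cpx_scale scl (cpx_form (c i) v) (b i, 0)) = (\<Sum>i<M. (scl (c i x) (b i), scl (c i y) (b i)))"
      by (simp add: v cpx_scale_def cpx_form_def)
    then show "(\<Sum>i<M. cpx_scale scl (cpx_form (c i) v) (b i, 0)) = v"
      using f by (simp add: sum_prod v frame_def)
  next
    fix i j assume "i < M" "j < M"
    then show "cpx_form (c i) (b j, 0) = (if i = j then 1 else 0)"
      using f linear_form_zero[OF c] by (simp add: cpx_form_def frame_def complex_eq_iff)
  qed
qed

lemma wedge_of_real:
  assumes f: "\<And>x. f' (\<lambda>i. J (x i)) = complex_of_real (f x)" and g: "\<And>x. g' (\<lambda>i. J (x i)) = complex_of_real (g x)"
  shows "wedge p q f' g' (\<lambda>i. J (x i)) = complex_of_real (wedge p q f g x)"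
  unfolding wedge_def using f[of "\<lambda>i. x (_ i)"] g[of "\<lambda>i. x (_ i)"] by simp

lemma wedge_power_of_real:
  assumes "\<And>a b. \<omega>' (J a) (J b) = complex_of_real (\<omega> a b)"
  shows "wedge_power \<omega>' k (\<lambda>i. J (x i)) = complex_of_real (wedge_power \<omega> k x)"
proof (induction k arbitrary: x)
  case (Suc k)
  show ?case unfolding wedge_power.simps
    by (rule wedge_of_real) (simp_all add: of_two_form_def assms Suc)
qed simp

lemma wedge_power_pullback:
  assumes "\<And>a b. \<omega>' (J a) (J b) = \<omega> a b"
  shows "wedge_power \<omega>' k (\<lambda>i. J (x i)) = wedge_power \<omega> k x"
proof (induction k arbitrary: x)
  case (Suc k)
  then show ?case by (simp add: wedge_def of_two_form_def assms)
qed simp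

text \<open>
  A complex multilinear map is determined by its values on a real form: replace the arguments one
  at a time by their real or imaginary parts.
\<close>

lemma alternating_form_nonzero_on_real_points:
  assumes F: "alternating_form scl d F" and x: "F x \<noteq> 0"
    and J: "\<And>v. \<exists>a a'. v = J a + scl \<i> (J a')"
  shows "\<exists>y. F (\<lambda>i. J (y i)) \<noteq> 0"
proof -
  have "\<exists>x. F x \<noteq> 0 \<and> (\<forall>i<m. x i \<in> range J)" if "m \<le> d" for m
    using that
  proof (induction m)
    case 0
    then show ?case using x by auto
  next
    case (Suc m)
    then obtain x where x: "F x \<noteq> 0" "\<forall>i<m. x i \<in> range J" by auto
    obtain a a' where a: "x m = J a + scl \<i> (J a')" using J by blast
    have lin: "linear_form scl (\<lambda>v. F (x(m := v)))" using F Suc.prems unfolding alternating_form_def by auto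
    have "F x = F (x(m := x m))" by simp
    also have "\<dots> = F (x(m := J a)) + \<i> * F (x(m := J a'))"
      unfolding a by (simp add: linear_form_simps[OF lin])
    finally have "F (x(m := J a)) \<noteq> 0 \<or> F (x(m := J a')) \<noteq> 0" using x(1) by auto
    then obtain v where v: "F (x(m := v)) \<noteq> 0" "v \<in> range J" by blast
    moreover have "\<forall>i<Suc m. (x(m := v)) i \<in> range J" using x(2) v(2) by (simp add: less_Suc_eq)
    ultimately show ?case by blast
  qed
  from this[of d] obtain x where x: "F x \<noteq> 0" "\<forall>i<d. x i \<in> range J" by blast
  define y where "y i = inv J (x i)" for i
  have "\<forall>i<d. J (y i) = x i" using x(2) unfolding y_def by (simp add: f_inv_into_f)
  moreover have "F u = F w" if "\<forall>i<d. u i = w i" for u w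
    using F[unfolded alternating_form_def, THEN conjunct1] that by blast
  ultimately have "F (\<lambda>i. J (y i)) = F x" by simp
  then show ?thesis using x(1) by metis
qed

text \<open>
  The pencil is generic over the complexification by the complex computation. The linear form
  \<open>\<phi>\<close> can be chosen real, and genericity is then seen on real arguments.
\<close>

lemma sec_nonflat_generic_pair_real:
  fixes scl :: "real \<Rightarrow> 'b::ab_group_add \<Rightarrow> 'b"
  assumes lie: "lie_algebra scl br" and f: "frame scl (2 * r + 1) b c"
    and \<alpha>: "linear_form scl \<alpha>" and \<beta>: "linear_form scl \<beta>"
    and gen: "real_generic_couple (Suc r) scl br \<alpha> \<beta>" and nz: "wedge_d_power br \<beta> r \<noteq> (\<lambda>x. 0)"
  shows "\<exists>\<Lambda> \<Lambda>1. linear_poisson_pair (sec_scale scl) (sec_bracket scl br) \<Lambda> \<Lambda>1 \<and>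
    generic_pair complex_of_real (sec_scale scl) \<Lambda> \<Lambda>1 \<and> \<not> flat_pair complex_of_real (sec_scale scl) \<Lambda> \<Lambda>1"
proof -
  interpret lie_algebra scl br by (rule lie)
  let ?scl = "cpx_scale scl" and ?br = "cpx_bracket br"
  note Clie = cpx_lie_algebra[OF lie] and Cf = cpx_frame[OF f]
    and C\<alpha> = cpx_form_linear[OF \<alpha>] and C\<beta> = cpx_form_linear[OF \<beta>]
  interpret C: lie_algebra ?scl ?br by (rule Clie)
  have Cgen: "generic_couple (Suc r) ?scl ?br (cpx_form \<alpha>) (cpx_form \<beta>)"
    using gen by (simp add: real_generic_couple_def)
  obtain x where x: "wedge_d_power br \<beta> r x \<noteq> 0" using nz by auto
  have "wedge_d_power ?br (cpx_form \<beta>) r (\<lambda>i. (x i, 0)) = complex_of_real (wedge_d_power br \<beta> r x)"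
    unfolding wedge_d_power_def
  proof (intro wedge_of_real wedge_power_of_real)
    show "of_one_form (cpx_form \<beta>) (\<lambda>i. (x i, 0)) = complex_of_real (of_one_form \<beta> x)" for x
      by (simp add: of_one_form_def cpx_form_def linear_form_zero[OF \<beta>] complex_eq_iff)
    show "d_one ?br (cpx_form \<beta>) (a, 0) (b, 0) = complex_of_real (d_one br \<beta> a b)" for a b
      by (simp add: d_one_def cpx_bracket_def cpx_form_def bracket_simps linear_form_zero[OF \<beta>] complex_eq_iff)
  qed
  then have Cnz: "wedge_d_power ?br (cpx_form \<beta>) r \<noteq> (\<lambda>x. 0)" using x by auto
  obtain F where F: "finite F" "0 \<notin> F" "\<And>s t v. (s, t) \<noteq> (0, 0) \<Longrightarrow>
      degenerate_at ?br (cpx_form \<alpha>) (cpx_form \<beta>) s t v \<Longrightarrow> s \<noteq> 0 \<and> (\<exists>a. \<exists>w\<in>F. v = ?scl a w)"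
    using finite_degenerate_directions[OF Clie Cf C\<alpha> C\<beta> _ Cnz] Cgen unfolding generic_couple_def by blast
  have "\<exists>\<phi>. linear_form scl \<phi> \<and> (\<forall>v\<in>F. cpx_form \<phi> v \<noteq> 0)"
  proof (rule avoid_finitely_many_zeros[where ev = "\<lambda>v \<phi>. cpx_form \<phi> v" and \<iota> = complex_of_real, OF F(1)])
    fix v assume "v \<in> F"
    then have "v \<noteq> 0" using F(2) by blast
    then obtain u where u: "u = fst v \<or> u = snd v" "u \<noteq> 0" by (metis prod.collapse zero_prod_def)
    obtain \<phi> where "linear_form scl \<phi>" "\<phi> u \<noteq> 0"
      using frame_separates[OF f, of u 0] u(2) linear_form_zero by fastforce
    then show "\<exists>\<phi>. linear_form scl \<phi> \<and> cpx_form \<phi> v \<noteq> 0"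
      using u(1) by (intro exI[of _ \<phi>]) (auto simp: cpx_form_def complex_eq_iff split: prod.split)
  next
    show "cpx_form (\<lambda>x. \<phi> x + a * \<psi> x) v = cpx_form \<phi> v + complex_of_real a * cpx_form \<psi> v" for v \<phi> \<psi> a
      by (cases v) (simp add: cpx_form_def complex_eq_iff)
  qed (simp_all add: infinite_UNIV_char_0 inj_of_real)
  then obtain \<phi> where \<phi>: "linear_form scl \<phi>" "\<And>v. v \<in> F \<Longrightarrow> cpx_form \<phi> v \<noteq> 0" by blast
  note C\<phi> = cpx_form_linear[OF \<phi>(1)]
  have avoid: "s * cpx_form \<phi> v \<noteq> 0" if st: "(s, t) \<noteq> (0, 0)"
    and d: "degenerate_at ?br (cpx_form \<alpha>) (cpx_form \<beta>) s t v" for s t v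
  proof -
    obtain a w where w: "s \<noteq> 0" "w \<in> F" "v = ?scl a w" using F(3)[OF st d] by blast
    have "a \<noteq> 0" using d w by (auto simp: degenerate_at_def)
    then show ?thesis using w \<phi> by (simp add: linear_form_simps[OF C\<phi>])
  qed
  \<comment> \<open>the inclusion of the real secondary algebra in the one of the complexification\<close>
  define J :: "'b \<times> 'b \<times> real \<Rightarrow> ('b \<times> 'b) \<times> ('b \<times> 'b) \<times> complex"
    where "J = (\<lambda>(v, v', s). ((v, 0), (v', 0), complex_of_real s))"
  have J: "\<exists>a a'. v = J a + sec_scale ?scl \<i> (J a')" for v
  proof -
    obtain x y x' y' s where v: "v = ((x, y), (x', y'), s)" by (metis prod.collapse)
    show ?thesis
      by (rule exI[of _ "(x, x', Re s)"], rule exI[of _ "(y, y', Im s)"])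
        (simp add: v J_def sec_scale_def cpx_scale_def complex_eq_iff)
  qed
  have J_form: "sec_fun (cpx_form \<phi>) (cpx_form \<zeta>) (sec_bracket ?scl ?br (J a) (J b))
      = complex_of_real (sec_fun \<phi> \<zeta> (sec_bracket scl br a b))"
    if "linear_form scl \<phi>" "linear_form scl \<zeta>" for \<phi> \<zeta> a b
    by (cases a, cases b) (simp add: J_def sec_bracket_apply sec_fun_def cpx_bracket_def cpx_scale_def
        cpx_form_def bracket_simps linear_form_simps[OF that(1)] linear_form_simps[OF that(2)] complex_eq_iff)
  have zero: "linear_form scl (\<lambda>v. 0)" by (simp add: linear_form_def)
  have zero_C: "cpx_form (\<lambda>v. 0) = (\<lambda>v. 0)" by (simp add: cpx_form_def fun_eq_iff complex_eq_iff)
  interpret S: lie_algebra "sec_scale ?scl" "sec_bracket ?scl ?br" by (rule sec_lie_algebra[OF Clie])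
  show ?thesis
  proof (rule sec_nonflat_generic_pair[OF lie f \<alpha> \<beta> \<phi>(1) nz])
    fix s t :: complex assume st: "(s, t) \<noteq> (0, 0)"
    let ?\<omega> = "\<lambda>a b. s * sec_fun (cpx_form \<phi>) (cpx_form \<alpha>) (sec_bracket ?scl ?br a b)
      + t * sec_fun (\<lambda>v. 0) (cpx_form \<beta>) (sec_bracket ?scl ?br a b)"
    have lin: "linear_form (sec_scale ?scl) (\<lambda>x. s * sec_fun (cpx_form \<phi>) (cpx_form \<alpha>) x + t * sec_fun (\<lambda>v. 0) (cpx_form \<beta>) x)"
      using cpx_form_linear[OF zero] unfolding zero_C
      by (intro pencil_linear_form sec_fun_linear C\<phi> C\<alpha> C\<beta>)
    obtain x where x: "wedge_power ?\<omega> (2 * r + 1) x \<noteq> 0"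
      using sec_pencil_generic[OF Clie Cf C\<alpha> C\<beta> C\<phi> Cgen _ st] avoid by blast
    obtain y where y: "wedge_power ?\<omega> (2 * r + 1) (\<lambda>i. J (y i)) \<noteq> 0"
      using alternating_form_nonzero_on_real_points[OF wedge_power_alternating[OF S.linear_form_bracket_alt[OF lin]] x J]
      by blast
    have "wedge_power ?\<omega> (2 * r + 1) (\<lambda>i. J (y i)) = wedge_power (\<lambda>a b. s * complex_of_real (sec_fun \<phi> \<alpha> (sec_bracket scl br a b))
      + t * complex_of_real (sec_fun (\<lambda>v. 0) \<beta> (sec_bracket scl br a b))) (2 * r + 1) y"
      by (rule wedge_power_pullback) (simp add: J_form[OF \<phi>(1) \<alpha>] J_form[OF zero \<beta>, unfolded zero_C])
    then show "wedge_power (\<lambda>a b. s * complex_of_real (sec_fun \<phi> \<alpha> (sec_bracket scl br a b))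
      + t * complex_of_real (sec_fun (\<lambda>v. 0) \<beta> (sec_bracket scl br a b))) (2 * r + 1) \<noteq> (\<lambda>x. 0)"
      using y by auto
  qed
qed

theorem proposition4:
  fixes n :: nat
    and rscale :: "real \<Rightarrow> 'a::ab_group_add \<Rightarrow> 'a" and rbracket :: "'a \<Rightarrow> 'a \<Rightarrow> 'a"
    and cscale :: "complex \<Rightarrow> 'b::ab_group_add \<Rightarrow> 'b" and cbracket :: "'b \<Rightarrow> 'b \<Rightarrow> 'b"
  assumes "2 \<le> n"
  shows
    "(lie_algebra rscale rbracket \<and> vector_space.dim rscale UNIV = 2 * n - 1 \<and>
      (\<exists>\<alpha>\<in>dual_space rscale. \<exists>\<beta>\<in>dual_space rscale.
         real_generic_couple n rscale rbracket \<alpha> \<beta> \<and>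
         wedge_d_power rbracket \<beta> (n - 1) \<noteq> (\<lambda>x. 0))
      \<longrightarrow>
      (\<exists>\<Lambda> \<Lambda>1. linear_poisson_pair (sec_scale rscale) (sec_bracket rscale rbracket) \<Lambda> \<Lambda>1 \<and>
         generic_pair complex_of_real (sec_scale rscale) \<Lambda> \<Lambda>1 \<and>
         \<not> flat_pair complex_of_real (sec_scale rscale) \<Lambda> \<Lambda>1))
     \<and>
     (lie_algebra cscale cbracket \<and> vector_space.dim cscale UNIV = 2 * n - 1 \<and>
      (\<exists>\<alpha>\<in>dual_space cscale. \<exists>\<beta>\<in>dual_space cscale.
         generic_couple n cscale cbracket \<alpha> \<beta> \<and>
         wedge_d_power cbracket \<beta> (n - 1) \<noteq> (\<lambda>x. 0))
      \<longrightarrow>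
      (\<exists>\<Lambda> \<Lambda>1. linear_poisson_pair (sec_scale cscale) (sec_bracket cscale cbracket) \<Lambda> \<Lambda>1 \<and>
         generic_pair (\<lambda>z. z) (sec_scale cscale) \<Lambda> \<Lambda>1 \<and>
         \<not> flat_pair (\<lambda>z. z) (sec_scale cscale) \<Lambda> \<Lambda>1))"
proof (intro conjI impI; elim conjE bexE)
  obtain r where n: "n = Suc r" using assms by (cases n) auto
  have dim: "2 * n - 1 = 2 * r + 1" "2 * r + 1 > 0" by (simp_all add: n)
  {
    fix \<alpha> \<beta>
    assume lie: "lie_algebra rscale rbracket" and d: "vector_space.dim rscale UNIV = 2 * n - 1"
      and \<alpha>: "\<alpha> \<in> dual_space rscale" and \<beta>: "\<beta> \<in> dual_space rscale"
      and gen: "real_generic_couple n rscale rbracket \<alpha> \<beta>"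
      and nz: "wedge_d_power rbracket \<beta> (n - 1) \<noteq> (\<lambda>x. 0)"
    interpret lie_algebra rscale rbracket by (rule lie)
    obtain b c where "frame rscale (2 * r + 1) b c"
      using frame_exists[OF vector_space_axioms d[unfolded dim(1)] dim(2)] by blast
    from sec_nonflat_generic_pair_real[OF lie this, of \<alpha> \<beta>]
    show "\<exists>\<Lambda> \<Lambda>1. linear_poisson_pair (sec_scale rscale) (sec_bracket rscale rbracket) \<Lambda> \<Lambda>1 \<and>
         generic_pair complex_of_real (sec_scale rscale) \<Lambda> \<Lambda>1 \<and>
         \<not> flat_pair complex_of_real (sec_scale rscale) \<Lambda> \<Lambda>1"
      using \<alpha> \<beta> gen nz dual_space_iff[OF vector_space_axioms] by (simp add: n)
  }
  {
    fix \<alpha> \<beta>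
    assume lie: "lie_algebra cscale cbracket" and d: "vector_space.dim cscale UNIV = 2 * n - 1"
      and \<alpha>: "\<alpha> \<in> dual_space cscale" and \<beta>: "\<beta> \<in> dual_space cscale"
      and gen: "generic_couple n cscale cbracket \<alpha> \<beta>"
      and nz: "wedge_d_power cbracket \<beta> (n - 1) \<noteq> (\<lambda>x. 0)"
    interpret lie_algebra cscale cbracket by (rule lie)
    obtain b c where "frame cscale (2 * r + 1) b c"
      using frame_exists[OF vector_space_axioms d[unfolded dim(1)] dim(2)] by blast
    from sec_nonflat_generic_pair_complex[OF lie this, of \<alpha> \<beta>]
    show "\<exists>\<Lambda> \<Lambda>1. linear_poisson_pair (sec_scale cscale) (sec_bracket cscale cbracket) \<Lambda> \<Lambda>1 \<and>
         generic_pair (\<lambda>z. z) (sec_scale cscale) \<Lambda> \<Lambda>1 \<and>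
         \<not> flat_pair (\<lambda>z. z) (sec_scale cscale) \<Lambda> \<Lambda>1"
      using \<alpha> \<beta> gen nz dual_space_iff[OF vector_space_axioms] by (simp add: n)
  }
qed

end
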